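(* Let $(X,g,\mu_g)$ be a $2$-parabolic (Riemannian) pseudomanifold (with $\partial X=\emptyset$). Let $f\in W^{1,2}_{\mathrm{loc}}(X)$ be a continuous, weakly subharmonic function such that $\|\nabla f\|_{L^1}$ and $\|\nabla f\|_{L^2}$ are finite. Then $f$ is harmonic.
   Context: Riemannian polyhedra. A polyhedron is a connected locally compact separable Hausdorff space $X$ homeomorphic, via some $\theta:|K|\to X$, to the space $|K|$ of a countable, locally finite simplicial complex $K$ of finite dimension; $(K,\theta)$ is a triangulation. $|K|$ carries the barycentric distance $\rho(\alpha,\beta)=(\sum_v(\alpha(v)-\beta(v))^2)^{1/2}$ and is affinely Lipschitz-homeomorphically embedded as a closed subset of a Euclidean space. $X$ is a Lipschitz polyhedron if it is a metric space and $\theta$ is a Lipschitz homeomorphism. A Riemannian polyhedron is a Lipschitz polyhedron $X$ such that, for some triangulation, each maximal simplex $s$ (viewed in the Euclidean space) carries a measurable Riemannian metric $g^s=g_{ij}dx^idx^j$ with $\Lambda^{-2}\|\xi\|^2\le g_{ij}(x)\xi^i\xi^j\le\Lambda^2\|\xi\|^2$ for a.e. $x\in s$, with $\Lambda$ independent of $s$. $d_X=d_X^g$ is the associated intrinsic distance: $d_X^g(x,y)$ is the supremum, over null sets $Z$, of the infimum of $g$-lengths of Lipschitz paths from $x$ to $y$ meeting $Z$ only on a parameter set of measure zero. The volume measure $\mu_g$ is given simplexwise by $d\mu_g=\sqrt{\det(g_{ij})}\,dx_1\cdots dx_n$. $X^{k}$ denotes the $k$-skeleton. Admissible: in some (hence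 any) triangulation, all maximal simplexes have the same dimension $n=\dim X$, and for every connected open $U\subset X$ the set $U\setminus X^{n-2}$ is connected. $\partial X$ is the union of all non-maximal simplexes contained in only one maximal simplex; it is always assumed that $\partial X=\emptyset$. An $n$-circuit is a polyhedron of homogeneous dimension $n$ such that every $(n-1)$-simplex is a face of at most two $n$-simplexes (exactly two if $\partial X=\emptyset$) and $X\setminus X^{n-2}$ is connected. A pseudomanifold is an admissible circuit. Sobolev spaces. $W^{1,2}(X)$ is the completion of the space of Lipschitz functions $u:(X,d_X)\to\mathbb R$ with finite norm $\|u\|_{1,2}^2=\int_X(u^2+|\nabla u|^2)\,d\mu_g$, where $\nabla u$ is the Riemannian gradient, defined a.e. on each $n$-simplex. $\mathrm{Lip}_c(X)$: Lipschitz functions with compact support. $W_0^{1,2}(X)$: closure of $\mathrm{Lip}_c(X)$ in $W^{1,2}(X)$ (similarly for domains). $W^{1,2}_{\mathrm{loc}}(X)$: all $u\in L^2_{\mathrm{loc}}(X)$ with $u\in W^{1,2}(U)$ for all relatively compact subdomains $U\subset X$. $\|\nabla f\|_{L^p}=(\int_X|\nabla f|^p\,d\mu_g)^{1/p}$. $f\in W^{1,2}_{\mathrm{loc}}(X)$ is weakly subharmonic if $\int_X\langle\nabla f,\nabla\rho\rangle\,d\mu_g\le 0$ for every non-negative $\rho\in\mathrm{Lip}_c(X)$, and weakly harmonic if $\int_X\langle\nabla f,\nabla\rho\rangle\,d\mu_g=0$ for every $\rho\in\mathrm{Lip}_c(X)$. A harmonic function is a continuous weakly harmonic function. $2$-parabolicity.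 For $E\subset\Omega$, $\mathrm{cap}(E,\Omega)=\inf\int_\Omega|\nabla u|^2\,d\mu_g$ over $u\in W^{1,2}_0(\Omega)$ with $u\ge1$ on $E$ (equivalently, over such $u$ with $u\le1$ and $u=1$ on a neighborhood of $E$). A domain (connected open set) $\Omega\subset X$ is $2$-parabolic if $\mathrm{cap}(D,\Omega)=0$ for every compact $D\subset\Omega$; $X$ is $2$-parabolic if this holds with $\Omega=X$. *)

theory Defs
  imports "HOL-Analysis.Analysis"
begin

section \<open>Simplicial complexes and their spaces\<close>

text \<open>A complex is given by its simplexes, a simplex by its finite set of vertices.\<close>

definition simplicial_complex_abs :: "'v set set \<Rightarrow> bool" where
  "simplicial_complex_abs K \<longleftrightarrow>
     (\<forall>s\<in>K. finite s \<and> s \<noteq> {}) \<and> (\<forall>s\<in>K. \<forall>t. t \<subseteq> s \<and> t \<noteq> {} \<longrightarrow> t \<in> K)"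

definition locally_finite_complex :: "'v set set \<Rightarrow> bool" where
  "locally_finite_complex K \<longleftrightarrow> (\<forall>v. finite {s \<in> K. v \<in> s})"

definition finite_dim_complex :: "'v set set \<Rightarrow> bool" where
  "finite_dim_complex K \<longleftrightarrow> (\<exists>d. \<forall>s\<in>K. card s \<le> d + 1)"

definition maximal_simplexes :: "'v set set \<Rightarrow> 'v set set" where
  "maximal_simplexes K = {s \<in> K. \<forall>t\<in>K. s \<subseteq> t \<longrightarrow> t = s}"

definition supp :: "('v \<Rightarrow> real) \<Rightarrow> 'v set" where
  "supp \<alpha> = {v. \<alpha> v \<noteq> 0}"

definition realization :: "'v set set \<Rightarrow> ('v \<Rightarrow> real) set" where
  "realization K = {\<alpha>. (\<forall>v. 0 \<le> \<alpha> v) \<and> supp \<alpha> \<in> K \<and> (\<Sum>v\<in>supp \<alpha>. \<alpha> v) = 1}"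

definition bary_dist :: "('v \<Rightarrow> real) \<Rightarrow> ('v \<Rightarrow> real) \<Rightarrow> real" where
  "bary_dist \<alpha> \<beta> = sqrt (\<Sum>v\<in>supp \<alpha> \<union> supp \<beta>. (\<alpha> v - \<beta> v)\<^sup>2)"

text \<open>\<open>Lipschitz\<close> is understood locally. The barycentric distance is bounded by \<open>sqrt 2\<close>, and
  distinct vertices are at mutual distance \<open>sqrt 2\<close>, so an infinite complex has no globally
  bi-Lipschitz embedding into a Euclidean space.\<close>

definition loc_lipschitz_map ::
    "('p \<Rightarrow> 'p \<Rightarrow> real) \<Rightarrow> 'p set \<Rightarrow> ('q \<Rightarrow> 'q \<Rightarrow> real) \<Rightarrow> ('p \<Rightarrow> 'q) \<Rightarrow> bool" where
  "loc_lipschitz_map d A d' f \<longleftrightarrow>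
     (\<forall>x\<in>A. \<exists>r>0. \<exists>L. \<forall>y\<in>A. \<forall>z\<in>A. d x y < r \<longrightarrow> d x z < r \<longrightarrow> d' (f y) (f z) \<le> L * d y z)"

definition lipschitz_homeo ::
    "('p \<Rightarrow> 'p \<Rightarrow> real) \<Rightarrow> 'p set \<Rightarrow> ('q \<Rightarrow> 'q \<Rightarrow> real) \<Rightarrow> 'q set \<Rightarrow> ('p \<Rightarrow> 'q) \<Rightarrow> bool" where
  "lipschitz_homeo d A d' B f \<longleftrightarrow>
     bij_betw f A B \<and> loc_lipschitz_map d A d' f \<and> loc_lipschitz_map d' B d (inv_into A f)"

text \<open>When the vertices are points of a Euclidean space, a point with barycentric coordinates
  \<open>\<alpha>\<close> is placed affinely.\<close>

definition bary_embed :: "('e::euclidean_space \<Rightarrow> real) \<Rightarrow> 'e" where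
  "bary_embed \<alpha> = (\<Sum>v\<in>supp \<alpha>. \<alpha> v *\<^sub>R v)"

section \<open>Riemannian polyhedra\<close>

text \<open>The space \<open>X\<close> is the whole type \<open>'a\<close>, and \<open>n = CARD('n)\<close> is its dimension.

  \<^item> \<open>cplx\<close> is the complex \<open>K\<close>, whose vertices are labelled by their images under the affine
    embedding of \<open>|K|\<close> into the Euclidean space \<open>'e\<close>;
  \<^item> \<open>triang\<close> is the map \<open>\<theta> : |K| \<rightarrow> X\<close>;
  \<^item> \<open>chart s\<close>, for a maximal simplex \<open>s\<close>, parametrises the affine hull of \<open>s\<close> in \<open>'e\<close> by
    Euclidean coordinates;
  \<^item> \<open>gmat s x\<close> is the matrix \<open>g\<^sub>i\<^sub>j(x)\<close> of the metric on \<open>s\<close> in these coordinates.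

  Charts and matrices are only meaningful for maximal simplexes.\<close>

record ('e, 'a, 'n::finite) rpoly =
  cplx :: "'e set set"
  triang :: "('e \<Rightarrow> real) \<Rightarrow> 'a"
  chart :: "'e set \<Rightarrow> (real ^ 'n) \<Rightarrow> 'e"
  gmat :: "'e set \<Rightarrow> (real ^ 'n) \<Rightarrow> (real ^ 'n) ^ 'n"

definition maxs :: "('e, 'a, 'n::finite) rpoly \<Rightarrow> 'e set set" where
  "maxs P = maximal_simplexes (cplx P)"

definition bary :: "('e, 'a, 'n::finite) rpoly \<Rightarrow> 'a \<Rightarrow> ('e \<Rightarrow> real)" where
  "bary P = inv_into (realization (cplx P)) (triang P)"

text \<open>The simplex whose relative interior contains the given point.\<close>

definition carrier_simplex :: "('e, 'a, 'n::finite) rpoly \<Rightarrow> 'a \<Rightarrow> 'e set" where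
  "carrier_simplex P p = supp (bary P p)"

definition pos :: "('e::euclidean_space, 'a, 'n::finite) rpoly \<Rightarrow> 'a \<Rightarrow> 'e" where
  "pos P p = bary_embed (bary P p)"

definition closed_simplex :: "('e, 'a, 'n::finite) rpoly \<Rightarrow> 'e set \<Rightarrow> 'a set" where
  "closed_simplex P s = {p. carrier_simplex P p \<subseteq> s}"

text \<open>\<open>skeleton P k\<close> is empty for negative \<open>k\<close>.\<close>

definition skeleton :: "('e, 'a, 'n::finite) rpoly \<Rightarrow> int \<Rightarrow> 'a set" where
  "skeleton P k = {p. int (card (carrier_simplex P p)) - 1 \<le> k}"

definition boundary_poly :: "('e, 'a, 'n::finite) rpoly \<Rightarrow> 'a set" where
  "boundary_poly P =
     \<Union> (closed_simplex P ` {s \<in> cplx P. s \<notin> maxs P \<and> (\<exists>!t. t \<in> maxs P \<and> s \<subseteq> t)})"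

definition lipschitz_polyhedron ::
    "('e::euclidean_space, 'a::metric_space, 'n::finite) rpoly \<Rightarrow> bool" where
  "lipschitz_polyhedron P \<longleftrightarrow>
     connected (UNIV :: 'a set) \<and> locally compact (UNIV :: 'a set) \<and>
     (\<exists>D :: 'a set. countable D \<and> closure D = UNIV) \<and>
     simplicial_complex_abs (cplx P) \<and> countable (cplx P) \<and>
     locally_finite_complex (cplx P) \<and> finite_dim_complex (cplx P) \<and>
     lipschitz_homeo bary_dist (realization (cplx P)) dist UNIV (triang P) \<and>
     lipschitz_homeo bary_dist (realization (cplx P)) dist
       (bary_embed ` realization (cplx P)) bary_embed \<and>
     closed (bary_embed ` realization (cplx P))"

definition homogeneous :: "('e, 'a, 'n::finite) rpoly \<Rightarrow> bool" where
  "homogeneous P \<longleftrightarrow> (\<forall>s\<in>maxs P. card s = CARD('n) + 1)"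

text \<open>A maximal simplex in its Euclidean coordinates, and the corresponding point of \<open>X\<close>.\<close>

definition cell :: "('e::euclidean_space, 'a, 'n::finite) rpoly \<Rightarrow> 'e set \<Rightarrow> (real ^ 'n) set" where
  "cell P s = {x. chart P s x \<in> convex hull s}"

definition point :: "('e::euclidean_space, 'a, 'n::finite) rpoly \<Rightarrow> 'e set \<Rightarrow> real ^ 'n \<Rightarrow> 'a" where
  "point P s x = inv (pos P) (chart P s x)"

definition coord :: "('e::euclidean_space, 'a, 'n::finite) rpoly \<Rightarrow> 'e set \<Rightarrow> 'a \<Rightarrow> real ^ 'n" where
  "coord P s p = inv (chart P s) (pos P p)"

definition euclidean_chart :: "('e::euclidean_space) set \<Rightarrow> (real ^ 'n::finite \<Rightarrow> 'e) \<Rightarrow> bool" where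
  "euclidean_chart s c \<longleftrightarrow>
     linear (\<lambda>x. c x - c 0) \<and> (\<forall>x. norm (c x - c 0) = norm x) \<and> range c = affine hull s"

definition riemannian_polyhedron ::
    "('e::euclidean_space, 'a::metric_space, 'n::finite) rpoly \<Rightarrow> bool" where
  "riemannian_polyhedron P \<longleftrightarrow>
     lipschitz_polyhedron P \<and> homogeneous P \<and>
     (\<forall>s\<in>maxs P. euclidean_chart s (chart P s) \<and>
        gmat P s \<in> borel_measurable (lebesgue_on (cell P s)) \<and>
        (AE x in lebesgue_on (cell P s). transpose (gmat P s x) = gmat P s x)) \<and>
     (\<exists>\<Lambda>>0. \<forall>s\<in>maxs P. AE x in lebesgue_on (cell P s). \<forall>\<xi>.
        inverse (\<Lambda>\<^sup>2) * (norm \<xi>)\<^sup>2 \<le> \<xi> \<bullet> (gmat P s x *v \<xi>) \<and>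
        \<xi> \<bullet> (gmat P s x *v \<xi>) \<le> \<Lambda>\<^sup>2 * (norm \<xi>)\<^sup>2)"

section \<open>Pseudomanifolds\<close>

definition admissible :: "('e, 'a::metric_space, 'n::finite) rpoly \<Rightarrow> bool" where
  "admissible P \<longleftrightarrow> homogeneous P \<and>
     (\<forall>U. open U \<and> connected U \<longrightarrow> connected (U - skeleton P (int CARD('n) - 2)))"

definition circuit :: "('e, 'a::metric_space, 'n::finite) rpoly \<Rightarrow> bool" where
  "circuit P \<longleftrightarrow> homogeneous P \<and>
     (\<forall>s\<in>cplx P. card s = CARD('n) \<longrightarrow>
        card {t \<in> cplx P. card t = CARD('n) + 1 \<and> s \<subseteq> t} \<le> 2) \<and>
     connected (UNIV - skeleton P (int CARD('n) - 2))"

definition pseudomanifold :: "('e, 'a::metric_space, 'n::finite) rpoly \<Rightarrow> bool" where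
  "pseudomanifold P \<longleftrightarrow> admissible P \<and> circuit P"

section \<open>Volume and intrinsic distance\<close>

text \<open>The measure is completed, since \<open>g\<close> is only Lebesgue measurable on each simplex.\<close>

definition vol :: "('e::euclidean_space, 'a::metric_space, 'n::finite) rpoly \<Rightarrow> 'a measure" where
  "vol P = completion (measure_of UNIV (sets borel)
     (\<lambda>A. \<integral>\<^sup>+s. (\<integral>\<^sup>+x\<in>{x \<in> cell P s. point P s x \<in> A}. ennreal (sqrt (det (gmat P s x))) \<partial>lebesgue)
        \<partial>count_space (maxs P)))"

text \<open>A tangent vector at a point in the relative interior of a maximal simplex is given by its
  components in the chart of that simplex. The remaining points form a null set.\<close>

definition g_at ::
    "('e::euclidean_space, 'a, 'n::finite) rpoly \<Rightarrow> 'a \<Rightarrow> (real ^ 'n) ^ 'n" where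
  "g_at P p = gmat P (carrier_simplex P p) (coord P (carrier_simplex P p) p)"

definition ginner ::
    "('e::euclidean_space, 'a, 'n::finite) rpoly \<Rightarrow> 'a \<Rightarrow> real ^ 'n \<Rightarrow> real ^ 'n \<Rightarrow> real" where
  "ginner P p \<xi> \<eta> = \<xi> \<bullet> (g_at P p *v \<eta>)"

definition gnorm :: "('e::euclidean_space, 'a, 'n::finite) rpoly \<Rightarrow> 'a \<Rightarrow> real ^ 'n \<Rightarrow> real" where
  "gnorm P p \<xi> = sqrt (ginner P p \<xi> \<xi>)"

text \<open>The value \<open>0\<close> off the maximal open simplexes is immaterial for the intrinsic distance, since
  that set may be added to the null sets over which the supremum is taken.\<close>

definition gspeed ::
    "('e::euclidean_space, 'a, 'n::finite) rpoly \<Rightarrow> (real \<Rightarrow> 'a) \<Rightarrow> real \<Rightarrow> real" where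
  "gspeed P \<gamma> t =
     (if carrier_simplex P (\<gamma> t) \<in> maxs P
      then gnorm P (\<gamma> t)
             (vector_derivative (\<lambda>\<tau>. coord P (carrier_simplex P (\<gamma> t)) (\<gamma> \<tau>)) (at t within {0..1}))
      else 0)"

definition glength ::
    "('e::euclidean_space, 'a, 'n::finite) rpoly \<Rightarrow> (real \<Rightarrow> 'a) \<Rightarrow> ennreal" where
  "glength P \<gamma> = (\<integral>\<^sup>+t\<in>{0..1}. ennreal (gspeed P \<gamma> t) \<partial>lebesgue)"

definition transversal_paths ::
    "'a::metric_space set \<Rightarrow> 'a \<Rightarrow> 'a \<Rightarrow> (real \<Rightarrow> 'a) set" where
  "transversal_paths Z x y = {\<gamma>. (\<exists>L. L-lipschitz_on {0..1} \<gamma>) \<and> \<gamma> 0 = x \<and> \<gamma> 1 = y \<and>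
     negligible {t \<in> {0..1}. \<gamma> t \<in> Z}}"

definition intrinsic_dist ::
    "('e::euclidean_space, 'a::metric_space, 'n::finite) rpoly \<Rightarrow> 'a \<Rightarrow> 'a \<Rightarrow> ennreal" where
  "intrinsic_dist P x y =
     (SUP Z\<in>null_sets (vol P). INF \<gamma>\<in>transversal_paths Z x y. glength P \<gamma>)"

section \<open>Lipschitz functions and Sobolev spaces\<close>

definition lip_on ::
    "('e::euclidean_space, 'a::metric_space, 'n::finite) rpoly \<Rightarrow> 'a set \<Rightarrow> ('a \<Rightarrow> real) \<Rightarrow> bool" where
  "lip_on P U u \<longleftrightarrow>
     (\<exists>L\<ge>0. \<forall>x\<in>U. \<forall>y\<in>U. ennreal \<bar>u x - u y\<bar> \<le> ennreal L * intrinsic_dist P x y)"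

definition Lip_c ::
    "('e::euclidean_space, 'a::metric_space, 'n::finite) rpoly \<Rightarrow> 'a set \<Rightarrow> ('a \<Rightarrow> real) set" where
  "Lip_c P \<Omega> = {u. lip_on P \<Omega> u \<and>
     compact (closure {x \<in> \<Omega>. u x \<noteq> 0}) \<and> closure {x \<in> \<Omega>. u x \<noteq> 0} \<subseteq> \<Omega>}"

text \<open>The components \<open>g\<^sup>i\<^sup>j \<partial>\<^sub>j u\<close> of the Riemannian gradient of a Lipschitz function, at points of
  differentiability.\<close>

definition lip_grad ::
    "('e::euclidean_space, 'a, 'n::finite) rpoly \<Rightarrow> ('a \<Rightarrow> real) \<Rightarrow> 'a \<Rightarrow> real ^ 'n" where
  "lip_grad P u p = matrix_inv (g_at P p) *v
     (THE D. GDERIV (\<lambda>x. u (point P (carrier_simplex P p) x))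
               (coord P (carrier_simplex P p) p) :> D)"

text \<open>\<open>sobolev_sq P U u G\<close> is the square of the \<open>W\<^sup>1\<^sup>,\<^sup>2(U)\<close>-norm of \<open>u\<close> when \<open>G\<close> is the gradient
  of \<open>u\<close>.\<close>

definition sobolev_sq ::
    "('e::euclidean_space, 'a::metric_space, 'n::finite) rpoly \<Rightarrow> 'a set \<Rightarrow>
     ('a \<Rightarrow> real) \<Rightarrow> ('a \<Rightarrow> real ^ 'n) \<Rightarrow> ennreal" where
  "sobolev_sq P U u G = (\<integral>\<^sup>+p\<in>U. ennreal ((u p)\<^sup>2 + (gnorm P p (G p))\<^sup>2) \<partial>vol P)"

text \<open>The completion is realised in \<open>L\<^sup>2\<close>: its elements are the \<open>L\<^sup>2\<close>-limits \<open>u\<close> of Cauchy sequences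
  of Lipschitz functions, and the gradient of \<open>u\<close> is the limit \<open>G\<close> of their gradients, which is
  determined by \<open>u\<close> almost everywhere.\<close>

definition has_sobolev_grad ::
    "('e::euclidean_space, 'a::metric_space, 'n::finite) rpoly \<Rightarrow> 'a set \<Rightarrow>
     ('a \<Rightarrow> real) \<Rightarrow> ('a \<Rightarrow> real ^ 'n) \<Rightarrow> bool" where
  "has_sobolev_grad P U u G \<longleftrightarrow>
     u \<in> borel_measurable (restrict_space (vol P) U) \<and>
     G \<in> borel_measurable (restrict_space (vol P) U) \<and>
     (\<exists>v :: nat \<Rightarrow> 'a \<Rightarrow> real.
        (\<forall>k. lip_on P U (v k) \<and> sobolev_sq P U (v k) (lip_grad P (v k)) < \<infinity>) \<and>
        (\<lambda>k. sobolev_sq P U (\<lambda>p. v k p - u p) (\<lambda>p. lip_grad P (v k) p - G p)) \<longlonglongrightarrow> 0)"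

definition W12 ::
    "('e::euclidean_space, 'a::metric_space, 'n::finite) rpoly \<Rightarrow> 'a set \<Rightarrow> ('a \<Rightarrow> real) set" where
  "W12 P U = {u. \<exists>G. has_sobolev_grad P U u G}"

definition sobolev_grad ::
    "('e::euclidean_space, 'a::metric_space, 'n::finite) rpoly \<Rightarrow> 'a set \<Rightarrow>
     ('a \<Rightarrow> real) \<Rightarrow> 'a \<Rightarrow> real ^ 'n" where
  "sobolev_grad P U u = (SOME G. has_sobolev_grad P U u G)"

definition W12_0 ::
    "('e::euclidean_space, 'a::metric_space, 'n::finite) rpoly \<Rightarrow> 'a set \<Rightarrow> ('a \<Rightarrow> real) set" where
  "W12_0 P \<Omega> = {u \<in> W12 P \<Omega>. \<exists>v :: nat \<Rightarrow> 'a \<Rightarrow> real. (\<forall>k. v k \<in> Lip_c P \<Omega>) \<and>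
     (\<lambda>k. sobolev_sq P \<Omega> (\<lambda>p. v k p - u p) (\<lambda>p. lip_grad P (v k) p - sobolev_grad P \<Omega> u p))
       \<longlonglongrightarrow> 0}"

definition rel_compact_domain :: "'a::metric_space set \<Rightarrow> bool" where
  "rel_compact_domain U \<longleftrightarrow> open U \<and> connected U \<and> compact (closure U)"

definition L2_loc ::
    "('e::euclidean_space, 'a::metric_space, 'n::finite) rpoly \<Rightarrow> ('a \<Rightarrow> real) set" where
  "L2_loc P = {u \<in> borel_measurable (vol P).
     \<forall>D. compact D \<longrightarrow> (\<integral>\<^sup>+p\<in>D. ennreal ((u p)\<^sup>2) \<partial>vol P) < \<infinity>}"

definition W12_loc ::
    "('e::euclidean_space, 'a::metric_space, 'n::finite) rpoly \<Rightarrow> ('a \<Rightarrow> real) set" where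
  "W12_loc P = {u \<in> L2_loc P. \<forall>U. rel_compact_domain U \<longrightarrow> u \<in> W12 P U}"

text \<open>The gradient on \<open>X\<close> of an element of \<open>W\<^sup>1\<^sup>,\<^sup>2\<^sub>l\<^sub>o\<^sub>c(X)\<close>: the field, unique almost everywhere, that
  is its gradient on each relatively compact subdomain.\<close>

definition loc_grad ::
    "('e::euclidean_space, 'a::metric_space, 'n::finite) rpoly \<Rightarrow> ('a \<Rightarrow> real) \<Rightarrow> 'a \<Rightarrow> real ^ 'n" where
  "loc_grad P f = (SOME G. \<forall>U. rel_compact_domain U \<longrightarrow> has_sobolev_grad P U f G)"

definition grad_Lp_norm ::
    "('e::euclidean_space, 'a::metric_space, 'n::finite) rpoly \<Rightarrow> real \<Rightarrow> ('a \<Rightarrow> real) \<Rightarrow> ennreal" where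
  "grad_Lp_norm P p f =
     (let I = \<integral>\<^sup>+x. ennreal (gnorm P x (loc_grad P f x) powr p) \<partial>vol P
      in if I = \<infinity> then \<infinity> else ennreal (enn2real I powr (1 / p)))"

section \<open>Subharmonic and harmonic functions, parabolicity\<close>

definition weakly_subharmonic ::
    "('e::euclidean_space, 'a::metric_space, 'n::finite) rpoly \<Rightarrow> ('a \<Rightarrow> real) \<Rightarrow> bool" where
  "weakly_subharmonic P f \<longleftrightarrow> f \<in> W12_loc P \<and>
     (\<forall>\<rho>\<in>Lip_c P UNIV. (\<forall>x. 0 \<le> \<rho> x) \<longrightarrow>
        (\<integral>x. ginner P x (loc_grad P f x) (lip_grad P \<rho> x) \<partial>vol P) \<le> 0)"

definition weakly_harmonic ::
    "('e::euclidean_space, 'a::metric_space, 'n::finite) rpoly \<Rightarrow> ('a \<Rightarrow> real) \<Rightarrow> bool" where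
  "weakly_harmonic P f \<longleftrightarrow> f \<in> W12_loc P \<and>
     (\<forall>\<rho>\<in>Lip_c P UNIV.
        (\<integral>x. ginner P x (loc_grad P f x) (lip_grad P \<rho> x) \<partial>vol P) = 0)"

definition harmonic_fun ::
    "('e::euclidean_space, 'a::metric_space, 'n::finite) rpoly \<Rightarrow> ('a \<Rightarrow> real) \<Rightarrow> bool" where
  "harmonic_fun P f \<longleftrightarrow> continuous_on UNIV f \<and> weakly_harmonic P f"

text \<open>Elements of \<open>W\<^sup>1\<^sup>,\<^sup>2\<^sub>0\<close> are determined up to null sets only, so \<open>u \<ge> 1\<close> on \<open>E\<close> means almost
  everywhere on a neighbourhood of \<open>E\<close>.\<close>

definition capacity ::
    "('e::euclidean_space, 'a::metric_space, 'n::finite) rpoly \<Rightarrow> 'a set \<Rightarrow> 'a set \<Rightarrow> ennreal" where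
  "capacity P E \<Omega> =
     (INF u\<in>{u \<in> W12_0 P \<Omega>. \<exists>N. open N \<and> E \<subseteq> N \<and> N \<subseteq> \<Omega> \<and> (AE p in vol P. p \<in> N \<longrightarrow> 1 \<le> u p)}.
        \<integral>\<^sup>+p\<in>\<Omega>. ennreal ((gnorm P p (sobolev_grad P \<Omega> u p))\<^sup>2) \<partial>vol P)"

definition parabolic ::
    "('e::euclidean_space, 'a::metric_space, 'n::finite) rpoly \<Rightarrow> 'a set \<Rightarrow> bool" where
  "parabolic P \<Omega> \<longleftrightarrow> open \<Omega> \<and> connected \<Omega> \<and> (\<forall>D. compact D \<and> D \<subseteq> \<Omega> \<longrightarrow> capacity P D \<Omega> = 0)"

end

theory Submission
  imports Defs
begin

text \<open>Let \<open>\<rho>\<close> be a Lipschitz function with compact support, \<open>\<bar>\<rho>\<bar> \<le> M\<close>. Parabolicity provides Lipschitz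
functions \<open>w\<^sub>k\<close> of compact support with \<open>0 \<le> w\<^sub>k \<le> 1\<close>, with \<open>\<integral>\<bar>\<nabla>w\<^sub>k\<bar>\<^sup>2 \<rightarrow> 0\<close>, and with \<open>w\<^sub>k \<rightarrow> 1\<close> on the
support of \<open>\<rho>\<close> (\<open>parabolic_cutoff\<close>): truncate competitors for the capacity of that support to
\<open>[0, 1]\<close>. Both \<open>w\<^sub>k (M + \<rho>)\<close> and \<open>w\<^sub>k (M - \<rho>)\<close> are nonnegative test functions, so subharmonicity gives
\<open>\<plusminus>\<integral> w\<^sub>k \<langle>\<nabla>f, \<nabla>\<rho>\<rangle> \<le> -\<integral> (M \<plusminus> \<rho>) \<langle>\<nabla>f, \<nabla>w\<^sub>k\<rangle> \<le> 2 M \<parallel>\<nabla>f\<parallel>\<^sub>2 \<parallel>\<nabla>w\<^sub>k\<parallel>\<^sub>2\<close>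
(\<open>cutoff_test_inequality\<close>). The right-hand side tends to \<open>0\<close> because \<open>\<nabla>f\<close> is square integrable, and
the left-hand side tends to \<open>\<plusminus>\<integral> \<langle>\<nabla>f, \<nabla>\<rho>\<rangle>\<close>. Hence this integral vanishes
(\<open>signed_weak_inequality\<close>).

The argument uses the product rule for gradients, the measurability of gradients and the existence of a
global gradient of \<open>f\<close>, and most of the text establishes these on a polyhedron.

  \<^item> The gradient of a Lipschitz function is a pointwise derivative, so it is meaningful almost everywhere
    only by Rademacher's theorem. Its one-dimensional case rests on Vitali's covering theorem; the step to
    several variables is made with Fubini's theorem and integration by parts against smooth bumps.

  \<^item> Lipschitz functions on \<open>X\<close> are Lipschitz for the intrinsic distance. Two points of a simplex are joined
    by a broken segment with a generic corner, which meets a given null set in a null set of times; so the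
    intrinsic distance is at most a multiple of the Euclidean one (\<open>intrinsic_dist_le\<close>), and Lipschitz
    functions are Lipschitz in the charts.

  \<^item> The gradient attached to a Sobolev function by approximation is its weak gradient in the charts, hence
    unique almost everywhere (\<open>weak_gradient_unique\<close>). The gradients of \<open>f\<close> on the open maximal simplexes
    therefore fit together to a gradient on every relatively compact domain (\<open>loc_grad_sobolev\<close>).\<close>

section \<open>Differentiability of Lipschitz functions of one variable\<close>

text \<open>A comparison of two measures on small balls around the points of \<open>E\<close> passes to \<open>E\<close> itself: by Vitali's
theorem countably many disjoint such balls, inside a neighbourhood of \<open>E\<close> that is optimal for \<open>\<beta>\<close>, cover
almost all of \<open>E\<close>.\<close>
lemma measure_le_of_fine_ball_cover:
  fixes \<alpha> \<beta> :: "'b::euclidean_space measure"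
  assumes sets: "sets \<alpha> = sets borel" "sets \<beta> = sets borel"
    and null: "\<And>N. N \<in> null_sets lborel \<Longrightarrow> emeasure \<alpha> N = 0"
    and E: "E \<in> sets borel"
    and outer: "\<And>e. e > 0 \<Longrightarrow> \<exists>U. open U \<and> E \<subseteq> U \<and> emeasure \<beta> U \<le> emeasure \<beta> E + ennreal e"
    and fine: "\<And>x d. x \<in> E \<Longrightarrow> d > 0 \<Longrightarrow> \<exists>c r. 0 < r \<and> r < d \<and> x \<in> cball c r \<and>
                 emeasure \<alpha> (cball c r) \<le> emeasure \<beta> (cball c r)"
  shows "emeasure \<alpha> E \<le> emeasure \<beta> E"
proof (rule ennreal_le_epsilon)
  fix e :: real assume "e > 0"
  then obtain U where U: "open U" "E \<subseteq> U" "emeasure \<beta> U \<le> emeasure \<beta> E + ennreal e"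
    using outer by blast
  define K where "K = {(c, r). 0 < r \<and> cball c r \<subseteq> U \<and>
                 emeasure \<alpha> (cball c r) \<le> emeasure \<beta> (cball c r)}"
  have K: "\<exists>i. i \<in> K \<and> x \<in> cball (fst i) (snd i) \<and> snd i < d" if x: "x \<in> E" and d: "d > 0" for x d
  proof -
    obtain \<delta> where \<delta>: "\<delta> > 0" "ball x \<delta> \<subseteq> U"
      using U x open_contains_ball by blast
    obtain c r where cr: "0 < r" "r < min d (\<delta>/2)" "x \<in> cball c r"
        "emeasure \<alpha> (cball c r) \<le> emeasure \<beta> (cball c r)"
      using fine[OF x, of "min d (\<delta>/2)"] d \<delta> by auto
    have "cball c r \<subseteq> ball x \<delta>"
    proof
      fix y assume "y \<in> cball c r"
      then have "dist x y \<le> 2 * r"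
        using cr(3) dist_triangle3[of x y c] by auto
      then show "y \<in> ball x \<delta>" using cr by auto
    qed
    then have "(c, r) \<in> K" using cr \<delta> by (auto simp: K_def)
    then show ?thesis using cr by (intro exI[of _ "(c, r)"]) auto
  qed
  obtain C where C: "countable C" "C \<subseteq> K"
    "pairwise (\<lambda>i j. disjnt (cball (fst i) (snd i)) (cball (fst j) (snd j))) C"
    "negligible (E - (\<Union>i\<in>C. cball (fst i) (snd i)))"
  proof (rule Vitali_covering_theorem_cballs[of K snd E fst])
    show "0 < snd i" if "i \<in> K" for i using that by (auto simp: K_def)
  qed (use K in blast)+
  let ?B = "\<lambda>i. cball (fst i) (snd i)"
  have disj: "disjoint_family_on ?B C"
    using C(3) by (auto simp: disjoint_family_on_def pairwise_def disjnt_def)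
  have B: "?B i \<in> sets borel" for i by auto
  have UB: "\<Union>(?B ` C) \<in> sets borel"
    using C(1) by (intro sets.countable_UN') auto
  have N: "E - \<Union>(?B ` C) \<in> null_sets lborel"
    using C(4) E UB
    by (simp add: negligible_iff_null_sets null_sets_completion_iff)
  have "emeasure \<alpha> E \<le> emeasure \<alpha> ((E - \<Union>(?B ` C)) \<union> \<Union>(?B ` C))"
    using E UB sets by (intro emeasure_mono) auto
  also have "\<dots> \<le> emeasure \<alpha> (E - \<Union>(?B ` C)) + emeasure \<alpha> (\<Union>(?B ` C))"
    using E UB sets by (intro emeasure_subadditive) auto
  also have "\<dots> = emeasure \<alpha> (\<Union>(?B ` C))"
    using null[OF N] by simp
  also have "\<dots> = (\<integral>\<^sup>+i. emeasure \<alpha> (?B i) \<partial>count_space C)"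
    using C(1) disj sets by (intro emeasure_UN_countable) auto
  also have "\<dots> \<le> (\<integral>\<^sup>+i. emeasure \<beta> (?B i) \<partial>count_space C)"
    using C(2) by (intro nn_integral_mono) (auto simp: K_def)
  also have "\<dots> = emeasure \<beta> (\<Union>(?B ` C))"
    using C(1) disj sets by (intro emeasure_UN_countable[symmetric]) auto
  also have "\<dots> \<le> emeasure \<beta> U"
    using C(2) U sets unfolding K_def by (intro emeasure_mono) fastforce+
  also have "\<dots> \<le> emeasure \<beta> E + ennreal e" by (rule U(3))
  finally show "emeasure \<alpha> E \<le> emeasure \<beta> E + ennreal e" .
qed

text \<open>The lower limit of \<open>Q\<close> at \<open>0\<close> is at most \<open>p\<close> and the upper limit at least \<open>q\<close>, in a form that is
visibly a countable intersection of open conditions when \<open>Q\<close> is a difference quotient.\<close>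

definition oscillates :: "(real \<Rightarrow> real) \<Rightarrow> real \<Rightarrow> real \<Rightarrow> bool" where
  "oscillates Q p q \<longleftrightarrow> (\<forall>d>0. \<exists>h. h \<noteq> 0 \<and> \<bar>h\<bar> < d \<and> Q h < p) \<and>
                       (\<forall>d>0. \<exists>h. h \<noteq> 0 \<and> \<bar>h\<bar> < d \<and> Q h > q)"

lemma oscillates_iff_frequently:
  "oscillates Q p q \<longleftrightarrow> (\<exists>\<^sub>F h in at 0. Q h < p) \<and> (\<exists>\<^sub>F h in at 0. Q h > q)"
  unfolding oscillates_def frequently_at by (simp add: conj_assoc)

text \<open>Boundedness makes the limit finite; a gap between the lower and the upper limit contains two rational
numbers.\<close>

lemma no_oscillation_imp_limit:
  assumes bdd: "\<And>h. h \<noteq> 0 \<Longrightarrow> m \<le> Q h \<and> Q h \<le> M"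
    and no: "\<And>p q. p \<in> \<rat> \<Longrightarrow> q \<in> \<rat> \<Longrightarrow> p < q \<Longrightarrow> \<not> oscillates Q p q"
  shows "\<exists>l. (Q \<longlongrightarrow> l) (at 0)"
proof -
  let ?li = "Liminf (at 0) (\<lambda>h. ereal (Q h))" and ?ls = "Limsup (at 0) (\<lambda>h. ereal (Q h))"
  have ev: "\<forall>\<^sub>F h in at 0. m \<le> Q h \<and> Q h \<le> M"
    using bdd by (auto simp: eventually_at intro!: exI[of _ 1])
  have le: "?li \<le> ?ls" by (intro Liminf_le_Limsup) simp
  have lo: "ereal m \<le> ?li" by (intro Liminf_bounded) (use ev in \<open>auto elim: eventually_mono\<close>)
  have hi: "?ls \<le> ereal M" by (intro Limsup_bounded) (use ev in \<open>auto elim: eventually_mono\<close>)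
  have "?li = ?ls"
  proof (rule ccontr)
    assume "?li \<noteq> ?ls"
    with le have "?li < ?ls" by simp
    then obtain p where p: "?li < ereal (real_of_rat p)" "ereal (real_of_rat p) < ?ls"
      using ereal_dense3 by blast
    then obtain q where q: "ereal (real_of_rat p) < ereal (real_of_rat q)" "ereal (real_of_rat q) < ?ls"
      using ereal_dense3 by blast
    have "\<exists>\<^sub>F h in at 0. Q h < real_of_rat p"
    proof (rule ccontr)
      assume "\<not> ?thesis"
      then have "ereal (real_of_rat p) \<le> ?li"
        by (intro Liminf_bounded) (auto simp: not_frequently not_less)
      then show False using p by auto
    qed
    moreover have "\<exists>\<^sub>F h in at 0. Q h > real_of_rat q"
    proof (rule ccontr)
      assume "\<not> ?thesis"
      then have "?ls \<le> ereal (real_of_rat q)"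
        by (intro Limsup_bounded) (auto simp: not_frequently not_less)
      then show False using q by auto
    qed
    ultimately have "oscillates Q (real_of_rat p) (real_of_rat q)"
      by (simp add: oscillates_iff_frequently)
    then show False using no[of "real_of_rat p" "real_of_rat q"] q by auto
  qed
  moreover obtain l where l: "?li = ereal l"
    using lo hi le by (cases ?li) auto
  ultimately have "((\<lambda>h. ereal (Q h)) \<longlongrightarrow> ereal l) (at 0)"
    by (subst tendsto_iff_Liminf_eq_Limsup) auto
  then show ?thesis by auto
qed

lemma limit_imp_no_oscillation:
  assumes "(Q \<longlongrightarrow> l) (at 0)" "p < q"
  shows "\<not> oscillates Q p q"
proof (cases "p < l")
  case True
  then have "\<forall>\<^sub>F h in at 0. p < Q h" using assms order_tendstoD by blast
  then have "\<not> (\<exists>\<^sub>F h in at 0. Q h < p)"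
    by (auto simp: not_frequently not_less elim: eventually_mono)
  then show ?thesis by (auto simp: oscillates_iff_frequently)
next
  case False
  then have "\<forall>\<^sub>F h in at 0. Q h < q" using assms order_tendstoD by force
  then have "\<not> (\<exists>\<^sub>F h in at 0. Q h > q)"
    by (auto simp: not_frequently not_less elim: eventually_mono)
  then show ?thesis by (auto simp: oscillates_iff_frequently)
qed

text \<open>For fixed \<open>h\<close> the difference quotient is continuous in \<open>x\<close>, so the union over all small \<open>h\<close> is open and
only the intersection over \<open>d\<close> has to be made countable.\<close>

lemma sets_oscillates:
  fixes F :: "'b::real_normed_vector \<Rightarrow> real"
  assumes contF: "continuous_on UNIV F"
  shows "{x. oscillates (\<lambda>h. (F (x + h *\<^sub>R v) - F x) / h) p q} \<in> sets borel"
proof -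
  have "{x. \<forall>d>0. \<exists>h. h \<noteq> 0 \<and> \<bar>h\<bar> < d \<and> R ((F (x + h *\<^sub>R v) - F x) / h)} \<in> sets borel"
    if "open (Collect R)" for R
  proof -
    let ?Q = "\<lambda>x h. (F (x + h *\<^sub>R v) - F x) / h"
    have "{x. \<forall>d>0. \<exists>h. h \<noteq> 0 \<and> \<bar>h\<bar> < d \<and> R (?Q x h)}
        = (\<Inter>n::nat. \<Union>h\<in>{h. h \<noteq> 0 \<and> \<bar>h\<bar> < 1 / real (Suc n)}. {x. R (?Q x h)})"
    proof (intro set_eqI iffI)
      fix x assume x: "x \<in> (\<Inter>n::nat. \<Union>h\<in>{h. h \<noteq> 0 \<and> \<bar>h\<bar> < 1 / real (Suc n)}. {x. R (?Q x h)})"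
      show "x \<in> {x. \<forall>d>0. \<exists>h. h \<noteq> 0 \<and> \<bar>h\<bar> < d \<and> R (?Q x h)}"
      proof (intro CollectI allI impI)
        fix d :: real assume "d > 0"
        then obtain n where n: "1 / real (Suc n) < d" using nat_approx_posE by blast
        obtain h where "h \<noteq> 0" "\<bar>h\<bar> < 1 / real (Suc n)" "R (?Q x h)"
          using x by blast
        with n show "\<exists>h. h \<noteq> 0 \<and> \<bar>h\<bar> < d \<and> R (?Q x h)"
          by (meson less_trans)
      qed
    next
      fix x assume "x \<in> {x. \<forall>d>0. \<exists>h. h \<noteq> 0 \<and> \<bar>h\<bar> < d \<and> R (?Q x h)}"
      then have x: "\<exists>h. h \<noteq> 0 \<and> \<bar>h\<bar> < d \<and> R (?Q x h)" if "d > 0" for d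
        using that by blast
      show "x \<in> (\<Inter>n::nat. \<Union>h\<in>{h. h \<noteq> 0 \<and> \<bar>h\<bar> < 1 / real (Suc n)}. {x. R (?Q x h)})"
        using x[of "1 / real (Suc n)" for n] by fastforce
    qed
    moreover have op: "open {x. R (?Q x h)}" if "h \<noteq> 0" for h
    proof -
      have "continuous_on UNIV (\<lambda>x. F (x + h *\<^sub>R v))"
        by (intro continuous_on_compose2[OF contF] continuous_intros) auto
      then have "continuous_on UNIV (\<lambda>x. ?Q x h)"
        using contF that by (intro continuous_intros) auto
      then show ?thesis
        using \<open>open (Collect R)\<close> open_vimage[of "Collect R" "\<lambda>x. ?Q x h"]
        by (auto simp: vimage_def)
    qed
    have "open (\<Union>h\<in>{h. h \<noteq> 0 \<and> \<bar>h\<bar> < 1 / real (Suc n)}. {x. R (?Q x h)})" for n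
      using op by (intro open_UN) auto
    then have "(\<Inter>n::nat. \<Union>h\<in>{h. h \<noteq> 0 \<and> \<bar>h\<bar> < 1 / real (Suc n)}. {x. R (?Q x h)}) \<in> sets borel"
      by (intro sets.countable_INT) auto
    ultimately show ?thesis by simp
  qed
  from this[of "\<lambda>y. y < p"] this[of "\<lambda>y. y > q"] show ?thesis
    by (simp add: oscillates_def Collect_conj_eq open_Collect_less)
qed

text \<open>Let \<open>\<nu>(A)\<close> be the Lebesgue measure of \<open>f(A)\<close>; on an interval it is the increment of \<open>f\<close>. Points of the
set have arbitrarily short intervals on which \<open>\<nu>\<close> is below \<open>p\<close> times the length, and others on which it is
above \<open>q\<close> times the length. So a bounded part \<open>E\<close> of the set has \<open>q \<bar>E\<bar> \<le> \<nu>(E) \<le> p \<bar>E\<bar>\<close>, and \<open>\<bar>E\<bar> = 0\<close>.\<close>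

lemma null_oscillates_difference_quotient:
  fixes f :: "real \<Rightarrow> real"
  assumes lo: "\<And>x y. x \<le> y \<Longrightarrow> y - x \<le> f y - f x"
    and up: "\<And>x y. x \<le> y \<Longrightarrow> f y - f x \<le> L * (y - x)"
    and pq: "0 < p" "p < q"
  shows "{x. oscillates (\<lambda>h. (f (x + h) - f x) / h) p q} \<in> null_sets lborel"
    (is "?E \<in> _")
proof -
  have L1: "L \<ge> 1" using lo[of 0 1] up[of 0 1] by simp
  have lipf: "\<bar>f y - f x\<bar> \<le> L * \<bar>y - x\<bar>" for x y
    using lo[of x y] up[of x y] lo[of y x] up[of y x] L1 by (cases "x \<le> y") (auto simp: abs_if)
  have contf: "continuous_on UNIV f"
    using L1 by (intro lipschitz_on_continuous_on[of L] lipschitz_onI)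
      (auto simp: dist_real_def intro: order_trans[OF lipf] lipf)
  have contf': "continuous_on A f" for A using contf continuous_on_subset by blast
  have smono: "strict_mono f"
    unfolding strict_mono_def using lo by (smt (verit))
  then have injf: "inj f" by (rule strict_mono_imp_inj_on)
  have surjf: "surj f"
  proof (unfold surj_def, rule allI)
    fix y
    let ?a = "- \<bar>y - f 0\<bar>" and ?b = "\<bar>y - f 0\<bar>"
    have "f ?a \<le> y" using lo[of ?a 0] by simp
    moreover have "y \<le> f ?b" using lo[of 0 ?b] by simp
    ultimately have "\<exists>x\<ge>?a. x \<le> ?b \<and> f x = y"
      by (intro IVT') (auto intro: contf')
    then show "\<exists>x. y = f x" by auto
  qed
  define g where "g = inv f"
  have fg: "f (g u) = u" and gf: "g (f x) = x" for u x
    using injf surjf by (auto simp: g_def surj_f_inv_f)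
  have gvim: "g -` A = f ` A" for A
    by (force simp: fg gf image_iff)
  have contg: "continuous_on UNIV g"
  proof -
    have "\<bar>g u - g v\<bar> \<le> \<bar>u - v\<bar>" for u v
      using lo[of "g u" "g v"] lo[of "g v" "g u"] by (cases "g u \<le> g v") (auto simp: fg)
    then show ?thesis
      by (intro lipschitz_on_continuous_on[of 1] lipschitz_onI) (auto simp: dist_real_def)
  qed
  then have gm: "g \<in> borel_measurable borel" by (rule borel_measurable_continuous_onI)
  \<comment> \<open>As the image measure under the inverse of \<open>f\<close>, \<open>\<nu>\<close> is countably additive.\<close>
  define \<nu> where "\<nu> = distr lborel borel g"
  have \<nu>: "emeasure \<nu> A = emeasure lborel (f ` A)" if "A \<in> sets borel" for A
    using that gm by (simp add: \<nu>_def emeasure_distr gvim)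
  have \<nu>I: "emeasure \<nu> (cball c r) = ennreal (f (c + r) - f (c - r))" if "r > 0" for c r
  proof -
    have "f ` {c - r..c + r} = {f (c - r)..f (c + r)}"
    proof safe
      fix u assume "u \<in> {f (c - r)..f (c + r)}"
      then have "\<exists>x\<ge>c - r. x \<le> c + r \<and> f x = u"
        using that by (intro IVT') (auto intro: contf')
      then show "u \<in> f ` {c - r..c + r}" by auto
    qed (use smono in \<open>auto simp: strict_mono_less_eq\<close>)
    then show ?thesis
      using that lo[of "c - r" "c + r"] by (simp add: \<nu> cball_eq_atLeastAtMost)
  qed
  have lb: "emeasure lborel (cball c r) = ennreal (2 * r)" if "r > 0" for c r :: real
    using that by (simp add: cball_eq_atLeastAtMost)
  have E: "?E \<in> sets borel"
    using sets_oscillates[OF contf, of 1] by simp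
  have "emeasure lborel (?E \<inter> {-real N..real N}) = 0" for N :: nat
  proof -
    define E0 where "E0 = ?E \<inter> {-real N..real N}"
    have E0: "E0 \<in> sets borel" using E by (auto simp: E0_def)
    have fin: "emeasure lborel E0 < \<infinity>"
    proof -
      have "emeasure lborel E0 \<le> emeasure lborel {-real N..real N}"
        by (intro emeasure_mono) (auto simp: E0_def)
      also have "\<dots> < \<infinity>" by simp
      finally show ?thesis .
    qed
    have "emeasure \<nu> E0 \<le> emeasure (scale_measure (ennreal p) lborel) E0"
    proof (rule measure_le_of_fine_ball_cover)
      fix M :: "real set" assume "M \<in> null_sets lborel"
      then have "negligible (f ` M)"
        by (intro negligible_locally_Lipschitz_image[where f=f])
           (auto simp: negligible_iff_null_sets null_sets_completion_iff null_sets_def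
             intro!: exI[of _ UNIV] exI[of _ L] order_trans[OF lipf])
      then show "emeasure \<nu> M = 0"
        using \<open>M \<in> null_sets lborel\<close> \<nu>[of M] measurable_sets_borel[OF gm, of M]
        by (simp add: gvim negligible_iff_null_sets null_sets_completion_iff null_sets_def)
    next
      fix e :: real assume e: "e > 0"
      have "ennreal (e / p) > 0" using e pq by auto
      then obtain U where U: "open U" "E0 \<subseteq> U" "emeasure lborel (U - E0) < ennreal (e / p)"
        using outer_regular_lborel[OF E0, of "e/p"] e pq by auto
      have "emeasure lborel U \<le> emeasure lborel (E0 \<union> (U - E0))"
        using U E0 by (intro emeasure_mono) auto
      also have "\<dots> \<le> emeasure lborel E0 + emeasure lborel (U - E0)"
        using U E0 by (intro emeasure_subadditive) auto
      also have "\<dots> \<le> emeasure lborel E0 + ennreal (e / p)"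
        using U by (intro add_mono) auto
      finally have "ennreal p * emeasure lborel U \<le> ennreal p * (emeasure lborel E0 + ennreal (e / p))"
        by (rule mult_left_mono) simp
      also have "\<dots> = ennreal p * emeasure lborel E0 + ennreal e"
        using pq e by (simp add: distrib_left ennreal_mult'[symmetric])
      finally show "\<exists>U. open U \<and> E0 \<subseteq> U \<and> emeasure (scale_measure (ennreal p) lborel) U
          \<le> emeasure (scale_measure (ennreal p) lborel) E0 + ennreal e"
        using U by (auto simp: emeasure_scale_measure)
    next
      fix x d :: real assume x: "x \<in> E0" and d: "d > 0"
      then obtain h where h: "h \<noteq> 0" "\<bar>h\<bar> < d" "(f (x + h) - f x) / h < p"
        unfolding E0_def oscillates_def by blast
      let ?c = "x + h/2" and ?r = "\<bar>h\<bar>/2"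
      have r: "?r > 0" using h by simp
      have ends: "?c + ?r = (if h > 0 then x + h else x)" "?c - ?r = (if h > 0 then x else x + h)"
        by (simp_all add: field_simps abs_if)
      have "f (?c + ?r) - f (?c - ?r) \<le> p * (2 * ?r)"
        unfolding ends using h by (cases "h > 0") (auto simp: divide_simps split: if_splits)
      then have "emeasure \<nu> (cball ?c ?r) \<le> emeasure (scale_measure (ennreal p) lborel) (cball ?c ?r)"
        unfolding \<nu>I[OF r] emeasure_scale_measure lb[OF r]
        using pq r by (simp add: ennreal_mult[symmetric] ennreal_leI del: distrib_left_numeral)
      then show "\<exists>c r. 0 < r \<and> r < d \<and> x \<in> cball c r \<and>
          emeasure \<nu> (cball c r) \<le> emeasure (scale_measure (ennreal p) lborel) (cball c r)"
        using h by (intro exI[of _ ?c] exI[of _ ?r]) (auto simp: dist_real_def)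
    qed (auto simp: \<nu>_def E0)
    moreover have "emeasure (scale_measure (ennreal q) lborel) E0 \<le> emeasure \<nu> E0"
    proof (rule measure_le_of_fine_ball_cover)
      fix M :: "real set" assume "M \<in> null_sets lborel"
      then show "emeasure (scale_measure (ennreal q) lborel) M = 0"
        by (auto simp: emeasure_scale_measure)
    next
      fix e :: real assume e: "e > 0"
      have fE: "f ` E0 \<in> sets borel"
        using gm E0 by (metis gvim measurable_sets_borel)
      then obtain U where U: "open U" "f ` E0 \<subseteq> U" "emeasure lborel (U - f ` E0) < ennreal e"
        using outer_regular_lborel[of "f ` E0" e] e by auto
      have fU: "open (f -` U)" using contf U by (simp add: open_vimage)
      have "emeasure \<nu> (f -` U) = emeasure lborel U"
        using fU surjf by (simp add: \<nu> surj_image_vimage_eq)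
      also have "\<dots> \<le> emeasure lborel (f ` E0 \<union> (U - f ` E0))"
        using U fE by (intro emeasure_mono) auto
      also have "\<dots> \<le> emeasure lborel (f ` E0) + emeasure lborel (U - f ` E0)"
        using U fE by (intro emeasure_subadditive) auto
      also have "\<dots> \<le> emeasure \<nu> E0 + ennreal e"
        using U E0 by (intro add_mono) (auto simp: \<nu>)
      finally show "\<exists>U. open U \<and> E0 \<subseteq> U \<and> emeasure \<nu> U \<le> emeasure \<nu> E0 + ennreal e"
        using U fU by auto
    next
      fix x d :: real assume x: "x \<in> E0" and d: "d > 0"
      then obtain h where h: "h \<noteq> 0" "\<bar>h\<bar> < d" "(f (x + h) - f x) / h > q"
        unfolding E0_def oscillates_def by blast
      let ?c = "x + h/2" and ?r = "\<bar>h\<bar>/2"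
      have r: "?r > 0" using h by simp
      have ends: "?c + ?r = (if h > 0 then x + h else x)" "?c - ?r = (if h > 0 then x else x + h)"
        by (simp_all add: field_simps abs_if)
      have "q * (2 * ?r) \<le> f (?c + ?r) - f (?c - ?r)"
        unfolding ends using h by (cases "h > 0") (auto simp: divide_simps split: if_splits)
      then have "emeasure (scale_measure (ennreal q) lborel) (cball ?c ?r) \<le> emeasure \<nu> (cball ?c ?r)"
        unfolding \<nu>I[OF r] emeasure_scale_measure lb[OF r]
        using pq r by (simp add: ennreal_mult[symmetric] ennreal_leI del: distrib_left_numeral)
      then show "\<exists>c r. 0 < r \<and> r < d \<and> x \<in> cball c r \<and>
          emeasure (scale_measure (ennreal q) lborel) (cball c r) \<le> emeasure \<nu> (cball c r)"
        using h by (intro exI[of _ ?c] exI[of _ ?r]) (auto simp: dist_real_def)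
    qed (auto simp: \<nu>_def E0)
    ultimately have le: "ennreal q * emeasure lborel E0 \<le> ennreal p * emeasure lborel E0"
      using order_trans by (fastforce simp: emeasure_scale_measure)
    obtain m where m: "emeasure lborel E0 = ennreal m" "m \<ge> 0"
      using fin by (cases "emeasure lborel E0") auto
    have "q * m \<le> p * m" using le pq m by (simp add: ennreal_mult[symmetric])
    then have "m = 0" using pq m by (metis mult_right_le_imp_le not_le order.not_eq_order_implies_strict)
    then show ?thesis using m by (simp add: E0_def)
  qed
  then have "(\<Union>N. ?E \<inter> {-real N..real N}) \<in> null_sets lborel"
    using E by (intro null_sets_UN) (auto simp: null_sets_def)
  moreover have "(\<Union>N. ?E \<inter> {-real N..real N}) = ?E"
  proof -
    have "\<exists>N. x \<in> {-real N..real N}" for x :: real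
      using real_arch_simple[of "\<bar>x\<bar>"] by (auto simp: abs_le_iff minus_le_iff)
    then show ?thesis by blast
  qed
  ultimately show ?thesis by simp
qed

lemma lipschitz_real_differentiable_off_null:
  fixes F :: "real \<Rightarrow> real"
  assumes lip: "\<And>x y. \<bar>F x - F y\<bar> \<le> L * \<bar>x - y\<bar>"
  shows "\<exists>N\<in>null_sets lborel. \<forall>x. x \<notin> N \<longrightarrow> (\<exists>l. ((\<lambda>h. (F (x + h) - F x) / h) \<longlongrightarrow> l) (at 0))"
proof -
  have L0: "L \<ge> 0" using lip[of 0 1] by simp
  \<comment> \<open>The added slope makes the function increasing, with all difference quotients at least 1.\<close>
  define f where "f x = F x + (L + 1) * x" for x
  have lo: "y - x \<le> f y - f x" if "x \<le> y" for x y
    using lip[of y x] that by (auto simp: f_def algebra_simps abs_le_iff)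
  have up: "f y - f x \<le> (2 * L + 1) * (y - x)" if "x \<le> y" for x y
    using lip[of y x] that by (auto simp: f_def algebra_simps abs_le_iff)
  let ?Q = "\<lambda>x h. (f (x + h) - f x) / h"
  have Q: "1 \<le> ?Q x h \<and> ?Q x h \<le> 2 * L + 1" if "h \<noteq> 0" for x h
  proof (cases "h > 0")
    case True
    then show ?thesis using lo[of x "x+h"] up[of x "x+h"] by (auto simp: divide_simps)
  next
    case False
    then show ?thesis using lo[of "x+h" x] up[of "x+h" x] that
      by (auto simp: divide_simps algebra_simps)
  qed
  define I where "I = {(p, q) \<in> \<rat> \<times> \<rat>. 0 < p \<and> p < (q::real)}"
  have "countable I" unfolding I_def
    by (rule countable_subset[of _ "\<rat> \<times> \<rat>"]) (auto intro: countable_rat)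
  define N where "N = (\<Union>(p, q)\<in>I. {x. oscillates (?Q x) p q})"
  have "N \<in> null_sets lborel"
    unfolding N_def
    using \<open>countable I\<close> null_oscillates_difference_quotient[where f=f, OF lo up]
    by (intro null_sets_UN') (auto simp: I_def)
  moreover have "\<exists>l. ((\<lambda>h. (F (x + h) - F x) / h) \<longlongrightarrow> l) (at 0)" if x: "x \<notin> N" for x
  proof -
    have "\<exists>l. (?Q x \<longlongrightarrow> l) (at 0)"
    proof (rule no_oscillation_imp_limit)
      fix p q :: real assume pq: "p \<in> \<rat>" "q \<in> \<rat>" "p < q"
      show "\<not> oscillates (?Q x) p q"
      proof
        assume o: "oscillates (?Q x) p q"
        then have "\<forall>d>0. \<exists>h. h \<noteq> 0 \<and> \<bar>h\<bar> < d \<and> ?Q x h < p"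
          unfolding oscillates_def by (rule conjunct1)
        from this[rule_format, OF zero_less_one] obtain h where h: "h \<noteq> 0" "?Q x h < p"
          by (elim exE conjE)
        then have "0 < p" using Q[OF h(1), of x] by linarith
        then have "(p, q) \<in> I" using pq by (simp add: I_def)
        then show False using o x by (auto simp: N_def)
      qed
    qed (rule Q)
    then obtain l where "(?Q x \<longlongrightarrow> l) (at 0)" by blast
    then have "((\<lambda>h. ?Q x h - (L + 1)) \<longlongrightarrow> l - (L + 1)) (at 0)"
      by (intro tendsto_intros)
    moreover have "\<forall>\<^sub>F h in at 0. ?Q x h - (L + 1) = (F (x + h) - F x) / h"
      by (auto simp: eventually_at f_def field_simps intro!: exI[of _ 1])
    ultimately have "((\<lambda>h. (F (x + h) - F x) / h) \<longlongrightarrow> l - (L + 1)) (at 0)"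
      by (rule Lim_transform_eventually)
    then show ?thesis by (rule exI)
  qed
  ultimately show ?thesis by blast
qed

section \<open>Directional derivatives and integration by parts\<close>

text \<open>Translations preserve Lebesgue measure, so the measure of \<open>B\<close> is the mean over \<open>t \<in> [0, 1]\<close> of the measure
of \<open>B\<close> translated by \<open>-t v\<close>. Integrating first in \<open>t\<close> gives \<open>0\<close>, whatever the direction \<open>v\<close>.\<close>
lemma null_set_if_null_on_parallel_lines:
  fixes B :: "'b::euclidean_space set"
  assumes B: "B \<in> sets borel" and lines: "\<And>x. {t. x + t *\<^sub>R v \<in> B} \<in> null_sets lborel"
  shows "B \<in> null_sets lborel"
proof -
  have m: "(\<lambda>(x, t). indicator B (x + t *\<^sub>R v) * indicator {0..1} t :: ennreal)
      \<in> borel_measurable (lborel \<Otimes>\<^sub>M (lborel :: real measure))"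
    using B by measurable
  have "emeasure lborel B = (\<integral>\<^sup>+t. emeasure lborel B * indicator {0..1::real} t \<partial>lborel)"
    by (subst nn_integral_cmult_indicator) auto
  also have "\<dots> = (\<integral>\<^sup>+t. (\<integral>\<^sup>+x. indicator B (x + t *\<^sub>R v) * indicator {0..1} t \<partial>lborel) \<partial>lborel)"
  proof (intro nn_integral_cong)
    fix t :: real
    have "emeasure lborel B = (\<integral>\<^sup>+x. indicator B x \<partial>distr lborel borel ((+) (t *\<^sub>R v)))"
      using B by (simp add: lborel_distr_plus)
    also have "\<dots> = (\<integral>\<^sup>+x. indicator B (x + t *\<^sub>R v) \<partial>lborel)"
      using B by (subst nn_integral_distr) (auto simp: add.commute)
    finally show "emeasure lborel B * indicator {0..1} t =
        (\<integral>\<^sup>+x. indicator B (x + t *\<^sub>R v) * indicator {0..1} t \<partial>lborel)"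
      by (auto split: split_indicator)
  qed
  also have "\<dots> = (\<integral>\<^sup>+x. (\<integral>\<^sup>+t. indicator B (x + t *\<^sub>R v) * indicator {0..1} t \<partial>lborel) \<partial>lborel)"
    using lborel_pair.Fubini[OF m] by simp
  also have "\<dots> = (\<integral>\<^sup>+(x::'b). 0 \<partial>lborel)"
  proof (intro nn_integral_cong)
    fix x :: 'b
    have "(\<integral>\<^sup>+t. indicator B (x + t *\<^sub>R v) * indicator {0..1} t \<partial>lborel)
        \<le> (\<integral>\<^sup>+t. indicator {t. x + t *\<^sub>R v \<in> B} t \<partial>lborel)"
      by (intro nn_integral_mono) (auto split: split_indicator)
    also have "\<dots> = 0" using lines[of x] by (subst nn_integral_indicator) auto
    finally show "(\<integral>\<^sup>+t. indicator B (x + t *\<^sub>R v) * indicator {0..1} t \<partial>lborel) = 0" by simp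
  qed
  finally show ?thesis using B by auto
qed

lemma lipschitz_directionally_differentiable_AE:
  fixes F :: "'b::euclidean_space \<Rightarrow> real"
  assumes lip: "L-lipschitz_on UNIV F"
  shows "AE x in lborel. \<exists>l. ((\<lambda>h. (F (x + h *\<^sub>R v) - F x) / h) \<longlongrightarrow> l) (at 0)"
proof -
  have L0: "L \<ge> 0" using lip by (rule lipschitz_on_nonneg)
  have l: "\<bar>F x - F y\<bar> \<le> L * norm (x - y)" for x y
    using lipschitz_onD[OF lip, of x y] by (simp add: dist_norm dist_real_def)
  have cont: "continuous_on UNIV F" using lip by (rule lipschitz_on_continuous_on)
  let ?Q = "\<lambda>x h. (F (x + h *\<^sub>R v) - F x) / h"
  have Q: "- (L * norm v) \<le> ?Q x h \<and> ?Q x h \<le> L * norm v" if "h \<noteq> 0" for x h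
  proof -
    have "\<bar>?Q x h\<bar> \<le> L * norm v"
      using l[of "x + h *\<^sub>R v" x] that by (simp add: abs_divide divide_le_eq mult_ac)
    then show ?thesis unfolding abs_le_iff by linarith
  qed
  define I where "I = {(p, q) \<in> \<rat> \<times> \<rat>. p < (q::real)}"
  have cI: "countable I" unfolding I_def
    by (rule countable_subset[of _ "\<rat> \<times> \<rat>"]) (auto intro: countable_rat)
  define N where "N = (\<Union>(p, q)\<in>I. {x. oscillates (?Q x) p q})"
  have NB: "N \<in> sets borel"
    unfolding N_def using sets_oscillates[OF cont, of v] cI
    by (intro sets.countable_UN') auto
  have "N \<in> null_sets lborel"
  proof (rule null_set_if_null_on_parallel_lines[OF NB, of v])
    fix x
    define G where "G t = F (x + t *\<^sub>R v)" for t
    have "\<bar>G s - G t\<bar> \<le> (L * norm v) * \<bar>s - t\<bar>" for s t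
      using l[of "x + s *\<^sub>R v" "x + t *\<^sub>R v"]
      by (simp add: G_def mult_ac flip: scaleR_left_diff_distrib)
    from lipschitz_real_differentiable_off_null[OF this]
    obtain M where M: "M \<in> null_sets lborel"
      "\<forall>t. t \<notin> M \<longrightarrow> (\<exists>l. ((\<lambda>h. (G (t + h) - G t) / h) \<longlongrightarrow> l) (at 0))" by (rule bexE)
    have eq: "(G (t + h) - G t) / h = ?Q (x + t *\<^sub>R v) h" for t h
      by (simp add: G_def algebra_simps)
    have "{t. x + t *\<^sub>R v \<in> N} \<subseteq> M"
    proof
      fix t assume "t \<in> {t. x + t *\<^sub>R v \<in> N}"
      then obtain p q where "p < q" "oscillates (?Q (x + t *\<^sub>R v)) p q"
        by (auto simp: N_def I_def)
      then have "\<nexists>l. ((\<lambda>h. (G (t + h) - G t) / h) \<longlongrightarrow> l) (at 0)"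
        using limit_imp_no_oscillation unfolding eq by blast
      then show "t \<in> M" using M(2) by (cases "t \<in> M") simp_all
    qed
    moreover have "{t. x + t *\<^sub>R v \<in> N} \<in> sets lborel"
      using NB by measurable
    ultimately show "{t. x + t *\<^sub>R v \<in> N} \<in> null_sets lborel"
      by (intro null_sets_subset[OF M(1), rotated])
  qed
  then show ?thesis
  proof (rule AE_I', safe)
    fix x assume no: "\<nexists>l. (?Q x \<longlongrightarrow> l) (at 0)"
    show "x \<in> N"
    proof (rule ccontr)
      assume x: "x \<notin> N"
      have "\<not> oscillates (?Q x) p q" if "p \<in> \<rat>" "q \<in> \<rat>" "p < q" for p q
        using x that by (auto simp: N_def I_def)
      then have "\<exists>l. (?Q x \<longlongrightarrow> l) (at 0)"
        by (intro no_oscillation_imp_limit[where Q="?Q x", OF Q])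
      with no show False by (rule notE)
    qed
  qed
qed

text \<open>The limit is taken along a sequence, so that a Borel function is obtained at all points.\<close>

definition dir_deriv :: "('b::euclidean_space \<Rightarrow> real) \<Rightarrow> 'b \<Rightarrow> 'b \<Rightarrow> real" where
  "dir_deriv F v x = lim (\<lambda>n. (F (x + (1 / real (Suc n)) *\<^sub>R v) - F x) / (1 / real (Suc n)))"

lemma inverse_Suc_at_0: "filterlim (\<lambda>n. 1 / real (Suc n)) (at 0) sequentially"
proof -
  have "(\<lambda>n. 1 / real (Suc n)) \<longlonglongrightarrow> 0"
    using LIMSEQ_inverse_real_of_nat unfolding inverse_eq_divide .
  then show ?thesis by (rule filterlim_atI) simp
qed

lemma dir_deriv_eq:
  assumes "((\<lambda>h. (F (x + h *\<^sub>R v) - F x) / h) \<longlongrightarrow> l) (at 0)"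
  shows "dir_deriv F v x = l"
  unfolding dir_deriv_def using filterlim_compose[OF assms inverse_Suc_at_0] by (rule limI)

lemma dir_deriv_measurable:
  assumes "continuous_on UNIV F"
  shows "dir_deriv F v \<in> borel_measurable borel"
proof -
  have [measurable]: "F \<in> borel_measurable borel"
    using assms by (rule borel_measurable_continuous_onI)
  show ?thesis unfolding dir_deriv_def by measurable
qed

lemma lipschitz_has_dir_deriv_AE:
  fixes F :: "'b::euclidean_space \<Rightarrow> real"
  assumes lip: "L-lipschitz_on UNIV F"
  shows "AE x in lborel. ((\<lambda>h. (F (x + h *\<^sub>R v) - F x) / h) \<longlongrightarrow> dir_deriv F v x) (at 0) \<and>
           \<bar>dir_deriv F v x\<bar> \<le> L * norm v"
  using lipschitz_directionally_differentiable_AE[OF lip, of v]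
proof eventually_elim
  case (elim x)
  then obtain l where l: "((\<lambda>h. (F (x + h *\<^sub>R v) - F x) / h) \<longlongrightarrow> l) (at 0)" by blast
  have "\<bar>(F (x + h *\<^sub>R v) - F x) / h\<bar> \<le> L * norm v" if "h \<noteq> 0" for h
    using lipschitz_onD[OF lip, of "x + h *\<^sub>R v" x] that
    by (simp add: abs_divide divide_le_eq mult_ac dist_norm)
  then have "\<forall>\<^sub>F h in at 0. \<bar>(F (x + h *\<^sub>R v) - F x) / h\<bar> \<le> L * norm v"
    by (auto simp: eventually_at intro!: exI[of _ 1])
  with tendsto_rabs[OF l] have "\<bar>l\<bar> \<le> L * norm v"
    by (rule tendsto_upperbound) simp
  then show ?case using l dir_deriv_eq[OF l] by simp
qed

text \<open>The difference quotient of \<open>F\<close> is moved to \<open>\<phi>\<close> by a translation, and both sides converge by dominated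
convergence.\<close>

lemma dir_deriv_integral_by_parts:
  fixes F \<phi> :: "'b::euclidean_space \<Rightarrow> real"
  assumes lip: "L-lipschitz_on UNIV F" and lip\<phi>: "M-lipschitz_on UNIV \<phi>"
    and supp: "\<And>x. norm x > R \<Longrightarrow> \<phi> x = 0"
    and d\<phi>: "\<And>x. ((\<lambda>h. (\<phi> (x + h *\<^sub>R v) - \<phi> x) / h) \<longlongrightarrow> d\<phi> x) (at 0)"
    and d\<phi>m: "d\<phi> \<in> borel_measurable borel"
  shows "(\<integral>x. dir_deriv F v x * \<phi> x \<partial>lborel) = - (\<integral>x. F x * d\<phi> x \<partial>lborel)"
proof -
  have contF: "continuous_on UNIV F" using lip by (rule lipschitz_on_continuous_on)
  have cont\<phi>: "continuous_on UNIV \<phi>" using lip\<phi> by (rule lipschitz_on_continuous_on)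
  have [measurable]: "F \<in> borel_measurable borel" "\<phi> \<in> borel_measurable borel"
      "dir_deriv F v \<in> borel_measurable borel"
    using contF cont\<phi> dir_deriv_measurable borel_measurable_continuous_onI by auto
  note [measurable] = d\<phi>m
  have lF: "\<bar>F x - F y\<bar> \<le> L * norm (x - y)" for x y
    using lipschitz_onD[OF lip, of x y] by (simp add: dist_norm dist_real_def)
  have l\<phi>: "\<bar>\<phi> x - \<phi> y\<bar> \<le> M * norm (x - y)" for x y
    using lipschitz_onD[OF lip\<phi>, of x y] by (simp add: dist_norm dist_real_def)
  have M0: "M \<ge> 0" using lip\<phi> by (rule lipschitz_on_nonneg)
  define e where "e n = 1 / real (Suc n)" for n
  have e: "0 < e n" "e n \<le> 1" for n by (auto simp: e_def)
  have e_lim: "filterlim e (at 0) sequentially" unfolding e_def by (rule inverse_Suc_at_0)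
  have int_cpt: "integrable lborel (\<lambda>x. indicator (cball 0 r) x * g x)"
    if "continuous_on UNIV g" for r and g :: "'b \<Rightarrow> real"
    using borel_integrable_compact[of "cball 0 r" g] that continuous_on_subset
    by (auto simp: indicator_def if_distrib cong: if_cong)
  have supp_ind: "\<phi> x = indicator (cball 0 R) x * \<phi> x" for x
    using supp[of x] by (auto simp: indicator_def)
  have eq: "(\<integral>x. (F (x + e n *\<^sub>R v) - F x) / e n * \<phi> x \<partial>lborel)
      = - (\<integral>x. F x * ((\<phi> (x + (- e n) *\<^sub>R v) - \<phi> x) / (- e n)) \<partial>lborel)" for n
  proof -
    have i1: "integrable lborel (\<lambda>x. F x * \<phi> x)"
      using int_cpt[of "\<lambda>x. F x * \<phi> x" R] contF cont\<phi>
      by (subst supp_ind) (auto simp: mult_ac intro!: continuous_intros)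
    have i2: "integrable lborel (\<lambda>x. F (x + e n *\<^sub>R v) * \<phi> x)"
    proof -
      have "continuous_on UNIV (\<lambda>x. F (x + e n *\<^sub>R v))"
        by (intro continuous_on_compose2[OF contF] continuous_intros) auto
      then have "integrable lborel (\<lambda>x. indicator (cball 0 R) x * (F (x + e n *\<^sub>R v) * \<phi> x))"
        using cont\<phi> by (intro int_cpt continuous_intros)
      then show ?thesis by (subst supp_ind) (simp add: mult_ac)
    qed
    have t: "distr lborel borel ((+) (e n *\<^sub>R v)) = lborel" by (rule lborel_distr_plus)
    let ?G = "\<lambda>x. F x * \<phi> (x - e n *\<^sub>R v)"
    have "integrable (distr lborel borel ((+) (e n *\<^sub>R v))) ?G"
      using i2 by (subst integrable_distr_eq) (auto simp: add_ac)
    then have i3: "integrable lborel ?G" by (simp add: t)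
    have "(\<integral>x. ?G x \<partial>lborel) = (\<integral>x. ?G x \<partial>distr lborel borel ((+) (e n *\<^sub>R v)))" by (simp add: t)
    also have "\<dots> = (\<integral>x. F (x + e n *\<^sub>R v) * \<phi> x \<partial>lborel)"
      by (subst integral_distr) (auto simp: add_ac)
    finally have sh: "(\<integral>x. F (x + e n *\<^sub>R v) * \<phi> x \<partial>lborel) = (\<integral>x. ?G x \<partial>lborel)" by simp
    have "(\<integral>x. (F (x + e n *\<^sub>R v) - F x) / e n * \<phi> x \<partial>lborel)
        = (\<integral>x. (F (x + e n *\<^sub>R v) * \<phi> x - F x * \<phi> x) / e n \<partial>lborel)"
      by (intro Bochner_Integration.integral_cong) (auto simp: algebra_simps diff_divide_distrib)
    also have "\<dots> = ((\<integral>x. ?G x \<partial>lborel) - (\<integral>x. F x * \<phi> x \<partial>lborel)) / e n"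
      using i1 i2 sh by simp
    also have "\<dots> = (\<integral>x. (?G x - F x * \<phi> x) / e n \<partial>lborel)"
      using i1 i3 by simp
    also have "\<dots> = (\<integral>x. - (F x * ((\<phi> (x + (- e n) *\<^sub>R v) - \<phi> x) / (- e n))) \<partial>lborel)"
      by (intro Bochner_Integration.integral_cong) (auto simp: algebra_simps diff_divide_distrib)
    finally show ?thesis by simp
  qed
  have lim1: "(\<lambda>n. \<integral>x. (F (x + e n *\<^sub>R v) - F x) / e n * \<phi> x \<partial>lborel)
      \<longlonglongrightarrow> (\<integral>x. dir_deriv F v x * \<phi> x \<partial>lborel)"
  proof (rule integral_dominated_convergence[where w="\<lambda>x. indicator (cball 0 R) x * (L * norm v * \<bar>\<phi> x\<bar>)"])
    show "integrable lborel (\<lambda>x. indicator (cball 0 R) x * (L * norm v * \<bar>\<phi> x\<bar>))"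
      by (intro int_cpt continuous_intros cont\<phi>)
    show "AE x in lborel. (\<lambda>n. (F (x + e n *\<^sub>R v) - F x) / e n * \<phi> x) \<longlonglongrightarrow> dir_deriv F v x * \<phi> x"
      using lipschitz_has_dir_deriv_AE[OF lip, of v]
    proof eventually_elim
      case (elim x)
      show ?case by (intro tendsto_mult filterlim_compose[OF _ e_lim] tendsto_const)
          (use elim in blast)
    qed
    show "AE x in lborel. norm ((F (x + e n *\<^sub>R v) - F x) / e n * \<phi> x)
        \<le> indicator (cball 0 R) x * (L * norm v * \<bar>\<phi> x\<bar>)" for n
    proof (intro AE_I2)
      fix x
      have "\<bar>(F (x + e n *\<^sub>R v) - F x) / e n\<bar> \<le> L * norm v"
        using lF[of "x + e n *\<^sub>R v" x] e[of n] by (simp add: abs_divide divide_le_eq mult_ac)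
      then have "\<bar>(F (x + e n *\<^sub>R v) - F x) / e n\<bar> * \<bar>\<phi> x\<bar> \<le> L * norm v * \<bar>\<phi> x\<bar>"
        by (rule mult_right_mono) simp
      then show "norm ((F (x + e n *\<^sub>R v) - F x) / e n * \<phi> x)
          \<le> indicator (cball 0 R) x * (L * norm v * \<bar>\<phi> x\<bar>)"
        using supp[of x] by (cases "norm x > R") (auto simp: abs_mult indicator_def)
    qed
  qed measurable
  have lim2: "(\<lambda>n. \<integral>x. F x * ((\<phi> (x + (- e n) *\<^sub>R v) - \<phi> x) / (- e n)) \<partial>lborel)
      \<longlonglongrightarrow> (\<integral>x. F x * d\<phi> x \<partial>lborel)"
  proof (rule integral_dominated_convergence[where w="\<lambda>x. indicator (cball 0 (R + norm v)) x * (M * norm v * \<bar>F x\<bar>)"])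
    show "integrable lborel (\<lambda>x. indicator (cball 0 (R + norm v)) x * (M * norm v * \<bar>F x\<bar>))"
      by (intro int_cpt continuous_intros contF)
    have e_lim': "filterlim (\<lambda>n. - e n) (at 0) sequentially"
      using e_lim tendsto_minus[of e 0 sequentially] by (auto simp: filterlim_at)
    show "AE x in lborel. (\<lambda>n. F x * ((\<phi> (x + (- e n) *\<^sub>R v) - \<phi> x) / (- e n))) \<longlonglongrightarrow> F x * d\<phi> x"
      by (intro AE_I2 tendsto_mult tendsto_const filterlim_compose[OF d\<phi> e_lim'])
    show "AE x in lborel. norm (F x * ((\<phi> (x + (- e n) *\<^sub>R v) - \<phi> x) / (- e n)))
        \<le> indicator (cball 0 (R + norm v)) x * (M * norm v * \<bar>F x\<bar>)" for n
    proof (intro AE_I2)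
      fix x
      have b: "\<bar>(\<phi> (x + (- e n) *\<^sub>R v) - \<phi> x) / (- e n)\<bar> \<le> M * norm v"
        using l\<phi>[of "x + (- e n) *\<^sub>R v" x] e[of n] by (simp add: abs_divide divide_le_eq mult_ac)
      show "norm (F x * ((\<phi> (x + (- e n) *\<^sub>R v) - \<phi> x) / (- e n)))
          \<le> indicator (cball 0 (R + norm v)) x * (M * norm v * \<bar>F x\<bar>)"
      proof (cases "norm x > R + norm v")
        case True
        have "norm (e n *\<^sub>R v) \<le> norm v" using e[of n] by (simp add: mult_left_le_one_le)
        then have "norm (x + (- e n) *\<^sub>R v) > R"
          using True norm_triangle_ineq2[of x "e n *\<^sub>R v"] by simp
        moreover have "norm x > R" using True norm_ge_zero[of v] by linarith
        ultimately show ?thesis using supp M0 by simp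
      next
        case False
        then show ?thesis using mult_right_mono[OF b, of "\<bar>F x\<bar>"]
          by (simp add: abs_mult mult_ac)
      qed
    qed
  qed measurable
  have "(\<lambda>n. - (\<integral>x. F x * ((\<phi> (x + (- e n) *\<^sub>R v) - \<phi> x) / (- e n)) \<partial>lborel))
      \<longlonglongrightarrow> - (\<integral>x. F x * d\<phi> x \<partial>lborel)"
    using lim2 by (rule tendsto_minus)
  then show ?thesis using lim1 unfolding eq by (rule LIMSEQ_unique[rotated])
qed

section \<open>Smooth bumps on boxes\<close>

text \<open>A continuously differentiable function with values in \<open>[0, 1)\<close> that vanishes exactly on the nonpositive
half-line.\<close>
definition smooth_step :: "real \<Rightarrow> real" where
  "smooth_step t = (max 0 t)\<^sup>2 / (1 + (max 0 t)\<^sup>2)"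

lemma smooth_step_bounds: "0 \<le> smooth_step t" "smooth_step t \<le> 1"
  by (auto simp: smooth_step_def divide_simps add_pos_nonneg)

lemma smooth_step_nonpos: "t \<le> 0 \<Longrightarrow> smooth_step t = 0"
  by (simp add: smooth_step_def)

lemma max0_square_deriv: "((\<lambda>t. (max 0 t)\<^sup>2) has_real_derivative 2 * max 0 t) (at (t::real))"
proof (cases "t = 0")
  case True
  have "((\<lambda>h::real. ((max 0 (0 + h))\<^sup>2 - (max 0 0)\<^sup>2) / h) \<longlongrightarrow> 0) (at 0)"
  proof (rule Lim_null_comparison)
    show "\<forall>\<^sub>F h in at 0. norm (((max 0 (0 + h))\<^sup>2 - (max 0 0)\<^sup>2) / h) \<le> norm (h::real)"
      by (auto simp: eventually_at max_def power2_eq_square intro!: exI[of _ 1])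
    show "((\<lambda>h::real. norm h) \<longlongrightarrow> 0) (at 0)" by (rule tendsto_norm_zero) simp
  qed
  then show ?thesis using True by (simp add: DERIV_def)
next
  case False
  show ?thesis
  proof (cases "t > 0")
    case True
    have "((\<lambda>t::real. t\<^sup>2) has_real_derivative 2 * max 0 t) (at t)"
      using True by (auto intro!: derivative_eq_intros)
    then show ?thesis
      by (rule DERIV_cong_ev[THEN iffD1, rotated 3, OF _ refl _ refl])
         (use True in \<open>auto simp: eventually_nhds intro!: exI[of _ "{0<..}"]\<close>)
  next
    case False
    with \<open>t \<noteq> 0\<close> have t: "t < 0" by simp
    have "((\<lambda>t::real. 0) has_real_derivative 2 * max 0 t) (at t)"
      using t by auto
    then show ?thesis
      by (rule DERIV_cong_ev[THEN iffD1, rotated 3, OF _ refl _ refl])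
         (use t in \<open>auto simp: eventually_nhds intro!: exI[of _ "{..<0}"]\<close>)
  qed
qed

lemma smooth_step_deriv:
  "(smooth_step has_real_derivative 2 * max 0 t / (1 + (max 0 t)\<^sup>2)\<^sup>2) (at t)"
proof -
  have p: "1 + (max 0 t)\<^sup>2 > 0" by (simp add: add_pos_nonneg)
  have "((\<lambda>t. (max 0 t)\<^sup>2 / (1 + (max 0 t)\<^sup>2)) has_real_derivative
     (2 * max 0 t * (1 + (max 0 t)\<^sup>2) - (max 0 t)\<^sup>2 * (0 + 2 * max 0 t)) / ((1 + (max 0 t)\<^sup>2) * (1 + (max 0 t)\<^sup>2))) (at t)"
    using p by (intro DERIV_divide DERIV_add max0_square_deriv DERIV_const) auto
  then show ?thesis
    by (simp add: smooth_step_def[abs_def] algebra_simps power2_eq_square)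
qed

lemma smooth_step_lipschitz: "\<bar>smooth_step s - smooth_step t\<bar> \<le> 1 * \<bar>s - t\<bar>"
proof -
  have b: "norm (2 * max 0 u / (1 + (max 0 u)\<^sup>2)\<^sup>2) \<le> 1" for u :: real
  proof -
    define m where "m = max 0 u"
    have m: "m \<ge> 0" by (simp add: m_def)
    have "2 * m \<le> 1 + m\<^sup>2" using sum_squares_bound[of 1 m] by simp
    also have "\<dots> \<le> (1 + m\<^sup>2)\<^sup>2" using m by (simp add: power2_eq_square algebra_simps)
    finally have "2 * m / (1 + m\<^sup>2)\<^sup>2 \<le> 1"
      by (simp add: divide_le_eq add_pos_nonneg)
    then show ?thesis using m by (simp add: m_def[symmetric])
  qed
  have "norm (smooth_step s - smooth_step t) \<le> 1 * norm (s - t)"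
    by (rule field_differentiable_bound[where S=UNIV, OF _ _ b])
       (auto intro: has_field_derivative_at_within smooth_step_deriv)
  then show ?thesis by simp
qed

text \<open>A differentiable Lipschitz function that is positive exactly on the open box from \<open>c\<close> to \<open>d\<close>, when
\<open>m > 0\<close>, and tends to the indicator of this box as \<open>m\<close> grows.\<close>

definition bump :: "real \<Rightarrow> 'b::euclidean_space \<Rightarrow> 'b \<Rightarrow> 'b \<Rightarrow> real" where
  "bump m c d x = (\<Prod>i\<in>Basis. smooth_step (m * ((x - c) \<bullet> i)) * smooth_step (m * ((d - x) \<bullet> i)))"

lemma bump_bounds: "0 \<le> bump m c d x" "bump m c d x \<le> 1"
  unfolding bump_def by (auto intro!: prod_nonneg prod_le_1 mult_nonneg_nonneg mult_le_one smooth_step_bounds)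

lemma bump_outside:
  assumes "x \<notin> box c d" "m > 0"
  shows "bump m c d x = 0"
proof -
  obtain i where i: "i \<in> Basis" "\<not> (c \<bullet> i < x \<bullet> i \<and> x \<bullet> i < d \<bullet> i)"
    using assms(1) by (auto simp: mem_box)
  then have "smooth_step (m * ((x - c) \<bullet> i)) * smooth_step (m * ((d - x) \<bullet> i)) = 0"
    using assms(2) by (auto simp: inner_diff_left mult_nonneg_nonpos intro!: smooth_step_nonpos)
  then show ?thesis unfolding bump_def using i(1) by (metis (no_types, lifting) finite_Basis prod_zero_iff)
qed

lemma bump_tendsto_indicator:
  "(\<lambda>k. bump (real (Suc k)) c d x) \<longlonglongrightarrow> indicator (box c d) x"
proof (cases "x \<in> box c d")
  case False
  then show ?thesis by (simp add: bump_outside del: of_nat_Suc)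
next
  case True
  have st: "(\<lambda>k. smooth_step (real (Suc k) * t)) \<longlonglongrightarrow> 1" if "t > 0" for t
  proof -
    have "(\<lambda>k. 1 - inverse (1 + (real (Suc k) * t)\<^sup>2)) \<longlonglongrightarrow> 1 - 0"
    proof (intro tendsto_intros tendsto_inverse_0_at_top)
      have "filterlim (\<lambda>k. real (Suc k) * t) at_top sequentially"
        using that filterlim_compose[OF filterlim_real_sequentially filterlim_Suc]
        by (subst mult.commute) (intro filterlim_tendsto_pos_mult_at_top[OF tendsto_const])
      then have "filterlim (\<lambda>k. (real (Suc k) * t)^2) at_top sequentially"
        by (intro filterlim_pow_at_top) auto
      then show "filterlim (\<lambda>k. 1 + (real (Suc k) * t)^2) at_top sequentially"
        by (intro filterlim_tendsto_add_at_top[OF tendsto_const])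
    qed
    moreover have "1 - inverse (1 + (real (Suc k) * t)\<^sup>2) = smooth_step (real (Suc k) * t)" for k
    proof -
      have "max 0 (real (Suc k) * t) = real (Suc k) * t" using that by (simp add: max_def)
      moreover have "1 + (real (Suc k) * t)\<^sup>2 \<noteq> 0" by (metis add_pos_nonneg less_irrefl zero_le_power2 zero_less_one)
      ultimately show ?thesis unfolding smooth_step_def by (simp add: divide_simps)
    qed
    ultimately show ?thesis by simp
  qed
  have "(\<lambda>k. bump (real (Suc k)) c d x) \<longlonglongrightarrow> (\<Prod>i\<in>(Basis::'a set). 1 * 1)"
    unfolding bump_def
    using True by (intro tendsto_prod tendsto_mult st) (auto simp: mem_box inner_diff_left)
  then show ?thesis using True by simp
qed

lemma bump_lipschitz: "(\<Sum>i\<in>(Basis::'b set). 2 * \<bar>m\<bar>)-lipschitz_on UNIV (bump m c (d::'b::euclidean_space))"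
proof (rule lipschitz_onI)
  fix x y :: 'b
  have st: "\<bar>smooth_step (m * s) - smooth_step (m * t)\<bar> \<le> \<bar>m\<bar> * \<bar>s - t\<bar>" for s t
    using smooth_step_lipschitz[of "m * s" "m * t"]
    by (simp add: abs_mult[symmetric] right_diff_distrib)
  have in1: "\<bar>(x - y) \<bullet> i\<bar> \<le> dist x y" if "i \<in> Basis" for i
    using Basis_le_norm[OF that, of "x - y"] by (simp add: dist_norm)
  let ?f = "\<lambda>x i. smooth_step (m * ((x - c) \<bullet> i)) * smooth_step (m * ((d - x) \<bullet> i))"
  have "norm (bump m c d x - bump m c d y) \<le> (\<Sum>i\<in>Basis. norm (?f x i - ?f y i))"
    unfolding bump_def
    by (rule norm_prod_diff) (auto intro!: mult_le_one smooth_step_bounds simp: abs_mult abs_of_nonneg smooth_step_bounds)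
  also have "\<dots> \<le> (\<Sum>i\<in>(Basis::'b set). 2 * \<bar>m\<bar> * dist x y)"
  proof (rule sum_mono)
    fix i :: 'b assume i: "i \<in> Basis"
    have "norm (?f x i - ?f y i)
      = \<bar>smooth_step (m * ((x - c) \<bullet> i)) * (smooth_step (m * ((d - x) \<bullet> i)) - smooth_step (m * ((d - y) \<bullet> i)))
        + (smooth_step (m * ((x - c) \<bullet> i)) - smooth_step (m * ((y - c) \<bullet> i))) * smooth_step (m * ((d - y) \<bullet> i))\<bar>"
      by (simp add: algebra_simps)
    also have "\<dots> \<le> 1 * (\<bar>m\<bar> * dist x y) + (\<bar>m\<bar> * dist x y) * 1"
    proof (rule order_trans[OF abs_triangle_ineq add_mono]; subst abs_mult; rule mult_mono)
      have "\<bar>(d - x) \<bullet> i - (d - y) \<bullet> i\<bar> \<le> dist x y"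
        using in1[OF i] by (simp add: inner_diff_left abs_minus_commute)
      from mult_left_mono[OF this, of "\<bar>m\<bar>"]
      show "\<bar>smooth_step (m * ((d - x) \<bullet> i)) - smooth_step (m * ((d - y) \<bullet> i))\<bar> \<le> \<bar>m\<bar> * dist x y"
        using st order_trans by fastforce
      have "\<bar>(x - c) \<bullet> i - (y - c) \<bullet> i\<bar> \<le> dist x y"
        using in1[OF i] by (simp add: inner_diff_left)
      from mult_left_mono[OF this, of "\<bar>m\<bar>"]
      show "\<bar>smooth_step (m * ((x - c) \<bullet> i)) - smooth_step (m * ((y - c) \<bullet> i))\<bar> \<le> \<bar>m\<bar> * dist x y"
        using st order_trans by fastforce
    qed (auto simp: smooth_step_bounds)
    finally show "norm (?f x i - ?f y i) \<le> 2 * \<bar>m\<bar> * dist x y" by simp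
  qed
  finally show "dist (bump m c d x) (bump m c d y) \<le> (\<Sum>i\<in>(Basis::'b set). 2 * \<bar>m\<bar>) * dist x y"
    by (simp add: dist_real_def mult_ac)
qed (simp add: sum_nonneg)

lemma bump_differentiable: "\<exists>D. GDERIV (bump m c d) x :> D"
proof -
  have st: "((\<lambda>x. smooth_step (l x)) has_derivative (\<lambda>h. l' h * (2 * max 0 (l x) / (1 + (max 0 (l x))\<^sup>2)\<^sup>2))) (at x)"
    if "(l has_derivative l') (at x)" for l :: "'a \<Rightarrow> real" and l'
    using has_derivative_compose[OF that smooth_step_deriv[of "l x", unfolded has_field_derivative_def]]
    by (simp add: mult_ac)
  have "(bump m c d) differentiable (at x)"
    unfolding bump_def[abs_def]
    by (rule differentiableI) (auto intro!: has_derivative_prod has_derivative_mult st derivative_eq_intros)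
  then obtain f' where f': "(bump m c d has_derivative f') (at x)"
    unfolding differentiable_def by blast
  then have "linear f'" by (rule has_derivative_linear)
  then have "f' = (\<lambda>h. h \<bullet> adjoint f' 1)"
    using adjoint_works[OF \<open>linear f'\<close>, of _ 1] by (simp add: fun_eq_iff)
  with f' show ?thesis unfolding gderiv_def by metis
qed

text \<open>The bumps converge boundedly to indicators of boxes, so \<open>h\<close> has integral \<open>0\<close> over all boxes, and then
over all Borel sets since the boxes form a generator that is stable under intersections.\<close>

lemma AE_zero_if_orthogonal_to_bumps:
  fixes h :: "'b::euclidean_space \<Rightarrow> real"
  assumes int: "integrable lborel (\<lambda>x. indicator (box a b) x * h x)"
    and orth: "\<And>m c d. m > 0 \<Longrightarrow> box c d \<subseteq> box a b \<Longrightarrow> (\<integral>x. h x * bump m c d x \<partial>lborel) = 0"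
  shows "AE x in lborel. x \<in> box a b \<longrightarrow> h x = 0"
proof -
  define g where "g x = indicator (box a b) x * h x" for x
  have g: "integrable lborel g" using int by (simp add: g_def[abs_def])
  have box0: "(\<integral>x\<in>box c d. g x \<partial>lborel) = 0" for c d
  proof -
    obtain c' d' where cd: "box c' d' = box c d \<inter> box a b"
      using box_Int_box[of c d a b] by blast
    have sub: "box c' d' \<subseteq> box a b" using cd by simp
    have "(\<lambda>k. \<integral>x. g x * bump (real (Suc k)) c' d' x \<partial>lborel) \<longlonglongrightarrow> (\<integral>x. g x * indicator (box c' d') x \<partial>lborel)"
    proof (rule integral_dominated_convergence[where w="\<lambda>x. \<bar>g x\<bar>"])
      show "integrable lborel (\<lambda>x. \<bar>g x\<bar>)" using g by simp
      show "AE x in lborel. (\<lambda>k. g x * bump (real (Suc k)) c' d' x) \<longlonglongrightarrow> g x * indicator (box c' d') x"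
        by (intro AE_I2 tendsto_intros bump_tendsto_indicator)
      show "AE x in lborel. norm (g x * bump (real (Suc k)) c' d' x) \<le> \<bar>g x\<bar>" for k
        by (intro AE_I2) (simp add: abs_mult bump_bounds abs_of_nonneg mult_left_le)
      have [measurable]: "bump m c' d' \<in> borel_measurable borel" for m
        using lipschitz_on_continuous_on[OF bump_lipschitz] by (rule borel_measurable_continuous_onI)
      have [measurable]: "g \<in> borel_measurable borel" using borel_measurable_integrable[OF g] by simp
      show "(\<lambda>x. g x * bump (real (Suc k)) c' d' x) \<in> borel_measurable lborel" for k by measurable
      show "(\<lambda>x. g x * indicator (box c' d') x) \<in> borel_measurable lborel" by measurable
    qed
    moreover have "(\<integral>x. g x * bump (real (Suc k)) c' d' x \<partial>lborel) = 0" for k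
    proof -
      have "(\<integral>x. g x * bump (real (Suc k)) c' d' x \<partial>lborel) = (\<integral>x. h x * bump (real (Suc k)) c' d' x \<partial>lborel)"
        using bump_outside[of _ c' d' "real (Suc k)"] sub
        by (intro Bochner_Integration.integral_cong) (auto simp: g_def indicator_def simp del: of_nat_Suc)
      then show ?thesis using orth[OF _ sub] by simp
    qed
    ultimately have "(\<integral>x. g x * indicator (box c' d') x \<partial>lborel) = 0"
      using LIMSEQ_const_iff[of "0::real"] by simp
    moreover have "g x * indicator (box c' d') x = indicator (box c d) x *\<^sub>R g x" for x
      by (auto simp: cd g_def indicator_def)
    ultimately show ?thesis by (simp add: set_lebesgue_integral_def)
  qed
  have UN: "(\<integral>x. g x \<partial>lborel) = 0"
    using box0[of a b] by (simp add: set_lebesgue_integral_def g_def mult.assoc[symmetric] flip: indicator_inter_arith)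
  have sint: "set_integrable lborel A g" if "A \<in> sets borel" for A
    using g that unfolding set_integrable_def by (intro integrable_mult_indicator) auto
  have all: "(\<integral>x\<in>A. g x \<partial>lborel) = 0" if "A \<in> sets borel" for A
  proof -
    have "A \<in> sigma_sets UNIV (range (\<lambda>(c, d). box c d))"
      using that by (simp add: borel_eq_box sets_measure_of)
    have "Int_stable (range (\<lambda>(c, d). box c d :: 'b set))"
      by (auto simp: Int_stable_def box_Int_box)
    moreover have "range (\<lambda>(c, d). box c d :: 'b set) \<subseteq> Pow UNIV" by simp
    moreover note \<open>A \<in> sigma_sets UNIV (range (\<lambda>(c, d). box c d))\<close>
    ultimately show ?thesis
    proof (induction rule: sigma_sets_induct_disjoint)
      case (basic A) then show ?case using box0 by auto
    next
      case empty show ?case by (simp add: set_lebesgue_integral_def)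
    next
      case (compl A)
      have A: "A \<in> sets borel" using compl(1) by (simp add: borel_eq_box sets_measure_of)
      have "(\<integral>x\<in>(UNIV - A) \<union> A. g x \<partial>lborel) = (\<integral>x\<in>UNIV - A. g x \<partial>lborel) + (\<integral>x\<in>A. g x \<partial>lborel)"
        using A by (intro set_integral_Un sint) auto
      then show ?case using compl UN by (simp add: set_lebesgue_integral_def)
    next
      case (union A)
      have A: "A i \<in> sets borel" for i using union(2) by (auto simp: borel_eq_box sets_measure_of)
      have "(\<integral>x\<in>(\<Union>i. A i). g x \<partial>lborel) = (\<Sum>i. (\<integral>x\<in>A i. g x \<partial>lborel))"
        using A union(1) by (intro lebesgue_integral_countable_add sint) (auto simp: disjoint_family_on_def)
      then show ?case using union by simp
    qed
  qed
  have "AE x in lborel. g x = 0"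
    using density_unique_real[OF g, of "\<lambda>_. 0"] all by (simp add: set_lebesgue_integral_def)
  then show ?thesis by eventually_elim (auto simp: g_def indicator_def)
qed

section \<open>Rademacher's theorem\<close>

lemma bump_zero_outside_ball:
  assumes "m > 0"
  obtains R where "\<And>x. norm x > R \<Longrightarrow> bump m c d x = 0"
proof -
  obtain R where "\<And>x. x \<in> box c d \<Longrightarrow> norm x \<le> R"
    using bounded_box[of c d] unfolding bounded_iff by blast
  then show ?thesis using assms bump_outside that by (metis linorder_not_le)
qed

lemma GDERIV_imp_difference_quotient:
  assumes "GDERIV F x :> D"
  shows "((\<lambda>h. (F (x + h *\<^sub>R v) - F x) / h) \<longlongrightarrow> v \<bullet> D) (at 0)"
proof -
  have "((\<lambda>t. x + t *\<^sub>R v) has_derivative (\<lambda>t. t *\<^sub>R v)) (at 0)"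
    by (auto intro!: derivative_eq_intros)
  moreover have "(F has_derivative (\<lambda>h. h \<bullet> D)) (at (x + 0 *\<^sub>R v))"
    using assms by (simp add: gderiv_def)
  ultimately have "((\<lambda>t. F (x + t *\<^sub>R v)) has_derivative (\<lambda>t. (t *\<^sub>R v) \<bullet> D)) (at 0)"
    by (rule has_derivative_compose)
  then have "((\<lambda>t. F (x + t *\<^sub>R v)) has_real_derivative v \<bullet> D) (at 0)"
    by (simp add: has_field_derivative_def mult.commute[of "v \<bullet> D"] mult_commute_abs)
  then show ?thesis by (simp add: DERIV_def)
qed

lemma dir_deriv_bump_ibp:
  fixes F :: "'b::euclidean_space \<Rightarrow> real"
  assumes lip: "L-lipschitz_on UNIV F" and m: "m > 0"
  shows "(\<integral>x. dir_deriv F v x * bump m c d x \<partial>lborel) = - (\<integral>x. F x * dir_deriv (bump m c d) v x \<partial>lborel)"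
proof -
  obtain R where R: "\<And>x. norm x > R \<Longrightarrow> bump m c d x = 0"
    using bump_zero_outside_ball[OF m] by blast
  show ?thesis
  proof (rule dir_deriv_integral_by_parts[OF lip bump_lipschitz R])
    fix x
    obtain D where "GDERIV (bump m c d) x :> D" using bump_differentiable by blast
    from GDERIV_imp_difference_quotient[OF this, of v]
    show "((\<lambda>h. (bump m c d (x + h *\<^sub>R v) - bump m c d x) / h) \<longlongrightarrow> dir_deriv (bump m c d) v x) (at 0)"
      using dir_deriv_eq by metis
  next
    show "dir_deriv (bump m c d) v \<in> borel_measurable borel"
      by (intro dir_deriv_measurable lipschitz_on_continuous_on[OF bump_lipschitz])
  qed
qed

lemma dir_deriv_bump_linear:
  "dir_deriv (bump m c d) v x = (\<Sum>i\<in>Basis. (v \<bullet> i) * dir_deriv (bump m c d) i x)"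
proof -
  obtain D where D: "GDERIV (bump m c d) x :> D" using bump_differentiable by blast
  have eq: "dir_deriv (bump m c d) w x = w \<bullet> D" for w
    by (rule dir_deriv_eq) (rule GDERIV_imp_difference_quotient[OF D])
  show ?thesis unfolding eq euclidean_inner[of v D] by (simp add: inner_commute)
qed

lemma integrable_bounded_on_box:
  fixes f :: "'b::euclidean_space \<Rightarrow> real"
  assumes [measurable]: "f \<in> borel_measurable lborel" and "AE x in lborel. \<bar>f x\<bar> \<le> B"
  shows "integrable lborel (\<lambda>x. indicator (box c d) x * f x)"
proof (rule Bochner_Integration.integrable_bound)
  show "integrable lborel (\<lambda>x. \<bar>B\<bar> * indicator (box c d) x)"
    using emeasure_bounded_finite[OF bounded_box[of c d]] by (intro integrable_mult_right integrable_real_indicator) auto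
  show "AE x in lborel. norm (indicator (box c d) x * f x) \<le> norm (\<bar>B\<bar> * indicator (box c d) x)"
    using assms(2) by eventually_elim (auto simp: indicator_def)
qed measurable

lemma dir_deriv_times_bump_integrable:
  fixes F :: "'b::euclidean_space \<Rightarrow> real"
  assumes lip: "L-lipschitz_on UNIV F" and m: "m > 0"
  shows "integrable lborel (\<lambda>x. dir_deriv F v x * bump m c d x)"
proof -
  have [measurable]: "dir_deriv F v \<in> borel_measurable borel"
    by (intro dir_deriv_measurable lipschitz_on_continuous_on[OF lip])
  have [measurable]: "bump m c d \<in> borel_measurable borel"
    using lipschitz_on_continuous_on[OF bump_lipschitz] by (rule borel_measurable_continuous_onI)
  have "integrable lborel (\<lambda>x. indicator (box c d) x * (dir_deriv F v x * bump m c d x))"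
  proof (rule integrable_bounded_on_box)
    show "AE x in lborel. \<bar>dir_deriv F v x * bump m c d x\<bar> \<le> L * norm v"
      using lipschitz_has_dir_deriv_AE[OF lip, of v]
    proof eventually_elim
      case (elim x)
      then have "\<bar>dir_deriv F v x\<bar> * \<bar>bump m c d x\<bar> \<le> (L * norm v) * 1"
        by (intro mult_mono) (auto simp: bump_bounds abs_of_nonneg)
      then show ?case by (simp add: abs_mult)
    qed
  qed measurable
  moreover have "indicator (box c d) x * (dir_deriv F v x * bump m c d x) = dir_deriv F v x * bump m c d x" for x
    using bump_outside[OF _ m] by (auto simp: indicator_def)
  ultimately show ?thesis by simp
qed

lemma dir_deriv_eq_0_on_open:
  fixes f :: "'b::euclidean_space \<Rightarrow> real"
  assumes "open S" "x \<in> S" "\<And>y. y \<in> S \<Longrightarrow> f y = 0"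
  shows "dir_deriv f v x = 0"
proof (rule dir_deriv_eq, rule tendsto_eventually)
  have "((\<lambda>h. x + h *\<^sub>R v) \<longlongrightarrow> x + 0 *\<^sub>R v) (at 0)" by (intro tendsto_intros)
  then have "\<forall>\<^sub>F h in at 0. x + h *\<^sub>R v \<in> S" using assms(1,2) by (intro topological_tendstoD) auto
  then show "\<forall>\<^sub>F h in at 0. (f (x + h *\<^sub>R v) - f x) / h = 0"
    by eventually_elim (simp add: assms)
qed

lemma lipschitz_times_dir_deriv_bump_integrable:
  fixes F :: "'b::euclidean_space \<Rightarrow> real"
  assumes contF: "continuous_on UNIV F" and m: "m > 0"
  shows "integrable lborel (\<lambda>x. F x * dir_deriv (bump m c d) v x)"
proof -
  have [measurable]: "F \<in> borel_measurable borel"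
    using contF by (rule borel_measurable_continuous_onI)
  have [measurable]: "dir_deriv (bump m c d) v \<in> borel_measurable borel"
    by (intro dir_deriv_measurable lipschitz_on_continuous_on[OF bump_lipschitz])
  obtain R where R: "\<And>x. norm x > R \<Longrightarrow> bump m c d x = 0"
    using bump_zero_outside_ball[OF m] by blast
  let ?M = "(\<Sum>i\<in>(Basis::'b set). 2 * \<bar>m\<bar>) * norm v"
  show ?thesis
  proof (rule Bochner_Integration.integrable_bound)
    have "continuous_on (cball 0 R) (\<lambda>x. \<bar>F x\<bar> * ?M)"
      by (intro continuous_intros continuous_on_subset[OF contF]) auto
    then show "integrable lborel (\<lambda>x. indicator (cball 0 R) x *\<^sub>R (\<bar>F x\<bar> * ?M))"
    proof -
      have "(\<lambda>x. indicator (cball 0 R) x *\<^sub>R (\<bar>F x\<bar> * ?M)) = (\<lambda>x. if x \<in> cball 0 R then \<bar>F x\<bar> * ?M else 0)"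
        by (auto simp: indicator_def fun_eq_iff)
      then show ?thesis
        using borel_integrable_compact[OF compact_cball \<open>continuous_on (cball 0 R) (\<lambda>x. \<bar>F x\<bar> * ?M)\<close>] by simp
    qed
    show "AE x in lborel. norm (F x * dir_deriv (bump m c d) v x)
        \<le> norm (indicator (cball 0 R) x *\<^sub>R (\<bar>F x\<bar> * ?M))"
      using lipschitz_has_dir_deriv_AE[OF bump_lipschitz[of m c d], of v]
    proof eventually_elim
      case (elim x)
      show ?case
      proof (cases "norm x > R")
        case False
        have "\<bar>F x\<bar> * \<bar>dir_deriv (bump m c d) v x\<bar> \<le> \<bar>F x\<bar> * ?M"
          using elim by (intro mult_left_mono) auto
        then show ?thesis using False by (simp add: abs_mult)
      next
        case True
        have "dir_deriv (bump m c d) v x = 0"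
        proof (rule dir_deriv_eq_0_on_open)
          show "open {y. R < norm y}" by (intro open_Collect_less continuous_intros)
        qed (use R True in auto)
        then show ?thesis using True by simp
      qed
    qed
  qed measurable
qed

text \<open>For smooth functions the derivative is linear in the direction; integration by parts transfers this to
the distributional derivatives of \<open>F\<close>, and these are the almost everywhere derivatives.\<close>

lemma lipschitz_dir_deriv_linear_AE:
  fixes F :: "'b::euclidean_space \<Rightarrow> real"
  assumes lip: "L-lipschitz_on UNIV F"
  shows "AE x in lborel. dir_deriv F v x = (\<Sum>i\<in>Basis. (v \<bullet> i) * dir_deriv F i x)"
proof -
  have contF: "continuous_on UNIV F" using lip by (rule lipschitz_on_continuous_on)
  have [measurable]: "dir_deriv F w \<in> borel_measurable borel" for w
    by (intro dir_deriv_measurable contF)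
  define h where "h x = dir_deriv F v x - (\<Sum>i\<in>Basis. (v \<bullet> i) * dir_deriv F i x)" for x
  have [measurable]: "h \<in> borel_measurable borel" unfolding h_def by measurable
  have "\<forall>i\<in>Basis. AE x in lborel. \<bar>dir_deriv F i x\<bar> \<le> L * norm i"
  proof
    fix i :: 'b
    show "AE x in lborel. \<bar>dir_deriv F i x\<bar> \<le> L * norm i"
      using lipschitz_has_dir_deriv_AE[OF lip, of i] by (rule eventually_mono) blast
  qed
  then have "AE x in lborel. \<forall>i\<in>Basis. \<bar>dir_deriv F i x\<bar> \<le> L * norm i"
    by (subst AE_finite_all) auto
  moreover have "AE x in lborel. \<bar>dir_deriv F v x\<bar> \<le> L * norm v"
    using lipschitz_has_dir_deriv_AE[OF lip, of v] by (rule eventually_mono) blast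
  ultimately have bnd: "AE x in lborel. \<bar>h x\<bar> \<le> L * norm v + (\<Sum>i\<in>Basis. \<bar>v \<bullet> i\<bar> * (L * norm i))"
  proof eventually_elim
    case (elim x)
    have "\<bar>\<Sum>i\<in>Basis. (v \<bullet> i) * dir_deriv F i x\<bar> \<le> (\<Sum>i\<in>Basis. \<bar>v \<bullet> i\<bar> * (L * norm i))"
      using elim by (intro order_trans[OF sum_abs] sum_mono) (auto simp: abs_mult intro!: mult_left_mono)
    then show ?case using elim unfolding h_def by linarith
  qed
  have "AE x in lborel. x \<in> box a b \<longrightarrow> h x = 0" for a b :: 'b
  proof (rule AE_zero_if_orthogonal_to_bumps)
    show "integrable lborel (\<lambda>x. indicator (box a b) x * h x)"
      by (rule integrable_bounded_on_box[OF _ bnd]) measurable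
    fix m :: real and c d :: 'b assume m: "m > 0"
    note i1 = dir_deriv_times_bump_integrable[OF lip m]
    note i2 = lipschitz_times_dir_deriv_bump_integrable[OF contF m]
    have "(\<integral>x. h x * bump m c d x \<partial>lborel)
        = (\<integral>x. dir_deriv F v x * bump m c d x - (\<Sum>i\<in>Basis. (v \<bullet> i) * (dir_deriv F i x * bump m c d x)) \<partial>lborel)"
      by (intro Bochner_Integration.integral_cong) (simp_all add: h_def left_diff_distrib sum_distrib_right mult.assoc)
    also have "\<dots> = (\<integral>x. dir_deriv F v x * bump m c d x \<partial>lborel)
          - (\<Sum>i\<in>Basis. (v \<bullet> i) * (\<integral>x. dir_deriv F i x * bump m c d x \<partial>lborel))"
      using i1 by simp
    also have "\<dots> = - ((\<integral>x. F x * dir_deriv (bump m c d) v x \<partial>lborel)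
          - (\<Sum>i\<in>Basis. (v \<bullet> i) * (\<integral>x. F x * dir_deriv (bump m c d) i x \<partial>lborel)))"
      by (simp add: dir_deriv_bump_ibp[OF lip m] sum_negf)
    also have "(\<Sum>i\<in>Basis. (v \<bullet> i) * (\<integral>x. F x * dir_deriv (bump m c d) i x \<partial>lborel))
         = (\<integral>x. (\<Sum>i\<in>Basis. (v \<bullet> i) * (F x * dir_deriv (bump m c d) i x)) \<partial>lborel)"
      using i2 by simp
    also have "\<dots> = (\<integral>x. F x * dir_deriv (bump m c d) v x \<partial>lborel)"
      by (intro Bochner_Integration.integral_cong)
         (auto simp: dir_deriv_bump_linear[of m c d v] sum_distrib_left mult_ac)
    finally show "(\<integral>x. h x * bump m c d x \<partial>lborel) = 0" by simp
  qed
  then have "AE x in lborel. \<forall>n::nat. x \<in> box (- real n *\<^sub>R One) (real n *\<^sub>R One) \<longrightarrow> h x = 0"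
    by (subst AE_all_countable) auto
  then show ?thesis
  proof eventually_elim
    case (elim x)
    obtain n :: nat where "x \<in> box (- (real n *\<^sub>R One)) (real n *\<^sub>R One)"
      using UNIV_I[of x] unfolding UN_box_eq_UNIV[symmetric] by (rule UN_E)
    then have "h x = 0" using elim[rule_format, of n] by simp
    then show ?case by (simp add: h_def)
  qed
qed

text \<open>The unit sphere is covered by finitely many small balls around directions in \<open>V\<close>. An increment in an
arbitrary direction differs from one in a nearby direction of \<open>V\<close> by at most the Lipschitz constant times
the distance of the end points.\<close>

lemma GDERIV_if_linear_along_dense_directions:
  fixes F :: "'b::euclidean_space \<Rightarrow> real"
  assumes lip: "L-lipschitz_on UNIV F"
    and dense: "\<And>U. open U \<Longrightarrow> U \<noteq> {} \<Longrightarrow> \<exists>v\<in>V. v \<in> U"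
    and lim: "\<And>v. v \<in> V \<Longrightarrow> ((\<lambda>h. (F (x + h *\<^sub>R v) - F x) / h) \<longlongrightarrow> v \<bullet> g) (at 0)"
  shows "GDERIV F x :> g"
  unfolding gderiv_def has_derivative_at_alt
proof (intro conjI allI impI)
  show "bounded_linear (\<lambda>h. h \<bullet> g)" by (rule bounded_linear_inner_left)
  fix e :: real assume e: "e > 0"
  have L0: "L \<ge> 0" using lip by (rule lipschitz_on_nonneg)
  \<comment> \<open>The three summands of the denominator bound the three errors made in replacing a direction.\<close>
  define e' where "e' = e / (L + norm g + 1)"
  have pos: "L + norm g + 1 > 0" using L0 by (simp add: add_nonneg_pos)
  have e': "e' > 0" using e pos by (simp add: e'_def)
  have "sphere (0::'b) 1 \<subseteq> (\<Union>v\<in>V. ball v e')"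
  proof
    fix u :: 'b
    obtain v where "v \<in> V" "v \<in> ball u e'"
      using dense[of "ball u e'"] e' by (auto simp: ball_eq_empty)
    then show "u \<in> (\<Union>v\<in>V. ball v e')" by (auto simp: dist_commute)
  qed
  then obtain V0 where V0: "V0 \<subseteq> V" "finite V0" "sphere (0::'b) 1 \<subseteq> (\<Union>v\<in>V0. ball v e')"
    using compactE_image[of "sphere (0::'b) 1" V "\<lambda>v. ball v e'"] by auto
  have "\<forall>v\<in>V0. \<forall>\<^sub>F h in at 0. \<bar>(F (x + h *\<^sub>R v) - F x) / h - v \<bullet> g\<bar> < e'"
    using lim V0(1) e' by (auto simp: tendsto_iff dist_real_def)
  then have "\<forall>\<^sub>F h in at 0. \<forall>v\<in>V0. \<bar>(F (x + h *\<^sub>R v) - F x) / h - v \<bullet> g\<bar> < e'"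
    using V0(2) by (simp add: eventually_ball_finite_distrib)
  then obtain d where d: "d > 0"
    "\<And>h v. h \<noteq> 0 \<Longrightarrow> \<bar>h\<bar> < d \<Longrightarrow> v \<in> V0 \<Longrightarrow> \<bar>(F (x + h *\<^sub>R v) - F x) / h - v \<bullet> g\<bar> < e'"
    unfolding eventually_at by (auto simp: dist_real_def)
  show "\<exists>d>0. \<forall>y. norm (y - x) < d \<longrightarrow> norm (F y - F x - (y - x) \<bullet> g) \<le> e * norm (y - x)"
  proof (intro exI[of _ d] conjI allI impI)
    fix y assume y: "norm (y - x) < d"
    show "norm (F y - F x - (y - x) \<bullet> g) \<le> e * norm (y - x)"
    proof (cases "y = x")
      case False
      define t where "t = norm (y - x)"
      define u where "u = (1 / t) *\<^sub>R (y - x)"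
      have t: "t > 0" "t < d" using False y by (auto simp: t_def)
      have yx: "y = x + t *\<^sub>R u" using t by (simp add: u_def)
      have "norm u = 1" using t by (simp add: u_def t_def)
      then obtain v where v: "v \<in> V0" "norm (u - v) < e'"
        using V0(3) by (fastforce simp: dist_norm norm_minus_commute)
      have "\<bar>(F (x + t *\<^sub>R v) - F x) / t - v \<bullet> g\<bar> < e'" using d(2) t v by auto
      then have "\<bar>(F (x + t *\<^sub>R v) - F x) / t - v \<bullet> g\<bar> * t \<le> e' * t"
        using t by (intro mult_right_mono) auto
      moreover have "\<bar>(F (x + t *\<^sub>R v) - F x) / t - v \<bullet> g\<bar> * t = \<bar>F (x + t *\<^sub>R v) - F x - t * (v \<bullet> g)\<bar>"
        using t by (simp add: field_simps flip: abs_mult_pos)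
      ultimately have 1: "\<bar>F (x + t *\<^sub>R v) - F x - t * (v \<bullet> g)\<bar> \<le> e' * t" by simp
      have "\<bar>F y - F (x + t *\<^sub>R v)\<bar> \<le> L * norm (t *\<^sub>R (u - v))"
        using lipschitz_onD[OF lip, of y "x + t *\<^sub>R v"]
        by (simp add: yx dist_norm scaleR_right_diff_distrib)
      also have "\<dots> \<le> L * (t * e')"
        using t v L0 by (intro mult_left_mono) auto
      finally have 2: "\<bar>F y - F (x + t *\<^sub>R v)\<bar> \<le> L * (t * e')" .
      have "\<bar>(u - v) \<bullet> g\<bar> \<le> e' * norm g"
        using Cauchy_Schwarz_ineq2[of "u - v" g] v by (meson less_imp_le mult_right_mono norm_ge_zero order_trans)
      then have 3: "\<bar>t * (v \<bullet> g) - t * (u \<bullet> g)\<bar> \<le> t * (e' * norm g)"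
        using t by (simp add: right_diff_distrib[symmetric] abs_mult inner_diff_left[symmetric] abs_minus_commute)
           (metis abs_minus_commute inner_diff_left mult_le_cancel_left_pos)
      have "(y - x) \<bullet> g = t * (u \<bullet> g)" by (simp add: yx)
      then have "\<bar>F y - F x - (y - x) \<bullet> g\<bar> \<le> L * (t * e') + e' * t + t * (e' * norm g)"
        using 1 2 3 by linarith
      also have "\<dots> = e' * (L + norm g + 1) * t" by (simp add: algebra_simps)
      also have "\<dots> = e * t" using pos by (simp add: e'_def)
      finally show ?thesis by (simp add: t_def)
    qed simp
  qed (rule d(1))
qed

text \<open>For almost every \<open>x\<close> the directional derivatives along all directions of a countable dense set exist and
depend linearly on the direction.\<close>

theorem rademacher:
  fixes F :: "'b::euclidean_space \<Rightarrow> real"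
  assumes lip: "L-lipschitz_on UNIV F"
  shows "AE x in lborel. GDERIV F x :> (\<Sum>i\<in>Basis. dir_deriv F i x *\<^sub>R i)"
proof -
  obtain V :: "'b set" where V: "countable V" "\<And>U. open U \<Longrightarrow> U \<noteq> {} \<Longrightarrow> \<exists>v\<in>V. v \<in> U"
    by (rule countable_dense_setE) blast
  have "AE x in lborel. \<forall>v\<in>V. ((\<lambda>h. (F (x + h *\<^sub>R v) - F x) / h) \<longlongrightarrow> dir_deriv F v x) (at 0)"
    using V(1) lipschitz_has_dir_deriv_AE[OF lip] by (subst AE_ball_countable) (auto elim: eventually_mono)
  moreover have "AE x in lborel. \<forall>v\<in>V. dir_deriv F v x = (\<Sum>i\<in>Basis. (v \<bullet> i) * dir_deriv F i x)"
    using V(1) lipschitz_dir_deriv_linear_AE[OF lip] by (subst AE_ball_countable) auto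
  ultimately show ?thesis
  proof eventually_elim
    case (elim x)
    have eq: "v \<bullet> (\<Sum>i\<in>Basis. dir_deriv F i x *\<^sub>R i) = (\<Sum>i\<in>Basis. (v \<bullet> i) * dir_deriv F i x)" for v
      by (simp add: inner_sum_right mult_ac)
    show ?case
      by (rule GDERIV_if_linear_along_dense_directions[OF lip V(2)]) (use elim in \<open>auto simp: eq\<close>)
  qed
qed

section \<open>Locally Lipschitz maps and barycentric coordinates\<close>

lemma loc_lipschitz_map_compose:
  assumes f: "loc_lipschitz_map d A d' f" and g: "loc_lipschitz_map d' B d'' g"
    and AB: "f ` A \<subseteq> B" and refl: "\<And>x. x \<in> A \<Longrightarrow> d x x = 0"
    and nonneg: "\<And>x y. x \<in> A \<Longrightarrow> y \<in> A \<Longrightarrow> 0 \<le> d x y" "\<And>x y. x \<in> B \<Longrightarrow> y \<in> B \<Longrightarrow> 0 \<le> d' x y"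
  shows "loc_lipschitz_map d A d'' (g \<circ> f)"
  unfolding loc_lipschitz_map_def
proof
  fix x assume x: "x \<in> A"
  then obtain r L where r: "r > 0" and L: "\<And>y z. y \<in> A \<Longrightarrow> z \<in> A \<Longrightarrow> d x y < r \<Longrightarrow> d x z < r \<Longrightarrow> d' (f y) (f z) \<le> L * d y z"
    using f unfolding loc_lipschitz_map_def by metis
  have "f x \<in> B" using x AB by auto
  then obtain r' L' where r': "r' > 0" and L': "\<And>y z. y \<in> B \<Longrightarrow> z \<in> B \<Longrightarrow> d' (f x) y < r' \<Longrightarrow> d' (f x) z < r' \<Longrightarrow> d'' (g y) (g z) \<le> L' * d' y z"
    using g unfolding loc_lipschitz_map_def by metis
  define M where "M = max L 1"
  define M' where "M' = max L' 0"
  define r0 where "r0 = min r (r' / M)"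
  have M: "M > 0" "L \<le> M" by (auto simp: M_def)
  have M': "M' \<ge> 0" "L' \<le> M'" by (auto simp: M'_def)
  have r0: "r0 > 0" "r0 \<le> r" "r0 \<le> r' / M" using r r' M by (auto simp: r0_def)
  have small: "d' (f x) (f y) < r'" if "y \<in> A" "d x y < r0" for y
  proof -
    have "d' (f x) (f y) \<le> L * d x y" using L[of x y] that x refl r0 r by auto
    also have "\<dots> \<le> M * d x y" using M nonneg(1) x that by (intro mult_right_mono) auto
    also have "\<dots> < M * r0" using that M by simp
    also have "\<dots> \<le> r'" using M r0 by (simp add: field_simps)
    finally show ?thesis .
  qed
  have "d'' ((g \<circ> f) y) ((g \<circ> f) z) \<le> (M' * M) * d y z"
    if y: "y \<in> A" "d x y < r0" and z: "z \<in> A" "d x z < r0" for y z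
  proof -
    have B: "f y \<in> B" "f z \<in> B" using y z AB by auto
    have "d'' (g (f y)) (g (f z)) \<le> L' * d' (f y) (f z)"
      using L' B small y z by auto
    also have "\<dots> \<le> M' * d' (f y) (f z)" using M' nonneg(2) B by (intro mult_right_mono) auto
    also have "\<dots> \<le> M' * (L * d y z)" using L y z r0 M' by (intro mult_left_mono) auto
    also have "\<dots> \<le> M' * (M * d y z)" using M M' nonneg(1) y z by (intro mult_left_mono mult_right_mono) auto
    finally show ?thesis by (simp add: mult_ac)
  qed
  then show "\<exists>r>0. \<exists>L. \<forall>y\<in>A. \<forall>z\<in>A. d x y < r \<longrightarrow> d x z < r \<longrightarrow> d'' ((g \<circ> f) y) ((g \<circ> f) z) \<le> L * d y z"
    using r0(1) by blast
qed

lemma loc_lipschitz_map_continuous_on: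
  fixes f :: "'p::metric_space \<Rightarrow> 'q::metric_space"
  assumes "loc_lipschitz_map dist A dist f"
  shows "continuous_on A f"
proof (rule continuous_onI)
  fix x and e :: real assume x: "x \<in> A" and e: "e > 0"
  obtain r L where r: "r > 0" and L: "\<And>y z. y \<in> A \<Longrightarrow> z \<in> A \<Longrightarrow> dist x y < r \<Longrightarrow> dist x z < r \<Longrightarrow> dist (f y) (f z) \<le> L * dist y z"
    using assms x unfolding loc_lipschitz_map_def by metis
  define M where "M = max L 1"
  have M: "M > 0" "L \<le> M" by (auto simp: M_def)
  have "dist (f y) (f x) \<le> e" if "y \<in> A" "dist y x < min r (e / M)" for y
  proof -
    have "dist (f y) (f x) \<le> L * dist y x" using L[of y x] that x r by (auto simp: dist_commute)
    also have "\<dots> \<le> M * dist y x" using M by (intro mult_right_mono) auto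
    also have "\<dots> \<le> M * (e / M)" using that M by (intro mult_left_mono) auto
    finally show ?thesis using M by simp
  qed
  moreover have "min r (e / M) > 0" using r e M by simp
  ultimately show "\<exists>d>0. \<forall>y\<in>A. dist y x < d \<longrightarrow> dist (f y) (f x) \<le> e" by blast
qed

lemma loc_lipschitz_map_lipschitz_on_compact:
  fixes f :: "'p::metric_space \<Rightarrow> 'q::metric_space"
  assumes loc: "loc_lipschitz_map dist A dist f" and C: "compact C" "C \<subseteq> A"
  shows "\<exists>L. L-lipschitz_on C f"
proof -
  have "local_lipschitz {0::real} C (\<lambda>_. f)"
    unfolding local_lipschitz_def
  proof (intro ballI)
    fix x and t :: real assume x: "x \<in> C"
    obtain r L where r: "r > 0" and L: "\<And>y z. y \<in> A \<Longrightarrow> z \<in> A \<Longrightarrow> dist x y < r \<Longrightarrow> dist x z < r \<Longrightarrow> dist (f y) (f z) \<le> L * dist y z"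
      using loc x C unfolding loc_lipschitz_map_def by (metis subsetD)
    have "(max L 0)-lipschitz_on (cball x (r/2) \<inter> C) f"
    proof (rule lipschitz_onI)
      fix y z assume yz: "y \<in> cball x (r/2) \<inter> C" "z \<in> cball x (r/2) \<inter> C"
      then have "dist (f y) (f z) \<le> L * dist y z" using L[of y z] C r by auto
      also have "\<dots> \<le> max L 0 * dist y z" by (intro mult_right_mono) auto
      finally show "dist (f y) (f z) \<le> max L 0 * dist y z" .
    qed simp
    then show "\<exists>u>0. \<exists>L. \<forall>t\<in>cball t u \<inter> {0}. L-lipschitz_on (cball x u \<inter> C) f"
      using r by (intro exI[of _ "r/2"]) auto
  qed
  from local_lipschitz_compact_implies_lipschitz[OF this C(1) compact_sing]
  show ?thesis by (metis continuous_on_sing singletonI)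
qed

lemma bary_dist_nonneg: "0 \<le> bary_dist \<alpha> \<beta>"
  unfolding bary_dist_def by (simp add: sum_nonneg)

lemma coordinate_le_bary_dist:
  assumes "finite (supp \<alpha>)" "finite (supp \<beta>)"
  shows "\<bar>\<alpha> v - \<beta> v\<bar> \<le> bary_dist \<alpha> \<beta>"
proof (cases "v \<in> supp \<alpha> \<union> supp \<beta>")
  case True
  have "(\<alpha> v - \<beta> v)\<^sup>2 \<le> (\<Sum>v\<in>supp \<alpha> \<union> supp \<beta>. (\<alpha> v - \<beta> v)\<^sup>2)"
    using assms True by (intro member_le_sum) auto
  then have "sqrt ((\<alpha> v - \<beta> v)\<^sup>2) \<le> bary_dist \<alpha> \<beta>"
    unfolding bary_dist_def by (rule real_sqrt_le_mono)
  then show ?thesis by simp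
next
  case False
  then show ?thesis using bary_dist_nonneg by (auto simp: supp_def)
qed

lemma bary_embed_superset:
  assumes "finite s" "supp \<alpha> \<subseteq> s"
  shows "bary_embed \<alpha> = (\<Sum>v\<in>s. \<alpha> v *\<^sub>R v)"
  unfolding bary_embed_def using assms by (intro sum.mono_neutral_left) (auto simp: supp_def)

locale riem_poly =
  fixes P :: "('e::euclidean_space, 'a::metric_space, 'n::finite) rpoly"
  assumes riem: "riemannian_polyhedron P"
begin

lemma lip_poly: "lipschitz_polyhedron P" and homog: "homogeneous P"
  using riem by (auto simp: riemannian_polyhedron_def)

abbreviation "R \<equiv> realization (cplx P)"

lemma simplex_finite: "s \<in> cplx P \<Longrightarrow> finite s" and simplex_nonempty: "s \<in> cplx P \<Longrightarrow> s \<noteq> {}"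
  and subsimplex: "s \<in> cplx P \<Longrightarrow> t \<subseteq> s \<Longrightarrow> t \<noteq> {} \<Longrightarrow> t \<in> cplx P"
  using lip_poly unfolding lipschitz_polyhedron_def simplicial_complex_abs_def by blast+

lemma countable_cplx: "countable (cplx P)"
  using lip_poly unfolding lipschitz_polyhedron_def by blast

lemma maxs_cplx: "s \<in> maxs P \<Longrightarrow> s \<in> cplx P"
  by (simp add: maxs_def maximal_simplexes_def)

lemma maxs_maximal: "s \<in> maxs P \<Longrightarrow> t \<in> cplx P \<Longrightarrow> s \<subseteq> t \<Longrightarrow> t = s"
  by (simp add: maxs_def maximal_simplexes_def)

lemma countable_maxs: "countable (maxs P)"
  by (rule countable_subset[OF _ countable_cplx]) (auto intro: maxs_cplx)

lemma triang_homeo: "lipschitz_homeo bary_dist R dist UNIV (triang P)"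
  and bary_embed_homeo: "lipschitz_homeo bary_dist R dist (bary_embed ` R) bary_embed"
  using lip_poly unfolding lipschitz_polyhedron_def by blast+

lemma bij_triang: "bij_betw (triang P) R UNIV" and bij_bary_embed: "bij_betw bary_embed R (bary_embed ` R)"
  using triang_homeo bary_embed_homeo by (auto simp: lipschitz_homeo_def)

lemma bary_in_realization: "bary P p \<in> R" and triang_bary: "triang P (bary P p) = p"
  using bij_triang unfolding bary_def bij_betw_def
  by (metis UNIV_I inv_into_into, metis UNIV_I f_inv_into_f)

lemma bary_triang: "\<alpha> \<in> R \<Longrightarrow> bary P (triang P \<alpha>) = \<alpha>"
  using bij_triang unfolding bary_def bij_betw_def by simp

lemma bary_nonneg: "0 \<le> bary P p v" and carrier_in_cplx: "carrier_simplex P p \<in> cplx P"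
  and bary_sum: "(\<Sum>v\<in>carrier_simplex P p. bary P p v) = 1"
  using bary_in_realization[of p] by (auto simp: realization_def carrier_simplex_def)

lemma carrier_finite: "finite (carrier_simplex P p)"
  using carrier_in_cplx simplex_finite by blast

lemma in_carrier_iff: "v \<in> carrier_simplex P p \<longleftrightarrow> 0 < bary P p v"
  using bary_nonneg[of p v] by (auto simp: carrier_simplex_def supp_def)

lemma inj_pos: "inj (pos P)"
proof (rule injI)
  fix p q assume "pos P p = pos P q"
  then have "bary P p = bary P q"
    using bij_bary_embed bary_in_realization unfolding pos_def bij_betw_def inj_on_def by blast
  then show "p = q" using triang_bary by metis
qed

text \<open>A convex combination of the vertices of a simplex defines a point of the realization; vertices with
coefficient \<open>0\<close> are dropped, so its carrier may be a proper face.\<close>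

lemma realization_hull_coordinates:
  assumes s: "s \<in> cplx P" and u: "\<And>v. v \<in> s \<Longrightarrow> 0 \<le> u v" "sum u s = 1"
  obtains p where "pos P p = (\<Sum>v\<in>s. u v *\<^sub>R v)" "\<And>v. v \<in> s \<Longrightarrow> bary P p v = u v"
    "carrier_simplex P p \<subseteq> s"
proof -
  define \<alpha> where "\<alpha> v = (if v \<in> s then u v else 0)" for v
  have fs: "finite s" using s simplex_finite by blast
  have sub: "supp \<alpha> \<subseteq> s" by (auto simp: \<alpha>_def supp_def split: if_splits)
  have "(\<Sum>v\<in>supp \<alpha>. \<alpha> v) = (\<Sum>v\<in>s. \<alpha> v)"
    using fs sub by (intro sum.mono_neutral_left) (auto simp: supp_def)
  also have "\<dots> = 1" using u(2) by (simp add: \<alpha>_def)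
  finally have sum1: "(\<Sum>v\<in>supp \<alpha>. \<alpha> v) = 1" .
  then have "supp \<alpha> \<noteq> {}" by auto
  then have "supp \<alpha> \<in> cplx P" using subsimplex s sub by blast
  then have \<alpha>R: "\<alpha> \<in> R" using sum1 u by (auto simp: realization_def \<alpha>_def)
  show ?thesis
  proof (rule that[of "triang P \<alpha>"])
    show "pos P (triang P \<alpha>) = (\<Sum>v\<in>s. u v *\<^sub>R v)"
      using bary_embed_superset[OF fs sub] by (simp add: pos_def bary_triang \<alpha>R \<alpha>_def)
    show "bary P (triang P \<alpha>) v = u v" if "v \<in> s" for v
      using that by (simp add: bary_triang \<alpha>R \<alpha>_def)
    show "carrier_simplex P (triang P \<alpha>) \<subseteq> s"
      using sub by (simp add: carrier_simplex_def bary_triang \<alpha>R)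
  qed
qed

lemma pos_in_hull_iff:
  assumes s: "s \<in> cplx P"
  shows "pos P p \<in> convex hull s \<longleftrightarrow> carrier_simplex P p \<subseteq> s"
proof
  assume "pos P p \<in> convex hull s"
  then obtain u where u: "\<forall>x\<in>s. 0 \<le> u x" "sum u s = 1" "(\<Sum>x\<in>s. u x *\<^sub>R x) = pos P p"
    unfolding convex_hull_finite[OF simplex_finite[OF s]] by blast
  obtain q where "pos P q = pos P p" "carrier_simplex P q \<subseteq> s"
    using realization_hull_coordinates[OF s, of u] u by metis
  then show "carrier_simplex P p \<subseteq> s" using inj_pos by (metis injD)
next
  assume sub: "carrier_simplex P p \<subseteq> s"
  have fs: "finite s" using s simplex_finite by blast
  have "(\<Sum>v\<in>s. bary P p v) = 1"
    using bary_sum[of p] sum.mono_neutral_left[OF fs sub, of "bary P p"]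
    by (auto simp: carrier_simplex_def supp_def)
  moreover have "pos P p = (\<Sum>v\<in>s. bary P p v *\<^sub>R v)"
    unfolding pos_def using bary_embed_superset[OF fs] sub by (simp add: carrier_simplex_def)
  ultimately show "pos P p \<in> convex hull s"
    unfolding convex_hull_finite[OF fs] using bary_nonneg
    by (intro CollectI exI[of _ "bary P p"]) simp
qed

lemma hull_subset_range_pos:
  assumes s: "s \<in> cplx P" and y: "y \<in> convex hull s"
  shows "pos P (inv (pos P) y) = y"
proof -
  obtain u where u: "\<forall>x\<in>s. 0 \<le> u x" "sum u s = 1" "(\<Sum>x\<in>s. u x *\<^sub>R x) = y"
    using y unfolding convex_hull_finite[OF simplex_finite[OF s]] by blast
  then obtain q where "pos P q = y"
    using realization_hull_coordinates[OF s, of u] by metis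
  then show ?thesis by (metis f_inv_into_f rangeI)
qed

lemma range_pos: "range (pos P) = bary_embed ` R"
proof -
  have "range (bary P) = R"
  proof
    show "R \<subseteq> range (bary P)"
    proof
      fix \<alpha> assume "\<alpha> \<in> R"
      then have "\<alpha> = bary P (triang P \<alpha>)" by (simp add: bary_triang)
      then show "\<alpha> \<in> range (bary P)" by (rule range_eqI)
    qed
  qed (use bary_in_realization in auto)
  then show ?thesis unfolding pos_def[abs_def] by (simp add: image_image flip: \<open>range (bary P) = R\<close>)
qed

lemma bary_loc_lipschitz: "loc_lipschitz_map dist UNIV bary_dist (bary P)"
  using triang_homeo by (simp add: lipschitz_homeo_def bary_def[abs_def])

lemma pos_loc_lipschitz: "loc_lipschitz_map dist UNIV dist (pos P)"
proof -
  have "loc_lipschitz_map bary_dist R dist bary_embed"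
    using bary_embed_homeo by (simp add: lipschitz_homeo_def)
  moreover have "bary P ` UNIV \<subseteq> R" using bary_in_realization by auto
  ultimately have "loc_lipschitz_map dist UNIV dist (bary_embed \<circ> bary P)"
    by (intro loc_lipschitz_map_compose[OF bary_loc_lipschitz]) (auto simp: bary_dist_nonneg)
  then show ?thesis by (simp add: pos_def[abs_def] comp_def)
qed

lemma inv_pos_loc_lipschitz: "loc_lipschitz_map dist (range (pos P)) dist (inv (pos P))"
proof -
  have 1: "loc_lipschitz_map dist (bary_embed ` R) bary_dist (inv_into R bary_embed)"
    using bary_embed_homeo by (simp add: lipschitz_homeo_def)
  have 2: "loc_lipschitz_map bary_dist R dist (triang P)"
    using triang_homeo by (simp add: lipschitz_homeo_def)
  have "loc_lipschitz_map dist (bary_embed ` R) dist (triang P \<circ> inv_into R bary_embed)"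
    by (rule loc_lipschitz_map_compose[OF 1 2]) (auto intro: inv_into_into simp: bary_dist_nonneg)
  moreover have "(triang P \<circ> inv_into R bary_embed) y = inv (pos P) y" if y: "y \<in> bary_embed ` R" for y
  proof -
    obtain p where p: "y = pos P p" using y range_pos by blast
    have "inv_into R bary_embed y = bary P p"
      using bij_bary_embed bary_in_realization p unfolding pos_def bij_betw_def by (simp add: inv_into_f_f)
    then show ?thesis using p triang_bary inj_pos by (simp add: inv_f_f)
  qed
  ultimately show ?thesis
    unfolding loc_lipschitz_map_def range_pos by (metis (no_types, lifting))
qed

lemma continuous_pos: "continuous_on A (pos P)"
  using loc_lipschitz_map_continuous_on[OF pos_loc_lipschitz] continuous_on_subset by blast

lemma continuous_bary: "continuous_on UNIV (\<lambda>p. bary P p v)"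
proof -
  have "loc_lipschitz_map dist UNIV dist (\<lambda>p. bary P p v)"
    unfolding loc_lipschitz_map_def
  proof
    fix x :: 'a
    obtain r L where r: "r > 0" and L: "\<And>y z. dist x y < r \<Longrightarrow> dist x z < r \<Longrightarrow> bary_dist (bary P y) (bary P z) \<le> L * dist y z"
      using bary_loc_lipschitz unfolding loc_lipschitz_map_def by (metis UNIV_I)
    have "dist (bary P y v) (bary P z v) \<le> L * dist y z" if "dist x y < r" "dist x z < r" for y z
      using L[OF that] coordinate_le_bary_dist[of "bary P y" "bary P z" v] carrier_finite
      by (simp add: dist_real_def carrier_simplex_def)
    then show "\<exists>r>0. \<exists>L. \<forall>y\<in>UNIV. \<forall>z\<in>UNIV. dist x y < r \<longrightarrow> dist x z < r \<longrightarrow> dist (bary P y v) (bary P z v) \<le> L * dist y z"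
      using r by blast
  qed
  then show ?thesis by (rule loc_lipschitz_map_continuous_on)
qed

lemma open_bary_pos: "open {p. 0 < bary P p v}"
  using continuous_bary by (intro open_Collect_less continuous_on_const)

lemma carrier_eq_max_iff:
  assumes "s \<in> maxs P"
  shows "carrier_simplex P p = s \<longleftrightarrow> (\<forall>v\<in>s. 0 < bary P p v)"
  using maxs_maximal[OF assms carrier_in_cplx, of p] in_carrier_iff[of _ p] by blast

lemma open_open_simplex:
  assumes "s \<in> maxs P"
  shows "open {p. carrier_simplex P p = s}"
proof -
  have "{p. carrier_simplex P p = s} = (\<Inter>v\<in>s. {p. 0 < bary P p v})"
    using carrier_eq_max_iff[OF assms] by auto
  then show ?thesis
    using open_bary_pos simplex_finite[OF maxs_cplx[OF assms]] by (simp add: open_INT)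
qed

text \<open>Near \<open>p\<close> the barycentric coordinate of a vertex \<open>v\<close> of the carrier of \<open>p\<close> stays positive, so every simplex
met there contains \<open>v\<close>.\<close>

lemma locally_finitely_many_simplexes:
  "\<exists>W. open W \<and> p \<in> W \<and> finite {s \<in> cplx P. \<exists>q\<in>W. carrier_simplex P q \<subseteq> s}"
proof -
  obtain v where v: "v \<in> carrier_simplex P p"
    using simplex_nonempty[OF carrier_in_cplx] by blast
  have "finite {s \<in> cplx P. v \<in> s}"
    using lip_poly unfolding lipschitz_polyhedron_def locally_finite_complex_def by blast
  moreover have "{s \<in> cplx P. \<exists>q\<in>{q. 0 < bary P q v}. carrier_simplex P q \<subseteq> s} \<subseteq> {s \<in> cplx P. v \<in> s}"
    using in_carrier_iff by blast
  ultimately show ?thesis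
    using open_bary_pos[of v] v in_carrier_iff by (intro exI[of _ "{q. 0 < bary P q v}"]) (auto intro: finite_subset)
qed

lemma in_some_maximal_simplex: "\<exists>s\<in>maxs P. carrier_simplex P p \<subseteq> s"
proof -
  obtain d where d: "\<forall>s\<in>cplx P. card s \<le> d + 1"
    using lip_poly unfolding lipschitz_polyhedron_def finite_dim_complex_def by blast
  let ?Q = "\<lambda>s. s \<in> cplx P \<and> carrier_simplex P p \<subseteq> s"
  obtain s where s: "?Q s" "\<And>t. ?Q t \<Longrightarrow> card t \<le> card s"
    using ex_has_greatest_nat[of ?Q "carrier_simplex P p" card "d + 2"] d carrier_in_cplx
    by (metis less_add_Suc1 add.commute add_2_eq_Suc' le_imp_less_Suc nat_less_le order_refl plus_1_eq_Suc)
  have "t = s" if t: "t \<in> cplx P" "s \<subseteq> t" for t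
    using s t simplex_finite[OF t(1)] by (metis card_seteq order_trans)
  then show ?thesis using s by (auto simp: maxs_def maximal_simplexes_def)
qed

end

section \<open>Charts of maximal simplexes\<close>

locale riem_simplex = riem_poly P for P :: "('e::euclidean_space, 'a::metric_space, 'n::finite) rpoly" +
  fixes s :: "'e set"
  assumes smax: "s \<in> maxs P"
begin

lemma scplx: "s \<in> cplx P" using smax by (rule maxs_cplx)

lemma sfin: "finite s" using scplx by (rule simplex_finite)

lemma card_s: "card s = CARD('n) + 1"
  using homog smax by (auto simp: homogeneous_def)

text \<open>The linear part of the chart, an isometric embedding; \<open>unlin\<close> inverts the chart on the affine hull of \<open>s\<close>,
and the adjoint makes it continuous on the whole space.\<close>

definition lin :: "real^'n \<Rightarrow> 'e" where "lin x = chart P s x - chart P s 0"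

definition unlin :: "'e \<Rightarrow> real^'n" where "unlin y = adjoint lin (y - chart P s 0)"

lemma chart_eq: "chart P s x = chart P s 0 + lin x" by (simp add: lin_def)

lemma lin_linear: "linear lin" and lin_norm: "norm (lin x) = norm x"
  and range_chart: "range (chart P s) = affine hull s"
proof -
  have "euclidean_chart s (chart P s)"
    using riem smax by (auto simp: riemannian_polyhedron_def)
  then show "linear lin" "norm (lin x) = norm x" "range (chart P s) = affine hull s"
    by (auto simp: euclidean_chart_def lin_def[abs_def])
qed

lemma lin_inner: "lin x \<bullet> lin y = x \<bullet> y"
proof -
  have "norm (lin (x + y)) = norm (x + y)" by (rule lin_norm)
  then have "(lin x + lin y) \<bullet> (lin x + lin y) = (x + y) \<bullet> (x + y)"
    by (simp add: linear_add[OF lin_linear] norm_eq)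
  moreover have "lin x \<bullet> lin x = x \<bullet> x" "lin y \<bullet> lin y = y \<bullet> y"
    using lin_norm by (simp_all add: norm_eq)
  ultimately show ?thesis by (simp add: inner_add inner_commute)
qed

lemma adjoint_lin_lin: "adjoint lin (lin x) = x"
proof -
  have "z \<bullet> adjoint lin (lin x) = z \<bullet> x" for z
    by (simp add: adjoint_works[OF lin_linear] lin_inner)
  then show ?thesis by (metis vector_eq_ldot)
qed

lemma unlin_chart: "unlin (chart P s x) = x"
  by (simp add: unlin_def lin_def[symmetric] adjoint_lin_lin)

lemma inj_chart: "inj (chart P s)" by (metis injI unlin_chart)

lemma chart_unlin: "y \<in> affine hull s \<Longrightarrow> chart P s (unlin y) = y"
  using range_chart unlin_chart by (metis rangeE)

lemma inv_chart: "y \<in> affine hull s \<Longrightarrow> inv (chart P s) y = unlin y"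
  using inj_chart chart_unlin by (metis inv_f_f)

lemma continuous_chart: "continuous_on A (chart P s)"
proof -
  have "continuous_on A (\<lambda>x. chart P s 0 + lin x)"
    using lin_linear by (intro continuous_intros linear_continuous_on) (simp add: linear_conv_bounded_linear)
  then show ?thesis by (simp flip: chart_eq)
qed

lemma continuous_unlin: "continuous_on A unlin"
proof -
  have "linear (adjoint lin)" by (rule adjoint_linear[OF lin_linear])
  then have "continuous_on UNIV (adjoint lin)" by (simp add: linear_continuous_on linear_conv_bounded_linear)
  then show ?thesis unfolding unlin_def[abs_def]
    by (rule continuous_on_compose2) (auto intro!: continuous_intros)
qed

lemma dist_chart: "dist (chart P s x) (chart P s y) = dist x y"
  by (simp add: dist_norm chart_eq[of x] chart_eq[of y] linear_diff[OF lin_linear, symmetric] lin_norm)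

text \<open>The affine hull of the \<open>n + 1\<close> vertices has dimension \<open>n\<close>, being the image of an isometric chart.\<close>

lemma aff_indep: "\<not> affine_dependent s"
proof -
  have injl: "inj lin" using adjoint_lin_lin by (metis injI)
  have "affine hull s = (+) (chart P s 0) ` range lin"
    by (simp add: range_chart[symmetric] image_image flip: chart_eq)
  then have "aff_dim (affine hull s) = aff_dim (range lin)"
    by (simp only: aff_dim_translation_eq)
  also have "\<dots> = int CARD('n)"
    using aff_dim_injective_linear_image[OF lin_linear injl, of UNIV] by simp
  finally show ?thesis
    unfolding affine_independent_iff_card using sfin card_s by simp
qed

lemma hull_subset_affine: "convex hull s \<subseteq> affine hull s" by (rule convex_hull_subset_affine_hull)

lemma cell_eq: "cell P s = unlin ` (convex hull s)"
proof (intro set_eqI iffI)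
  fix x assume "x \<in> cell P s"
  then show "x \<in> unlin ` (convex hull s)"
    by (intro image_eqI[of _ _ "chart P s x"]) (simp_all add: unlin_chart cell_def)
next
  fix x assume "x \<in> unlin ` (convex hull s)"
  then show "x \<in> cell P s"
    using hull_subset_affine by (auto simp: cell_def chart_unlin subset_iff)
qed

lemma compact_cell: "compact (cell P s)"
  unfolding cell_eq using sfin
  by (intro compact_continuous_image continuous_unlin compact_convex_hull finite_imp_compact)

lemma convex_cell: "convex (cell P s)"
proof (rule convexI)
  fix x y and u v :: real assume xy: "x \<in> cell P s" "y \<in> cell P s" and uv: "0 \<le> u" "0 \<le> v" "u + v = 1"
  have "chart P s (u *\<^sub>R x + v *\<^sub>R y) = u *\<^sub>R chart P s x + v *\<^sub>R chart P s y"
  proof -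
    have "chart P s 0 = u *\<^sub>R chart P s 0 + v *\<^sub>R chart P s 0"
      using scaleR_left_distrib[of u v "chart P s 0"] uv(3) by simp
    then show ?thesis
      by (simp add: chart_eq[of x] chart_eq[of y] chart_eq[of "u *\<^sub>R x + v *\<^sub>R y"]
        linear_add[OF lin_linear] linear_cmul[OF lin_linear] scaleR_right_distrib)
  qed
  then show "u *\<^sub>R x + v *\<^sub>R y \<in> cell P s"
    using xy uv convexD[OF convex_convex_hull, of "chart P s x" s "chart P s y" u v] by (simp add: cell_def)
qed

lemma pos_point: "x \<in> cell P s \<Longrightarrow> pos P (point P s x) = chart P s x"
  unfolding point_def cell_def using hull_subset_range_pos[OF scplx] by simp

lemma coord_point: "x \<in> cell P s \<Longrightarrow> coord P s (point P s x) = x"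
  unfolding coord_def by (simp add: pos_point inv_f_f inj_chart)

lemma coord_eq_unlin: "carrier_simplex P p \<subseteq> s \<Longrightarrow> coord P s p = unlin (pos P p)"
  unfolding coord_def using pos_in_hull_iff[OF scplx] hull_subset_affine inv_chart by blast

lemma coord_in_cell: "carrier_simplex P p \<subseteq> s \<Longrightarrow> coord P s p \<in> cell P s"
  using pos_in_hull_iff[OF scplx] by (auto simp: coord_eq_unlin cell_eq)

lemma chart_coord: "carrier_simplex P p \<subseteq> s \<Longrightarrow> chart P s (coord P s p) = pos P p"
  using pos_in_hull_iff[OF scplx] hull_subset_affine chart_unlin by (simp add: coord_eq_unlin subset_iff)

lemma point_coord: "carrier_simplex P p \<subseteq> s \<Longrightarrow> point P s (coord P s p) = p"
  unfolding point_def by (simp add: chart_coord inv_f_f inj_pos)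

lemma closed_simplex_eq: "closed_simplex P s = pos P -` (convex hull s)"
  using pos_in_hull_iff[OF scplx] by (auto simp: closed_simplex_def)

lemma closed_closed_simplex: "closed (closed_simplex P s)"
  unfolding closed_simplex_eq
  by (intro closed_vimage continuous_pos compact_imp_closed compact_convex_hull finite_imp_compact sfin)

lemma continuous_coord: "continuous_on (closed_simplex P s) (coord P s)"
proof -
  have "continuous_on (closed_simplex P s) (\<lambda>p. unlin (pos P p))"
    by (rule continuous_on_compose2[OF continuous_unlin continuous_pos subset_UNIV])
  then show ?thesis
    by (rule continuous_on_eq) (simp add: coord_eq_unlin closed_simplex_def)
qed

lemma point_lipschitz: "\<exists>L. L-lipschitz_on (cell P s) (point P s)"
proof -
  have sub: "chart P s ` cell P s \<subseteq> range (pos P)"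
    using pos_point by (metis image_subset_iff rangeI)
  have "compact (chart P s ` cell P s)"
    by (intro compact_continuous_image continuous_chart compact_cell)
  then obtain L where L: "L-lipschitz_on (chart P s ` cell P s) (inv (pos P))"
    using loc_lipschitz_map_lipschitz_on_compact[OF inv_pos_loc_lipschitz _ sub] by blast
  have "L-lipschitz_on (cell P s) (point P s)"
  proof (rule lipschitz_onI)
    show "dist (point P s x) (point P s y) \<le> L * dist x y" if "x \<in> cell P s" "y \<in> cell P s" for x y
      using lipschitz_onD[OF L, of "chart P s x" "chart P s y"] that by (simp add: point_def dist_chart)
  qed (rule lipschitz_on_nonneg[OF L])
  then show ?thesis by blast
qed

lemma continuous_point: "continuous_on (cell P s) (point P s)"
  using point_lipschitz lipschitz_on_continuous_on by blast

text \<open>Since the vertices are affinely independent, the relative interior of their hull consists of the points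
with positive barycentric coordinates; so interior points of the cell are those carried by \<open>s\<close> itself.\<close>

lemma interior_cell_rel_interior: "interior (cell P s) = {x. chart P s x \<in> rel_interior (convex hull s)}"
proof
  let ?T = "chart P s ` interior (cell P s)"
  have T: "?T = affine hull s \<inter> unlin -` interior (cell P s)"
  proof (intro set_eqI iffI)
    fix y assume "y \<in> ?T"
    then obtain x where x: "x \<in> interior (cell P s)" "y = chart P s x" by blast
    have "y \<in> range (chart P s)" using x by simp
    then show "y \<in> affine hull s \<inter> unlin -` interior (cell P s)"
      using x range_chart by (simp add: unlin_chart)
  next
    fix y assume y: "y \<in> affine hull s \<inter> unlin -` interior (cell P s)"
    then show "y \<in> ?T" by (intro image_eqI[of _ _ "unlin y"]) (simp_all add: chart_unlin)
  qed
  have "openin (top_of_set (affine hull s)) ?T"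
    unfolding T by (intro continuous_openin_preimage_gen continuous_unlin open_interior)
  moreover have "?T \<subseteq> convex hull s"
    using interior_subset[of "cell P s"] by (auto simp: cell_def)
  ultimately have "?T \<subseteq> rel_interior (convex hull s)"
    by (intro rel_interior_maximal) (auto simp: affine_hull_convex_hull)
  then show "interior (cell P s) \<subseteq> {x. chart P s x \<in> rel_interior (convex hull s)}" by blast
next
  obtain U where U: "open U" "rel_interior (convex hull s) = affine hull s \<inter> U"
    using openin_rel_interior[of "convex hull s"] by (auto simp: openin_open affine_hull_convex_hull)
  have eq: "{x. chart P s x \<in> rel_interior (convex hull s)} = chart P s -` U"
    using U range_chart by auto
  have "open (chart P s -` U)" using U(1) by (intro open_vimage continuous_chart)
  moreover have "chart P s -` U \<subseteq> cell P s"
    unfolding eq[symmetric] using rel_interior_subset by (auto simp: cell_def)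
  ultimately show "{x. chart P s x \<in> rel_interior (convex hull s)} \<subseteq> interior (cell P s)"
    unfolding eq by (intro interior_maximal)
qed

lemma carrier_point_interior:
  assumes x: "x \<in> interior (cell P s)"
  shows "carrier_simplex P (point P s x) = s"
proof -
  have xc: "x \<in> cell P s" using x interior_subset by blast
  have "chart P s x \<in> rel_interior (convex hull s)" using x interior_cell_rel_interior by blast
  then obtain u where u: "\<forall>v\<in>s. 0 < u v" "sum u s = 1" "(\<Sum>v\<in>s. u v *\<^sub>R v) = chart P s x"
    unfolding rel_interior_convex_hull_explicit[OF aff_indep] by blast
  obtain p where p: "pos P p = (\<Sum>v\<in>s. u v *\<^sub>R v)" "\<And>v. v \<in> s \<Longrightarrow> bary P p v = u v"
    using realization_hull_coordinates[OF scplx, of u] u by (metis less_imp_le)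
  have "p = point P s x" using p(1) u(3) pos_point[OF xc] inj_pos by (metis injD)
  then show ?thesis using carrier_eq_max_iff[OF smax] p(2) u(1) by auto
qed

lemma coord_in_interior:
  assumes p: "carrier_simplex P p = s"
  shows "coord P s p \<in> interior (cell P s)"
proof -
  have "(\<Sum>v\<in>s. bary P p v) = 1" using bary_sum[of p] p by simp
  moreover have "pos P p = (\<Sum>v\<in>s. bary P p v *\<^sub>R v)"
    unfolding pos_def using bary_embed_superset[OF sfin] p by (simp add: carrier_simplex_def)
  moreover have "\<forall>v\<in>s. 0 < bary P p v" using p carrier_eq_max_iff[OF smax] by blast
  ultimately have "pos P p \<in> rel_interior (convex hull s)"
    unfolding rel_interior_convex_hull_explicit[OF aff_indep] by (auto intro!: exI[of _ "bary P p"])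
  then show ?thesis
    unfolding interior_cell_rel_interior using chart_coord p by simp
qed

lemma negligible_cell_boundary: "negligible (cell P s - interior (cell P s))"
proof -
  have "negligible (frontier (cell P s))" using convex_cell by (rule negligible_convex_frontier)
  then show ?thesis
    by (rule negligible_subset) (use compact_imp_closed[OF compact_cell] in \<open>auto simp: frontier_def\<close>)
qed

lemma open_simplex_image: "{p. carrier_simplex P p = s} = point P s ` interior (cell P s)"
  using carrier_point_interior coord_in_interior point_coord by (auto simp: image_iff) (metis order_refl)

end

section \<open>Uniformly elliptic matrices\<close>

text \<open>Along the segment from the identity to \<open>A\<close> all matrices are positive definite, so the determinant has no
zero there.\<close>
lemma posdef_det_pos:
  fixes A :: "real^'n^'n"
  assumes pd: "\<And>\<xi>. \<xi> \<noteq> 0 \<Longrightarrow> 0 < \<xi> \<bullet> (A *v \<xi>)"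
  shows "0 < det A"
proof (rule ccontr)
  assume neg: "\<not> 0 < det A"
  define h where "h t = det ((1 - t) *\<^sub>R mat 1 + t *\<^sub>R A)" for t :: real
  have "continuous_on {0..1} h"
    unfolding h_def det_def by (intro continuous_intros)
  moreover have "h 0 = 1" "h 1 = det A" by (simp_all add: h_def)
  ultimately obtain t where t: "0 \<le> t" "t \<le> 1" "h t = 0"
    using IVT2'[of h 1 0 0] neg by auto
  then have "\<not> invertible ((1 - t) *\<^sub>R mat 1 + t *\<^sub>R A)"
    by (simp add: invertible_det_nz h_def)
  then obtain \<xi> where \<xi>: "\<xi> \<noteq> 0" "((1 - t) *\<^sub>R mat 1 + t *\<^sub>R A) *v \<xi> = 0"
    by (metis invertible_left_inverse matrix_left_invertible_ker)
  have "0 = \<xi> \<bullet> (((1 - t) *\<^sub>R mat 1 + t *\<^sub>R A) *v \<xi>)" using \<xi>(2) by simp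
  also have "\<dots> = (1 - t) * (\<xi> \<bullet> \<xi>) + t * (\<xi> \<bullet> (A *v \<xi>))"
    by (simp add: matrix_vector_mult_add_rdistrib scaleR_matrix_vector_assoc[symmetric] inner_add_right)
  also have "\<dots> > 0"
    using t pd[OF \<xi>(1)] \<xi>(1) by (cases "t = 0") (auto intro!: add_nonneg_pos)
  finally show False by simp
qed

text \<open>The symmetric matrices whose quadratic form lies between \<open>c \<bar>\<xi>\<bar>\<^sup>2\<close> and \<open>C \<bar>\<xi>\<bar>\<^sup>2\<close>: the values that the metric
takes almost everywhere, for suitable constants.\<close>

definition bounded_forms :: "real \<Rightarrow> real \<Rightarrow> (real^'n^'n) set" where
  "bounded_forms c C = {A. transpose A = A \<and> (\<forall>\<xi>. c * (norm \<xi>)\<^sup>2 \<le> \<xi> \<bullet> (A *v \<xi>) \<and> \<xi> \<bullet> (A *v \<xi>) \<le> C * (norm \<xi>)\<^sup>2)}"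

lemma compact_bounded_forms:
  assumes c: "c > 0"
  shows "compact (bounded_forms c C :: (real^'n^'n) set)"
proof -
  have ent: "A $ i $ j = axis i 1 \<bullet> (A *v axis j 1)" for A :: "real^'n^'n" and i j
    by (simp add: matrix_vector_mult_basis inner_axis' column_def)
  have cont: "continuous_on UNIV (\<lambda>A::real^'n^'n. \<xi> \<bullet> (A *v \<xi>))" for \<xi>
    unfolding matrix_vector_mult_def inner_vec_def by (intro continuous_intros)
  have contT: "continuous_on UNIV (\<lambda>A::real^'n^'n. transpose A)"
    unfolding transpose_def by (intro continuous_intros)
  have eq: "(bounded_forms c C :: (real^'n^'n) set) = {A. transpose A = A} \<inter>
      (\<Inter>\<xi>. {A. c * (norm \<xi>)\<^sup>2 \<le> \<xi> \<bullet> (A *v \<xi>)} \<inter> {A. \<xi> \<bullet> (A *v \<xi>) \<le> C * (norm \<xi>)\<^sup>2})"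
    unfolding bounded_forms_def by auto
  have "closed (bounded_forms c C :: (real^'n^'n) set)"
    unfolding eq
    by (intro closed_Int closed_INT ballI closed_Collect_le closed_Collect_eq cont contT continuous_on_const continuous_on_id)
  moreover have "bounded (bounded_forms c C :: (real^'n^'n) set)"
    unfolding bounded_iff
  proof (intro exI ballI)
    fix A :: "real^'n^'n" assume A: "A \<in> bounded_forms c C"
    have b: "0 \<le> \<xi> \<bullet> (A *v \<xi>)" "\<xi> \<bullet> (A *v \<xi>) \<le> C * (norm \<xi>)\<^sup>2" for \<xi>
      using A c unfolding bounded_forms_def by (auto intro: order_trans[rotated])
    have entry: "\<bar>A $ i $ j\<bar> \<le> 4 * \<bar>C\<bar>" for i j
    proof -
      let ?x = "axis i 1 :: real^'n" and ?y = "axis j 1 :: real^'n"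
      have sym: "?x \<bullet> (A *v ?y) = ?y \<bullet> (A *v ?x)"
        using A dot_lmul_matrix[of ?x A ?y] unfolding bounded_forms_def
        by (metis (mono_tags, lifting) inner_commute mem_Collect_eq transpose_matrix_vector)
      have n: "norm ?x = 1" "norm ?y = 1" by (simp_all add: norm_axis_1)
      have "norm (?x + ?y) \<le> 2" using norm_triangle_ineq[of ?x ?y] n by simp
      then have n2: "(norm (?x + ?y))\<^sup>2 \<le> 4" using power_mono[of "norm (?x + ?y)" 2 2] by simp
      have "(?x + ?y) \<bullet> (A *v (?x + ?y)) = ?x \<bullet> (A *v ?x) + 2 * (?x \<bullet> (A *v ?y)) + ?y \<bullet> (A *v ?y)"
        using sym by (simp add: matrix_vector_right_distrib inner_add)
      moreover have "(?x + ?y) \<bullet> (A *v (?x + ?y)) \<le> \<bar>C\<bar> * 4"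
      proof -
        have "(?x + ?y) \<bullet> (A *v (?x + ?y)) \<le> C * (norm (?x + ?y))\<^sup>2" by (rule b(2))
        also have "\<dots> \<le> \<bar>C\<bar> * (norm (?x + ?y))\<^sup>2" by (intro mult_right_mono) auto
        also have "\<dots> \<le> \<bar>C\<bar> * 4" using n2 by (intro mult_left_mono) auto
        finally show ?thesis .
      qed
      moreover have "?x \<bullet> (A *v ?x) \<le> \<bar>C\<bar>" "?y \<bullet> (A *v ?y) \<le> \<bar>C\<bar>"
        using b(2)[of ?x] b(2)[of ?y] n by auto
      moreover note b(1)[of ?x] b(1)[of ?y] b(1)[of "?x + ?y"]
      ultimately have "\<bar>?x \<bullet> (A *v ?y)\<bar> \<le> 4 * \<bar>C\<bar>" by linarith
      then show ?thesis using ent by metis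
    qed
    have "norm A \<le> (\<Sum>i\<in>UNIV. norm (A $ i))" unfolding norm_vec_def by (rule L2_set_le_sum) simp
    also have "\<dots> \<le> (\<Sum>i\<in>(UNIV::'n set). \<Sum>j\<in>(UNIV::'n set). 4 * \<bar>C\<bar>)"
      by (intro sum_mono order_trans[OF norm_le_l1_cart] entry)
    finally show "norm A \<le> (\<Sum>i\<in>(UNIV::'n set). \<Sum>j\<in>(UNIV::'n set). 4 * \<bar>C\<bar>)" .
  qed
  ultimately show ?thesis by (simp add: compact_eq_bounded_closed)
qed

text \<open>A positive continuous function attains a positive minimum on a compact set; the best constant is \<open>c\<^sup>n\<close>.\<close>

lemma bounded_forms_det_lower_bound:
  assumes c: "c > 0"
  shows "\<exists>m>0. \<forall>A\<in>bounded_forms c C. m \<le> det (A :: real^'n^'n)"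
proof (cases "bounded_forms c C = ({} :: (real^'n^'n) set)")
  case True then show ?thesis by (intro exI[of _ 1]) auto
next
  case False
  have "continuous_on (bounded_forms c C) (det :: real^'n^'n \<Rightarrow> real)"
    unfolding det_def[abs_def] by (intro continuous_intros)
  then have "\<exists>B\<in>bounded_forms c C. \<forall>A\<in>bounded_forms c C. det (B :: real^'n^'n) \<le> det (A :: real^'n^'n)"
    by (rule continuous_attains_inf[OF compact_bounded_forms[OF c] False])
  then obtain B :: "real^'n^'n" where B: "B \<in> bounded_forms c C" "\<forall>A\<in>bounded_forms c C. det B \<le> det (A :: real^'n^'n)"
    by (rule bexE)
  have "0 < det B"
  proof (rule posdef_det_pos)
    fix \<xi> :: "real^'n" assume "\<xi> \<noteq> 0"
    then have "0 < c * (norm \<xi>)\<^sup>2" using c by simp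
    also have "\<dots> \<le> \<xi> \<bullet> (B *v \<xi>)" using B(1) by (simp add: bounded_forms_def)
    finally show "0 < \<xi> \<bullet> (B *v \<xi>)" .
  qed
  then show ?thesis using B(2) by (intro exI[of _ "det B"] conjI)
qed

context riem_poly begin

definition Lam :: real where
  "Lam = (SOME \<Lambda>. \<Lambda> > 0 \<and> (\<forall>s\<in>maxs P. AE x in lebesgue_on (cell P s). \<forall>\<xi>.
        inverse (\<Lambda>\<^sup>2) * (norm \<xi>)\<^sup>2 \<le> \<xi> \<bullet> (gmat P s x *v \<xi>) \<and>
        \<xi> \<bullet> (gmat P s x *v \<xi>) \<le> \<Lambda>\<^sup>2 * (norm \<xi>)\<^sup>2))"

lemma Lam_pos: "Lam > 0" and Lam_AE: "s \<in> maxs P \<Longrightarrow> AE x in lebesgue_on (cell P s). \<forall>\<xi>.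
        inverse (Lam\<^sup>2) * (norm \<xi>)\<^sup>2 \<le> \<xi> \<bullet> (gmat P s x *v \<xi>) \<and>
        \<xi> \<bullet> (gmat P s x *v \<xi>) \<le> Lam\<^sup>2 * (norm \<xi>)\<^sup>2"
proof -
  have "Lam > 0 \<and> (\<forall>s\<in>maxs P. AE x in lebesgue_on (cell P s). \<forall>\<xi>.
        inverse (Lam\<^sup>2) * (norm \<xi>)\<^sup>2 \<le> \<xi> \<bullet> (gmat P s x *v \<xi>) \<and>
        \<xi> \<bullet> (gmat P s x *v \<xi>) \<le> Lam\<^sup>2 * (norm \<xi>)\<^sup>2)"
    unfolding Lam_def
    proof (rule someI_ex)
    show "\<exists>\<Lambda>>0. \<forall>s\<in>maxs P. AE x in lebesgue_on (cell P s). \<forall>\<xi>.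
        inverse (\<Lambda>\<^sup>2) * (norm \<xi>)\<^sup>2 \<le> \<xi> \<bullet> (gmat P s x *v \<xi>) \<and>
        \<xi> \<bullet> (gmat P s x *v \<xi>) \<le> \<Lambda>\<^sup>2 * (norm \<xi>)\<^sup>2"
      using riem unfolding riemannian_polyhedron_def by (elim conjE)
  qed
  then show "Lam > 0" "s \<in> maxs P \<Longrightarrow> AE x in lebesgue_on (cell P s). \<forall>\<xi>.
        inverse (Lam\<^sup>2) * (norm \<xi>)\<^sup>2 \<le> \<xi> \<bullet> (gmat P s x *v \<xi>) \<and>
        \<xi> \<bullet> (gmat P s x *v \<xi>) \<le> Lam\<^sup>2 * (norm \<xi>)\<^sup>2" by blast+
qed

abbreviation "Forms \<equiv> bounded_forms (inverse (Lam\<^sup>2)) (Lam\<^sup>2) :: (real^'n^'n) set"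

text \<open>A lower bound for \<open>det g\<close>, by which Lebesgue measure in the charts is at most a multiple of the volume.\<close>

definition detmin :: real where
  "detmin = (SOME m. m > 0 \<and> (\<forall>A\<in>Forms. m \<le> det A))"

lemma detmin_pos: "detmin > 0" and detmin_le: "A \<in> Forms \<Longrightarrow> detmin \<le> det A"
proof -
  have "detmin > 0 \<and> (\<forall>A\<in>Forms. detmin \<le> det A)"
    unfolding detmin_def
    by (rule someI_ex, rule bounded_forms_det_lower_bound) (use Lam_pos in simp)
  then show "detmin > 0" "A \<in> Forms \<Longrightarrow> detmin \<le> det A" by blast+
qed

definition dens :: "'e set \<Rightarrow> real^'n \<Rightarrow> ennreal" where
  "dens s x = ennreal (sqrt (det (gmat P s x)))"

definition cell_vol :: "'e set \<Rightarrow> 'a measure" where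
  "cell_vol s = distr (density (lebesgue_on (cell P s)) (dens s)) borel (point P s)"

end

section \<open>The volume measure in charts\<close>

lemma AE_lebesgue_on_iff_negligible:
  assumes "S \<in> sets lebesgue"
  shows "(AE x in lebesgue_on S. Q x) \<longleftrightarrow> negligible {x \<in> S. \<not> Q x}"
proof -
  have "(AE x in lebesgue_on S. Q x) \<longleftrightarrow> (AE x in lebesgue. x \<in> S \<longrightarrow> Q x)"
    using assms by (simp add: AE_restrict_space_iff)
  also have "\<dots> \<longleftrightarrow> {x \<in> S. \<not> Q x} \<in> null_sets lebesgue"
    by (subst completion.AE_iff_null_sets) auto
  finally show ?thesis by (simp add: negligible_iff_null_sets)
qed

context riem_simplex begin

lemma cell_borel: "cell P s \<in> sets borel" by (simp add: compact_imp_closed compact_cell)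

lemma cell_lebesgue: "cell P s \<in> sets lebesgue" using cell_borel by simp

lemma gmat_measurable: "gmat P s \<in> borel_measurable (lebesgue_on (cell P s))"
  using riem smax by (auto simp: riemannian_polyhedron_def)

lemma gmat_Forms_AE: "negligible {x \<in> cell P s. gmat P s x \<notin> Forms}"
proof -
  have "AE x in lebesgue_on (cell P s). transpose (gmat P s x) = gmat P s x"
    using riem smax by (auto simp: riemannian_polyhedron_def)
  with Lam_AE[OF smax] have "AE x in lebesgue_on (cell P s). gmat P s x \<in> Forms"
    by eventually_elim (simp add: bounded_forms_def)
  then show ?thesis by (simp add: AE_lebesgue_on_iff_negligible cell_lebesgue)
qed

lemma dens_measurable: "dens s \<in> borel_measurable (lebesgue_on (cell P s))"
proof -
  have "continuous_on UNIV (det :: real^'n^'n \<Rightarrow> real)"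
    unfolding det_def[abs_def] by (intro continuous_intros)
  then have "(\<lambda>x. det (gmat P s x)) \<in> borel_measurable (lebesgue_on (cell P s))"
    using gmat_measurable by (intro borel_measurable_continuous_on[of det])
  then show ?thesis unfolding dens_def[abs_def] by measurable
qed

lemma dens_lower_bound: "gmat P s x \<in> Forms \<Longrightarrow> ennreal (sqrt detmin) \<le> dens s x"
  unfolding dens_def by (intro ennreal_leI real_sqrt_le_mono detmin_le)

lemma point_preimage_borel:
  assumes "A \<in> sets borel"
  shows "{x \<in> cell P s. point P s x \<in> A} \<in> sets borel"
proof -
  have "point P s \<in> borel_measurable (restrict_space borel (cell P s))"
    by (rule borel_measurable_continuous_on_restrict[OF continuous_point])
  from measurable_sets[OF this assms] have "point P s -` A \<inter> cell P s \<in> sets (restrict_space borel (cell P s))"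
    by (simp add: space_restrict_space)
  moreover have "point P s -` A \<inter> cell P s = {x \<in> cell P s. point P s x \<in> A}" by auto
  ultimately show ?thesis using cell_borel by (auto simp: sets_restrict_space_iff)
qed

lemma coord_preimage_borel:
  assumes "B \<in> sets borel"
  shows "{p \<in> closed_simplex P s. coord P s p \<in> B} \<in> sets borel"
proof -
  have "coord P s \<in> borel_measurable (restrict_space borel (closed_simplex P s))"
    by (rule borel_measurable_continuous_on_restrict[OF continuous_coord])
  from measurable_sets[OF this assms] have "coord P s -` B \<inter> closed_simplex P s \<in> sets (restrict_space borel (closed_simplex P s))"
    by (simp add: space_restrict_space)
  moreover have "coord P s -` B \<inter> closed_simplex P s = {p \<in> closed_simplex P s. coord P s p \<in> B}" by auto
  ultimately show ?thesis using closed_closed_simplex by (auto simp: sets_restrict_space_iff)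
qed

lemma point_measurable_borel: "point P s \<in> measurable (lebesgue_on (cell P s)) borel"
proof (rule measurableI)
  fix A :: "'a set" assume "A \<in> sets borel"
  from point_preimage_borel[OF this]
  have "{x \<in> cell P s. point P s x \<in> A} \<in> sets lebesgue" by simp
  moreover have "point P s -` A \<inter> cell P s = {x \<in> cell P s. point P s x \<in> A}" by auto
  ultimately show "point P s -` A \<inter> space (lebesgue_on (cell P s)) \<in> sets (lebesgue_on (cell P s))"
    using cell_lebesgue by (auto simp: sets_restrict_space_iff space_restrict_space)
qed simp

lemma emeasure_cell_vol_on:
  assumes A: "A \<in> sets borel"
  shows "{x \<in> cell P s. point P s x \<in> A} \<in> sets (lebesgue_on (cell P s))"
    and "emeasure (cell_vol s) A =
      (\<integral>\<^sup>+x. dens s x * indicator {x \<in> cell P s. point P s x \<in> A} x \<partial>lebesgue_on (cell P s))"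
proof -
  have m: "point P s \<in> measurable (density (lebesgue_on (cell P s)) (dens s)) borel"
    using point_measurable_borel by simp
  show S: "{x \<in> cell P s. point P s x \<in> A} \<in> sets (lebesgue_on (cell P s))"
    using point_preimage_borel[OF A] cell_lebesgue by (auto simp: sets_restrict_space_iff)
  have "emeasure (cell_vol s) A = emeasure (density (lebesgue_on (cell P s)) (dens s)) {x \<in> cell P s. point P s x \<in> A}"
    unfolding cell_vol_def using A m
    by (subst emeasure_distr) (auto simp: space_restrict_space intro!: arg_cong2[where f=emeasure])
  also have "\<dots> = (\<integral>\<^sup>+x. dens s x * indicator {x \<in> cell P s. point P s x \<in> A} x \<partial>lebesgue_on (cell P s))"
    by (rule emeasure_density[OF dens_measurable S])
  finally show "emeasure (cell_vol s) A =
      (\<integral>\<^sup>+x. dens s x * indicator {x \<in> cell P s. point P s x \<in> A} x \<partial>lebesgue_on (cell P s))" .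
qed

lemma emeasure_cell_vol:
  assumes A: "A \<in> sets borel"
  shows "emeasure (cell_vol s) A = (\<integral>\<^sup>+x\<in>{x \<in> cell P s. point P s x \<in> A}. dens s x \<partial>lebesgue)"
  unfolding emeasure_cell_vol_on(2)[OF A] using cell_lebesgue
  by (subst nn_integral_restrict_space) (auto intro!: nn_integral_cong split: split_indicator)

text \<open>The density is bounded below, so it does not affect null sets.\<close>

lemma emeasure_cell_vol_0_iff:
  assumes A: "A \<in> sets borel"
  shows "emeasure (cell_vol s) A = 0 \<longleftrightarrow> negligible {x \<in> cell P s. point P s x \<in> A}"
proof -
  let ?S = "{x \<in> cell P s. point P s x \<in> A}"
  note S = emeasure_cell_vol_on(1)[OF A]
  have "emeasure (cell_vol s) A = 0 \<longleftrightarrow> (AE x in lebesgue_on (cell P s). dens s x * indicator ?S x = 0)"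
    unfolding emeasure_cell_vol_on(2)[OF A] using dens_measurable S by (simp add: nn_integral_0_iff_AE)
  also have "\<dots> \<longleftrightarrow> negligible {x \<in> cell P s. dens s x * indicator ?S x \<noteq> 0}"
    by (simp add: AE_lebesgue_on_iff_negligible cell_lebesgue)
  also have "\<dots> \<longleftrightarrow> negligible ?S"
  proof
    assume n: "negligible {x \<in> cell P s. dens s x * indicator ?S x \<noteq> 0}"
    have "dens s x \<noteq> 0" if "gmat P s x \<in> Forms" for x
    proof -
      have "0 < ennreal (sqrt detmin)" using detmin_pos by simp
      also have "\<dots> \<le> dens s x" using that by (rule dens_lower_bound)
      finally show ?thesis by simp
    qed
    then have "?S \<subseteq> {x \<in> cell P s. dens s x * indicator ?S x \<noteq> 0} \<union> {x \<in> cell P s. gmat P s x \<notin> Forms}"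
      by auto
    then show "negligible ?S" using negligible_Un[OF n gmat_Forms_AE] negligible_subset by blast
  next
    assume "negligible ?S"
    then show "negligible {x \<in> cell P s. dens s x * indicator ?S x \<noteq> 0}"
      by (rule negligible_subset) (auto simp: indicator_def split: if_splits)
  qed
  finally show ?thesis .
qed

end

context riem_poly begin

lemma riem_simplexI: "s \<in> maxs P \<Longrightarrow> riem_simplex P s"
  by unfold_locales

text \<open>The volume before completion, as a sum of the volumes of the maximal cells.\<close>

definition vol0 :: "'a measure" where
  "vol0 = measure_of UNIV (sets borel) (\<lambda>A. \<integral>\<^sup>+s. emeasure (cell_vol s) A \<partial>count_space (maxs P))"

lemma sets_vol0 [simp]: "sets vol0 = sets borel" and space_vol0 [simp]: "space vol0 = UNIV"
  unfolding vol0_def by (simp_all add: sets.sigma_sets_eq[of borel, simplified])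

text \<open>The formula that defines the volume is countably additive, as a sum of measures; only now is it known to
be the value of the measure.\<close>

lemma emeasure_vol0:
  assumes "A \<in> sets borel"
  shows "emeasure vol0 A = (\<integral>\<^sup>+s. emeasure (cell_vol s) A \<partial>count_space (maxs P))"
proof (rule emeasure_measure_of[OF vol0_def])
  show "countably_additive (sets vol0) (\<lambda>A. \<integral>\<^sup>+s. emeasure (cell_vol s) A \<partial>count_space (maxs P))"
  proof (rule countably_additiveI)
    fix A :: "nat \<Rightarrow> 'a set" assume A: "range A \<subseteq> sets vol0" "disjoint_family A"
    have "(\<Sum>i. emeasure (cell_vol s) (A i)) = emeasure (cell_vol s) (\<Union>i. A i)" for s
      using A by (intro suminf_emeasure) (auto simp: cell_vol_def)
    then show "(\<Sum>i. \<integral>\<^sup>+s. emeasure (cell_vol s) (A i) \<partial>count_space (maxs P))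
        = (\<integral>\<^sup>+s. emeasure (cell_vol s) (\<Union>i. A i) \<partial>count_space (maxs P))"
      by (subst nn_integral_suminf[symmetric]) simp_all
  qed
qed (use assms in \<open>auto simp: positive_def\<close>)

lemma vol_eq: "vol P = completion vol0"
proof -
  have "measure_of UNIV (sets borel)
     (\<lambda>A. \<integral>\<^sup>+s. (\<integral>\<^sup>+x\<in>{x \<in> cell P s. point P s x \<in> A}. ennreal (sqrt (det (gmat P s x))) \<partial>lebesgue)
        \<partial>count_space (maxs P)) = vol0"
    unfolding vol0_def
  proof (rule measure_of_eq)
    fix A :: "'a set" assume "A \<in> sigma_sets UNIV (sets borel)"
    then have A: "A \<in> sets borel" by (simp add: sets.sigma_sets_eq[of borel, simplified])
    show "(\<integral>\<^sup>+s. (\<integral>\<^sup>+x\<in>{x \<in> cell P s. point P s x \<in> A}. ennreal (sqrt (det (gmat P s x))) \<partial>lebesgue)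
        \<partial>count_space (maxs P)) = (\<integral>\<^sup>+s. emeasure (cell_vol s) A \<partial>count_space (maxs P))"
    proof (intro nn_integral_cong)
      fix s assume "s \<in> space (count_space (maxs P))"
      then interpret S: riem_simplex P s by (intro riem_simplexI) simp
      show "(\<integral>\<^sup>+x\<in>{x \<in> cell P s. point P s x \<in> A}. ennreal (sqrt (det (gmat P s x))) \<partial>lebesgue)
          = emeasure (cell_vol s) A"
        unfolding S.emeasure_cell_vol[OF A] dens_def ..
    qed
  qed simp
  then show ?thesis by (simp add: vol_def)
qed

lemma space_vol [simp]: "space (vol P) = UNIV" by (simp add: vol_eq)

lemma null_sets_vol0_iff:
  assumes "A \<in> sets borel"
  shows "A \<in> null_sets vol0 \<longleftrightarrow> (\<forall>s\<in>maxs P. negligible {x \<in> cell P s. point P s x \<in> A})"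
proof -
  have "A \<in> null_sets vol0 \<longleftrightarrow> (\<forall>s\<in>maxs P. emeasure (cell_vol s) A = 0)"
    using assms by (simp add: null_sets_def emeasure_vol0 nn_integral_0_iff_AE AE_count_space)
  then show ?thesis
    using riem_simplex.emeasure_cell_vol_0_iff[OF riem_simplexI assms] by auto
qed

text \<open>The set may be enlarged to the preimage of a Borel null set. In the cell of another maximal simplex its
trace lies in the boundary, since an interior point has that other simplex as its carrier.\<close>

lemma negligible_coords_null_set:
  assumes s: "s \<in> maxs P" and M: "negligible M"
  shows "\<exists>C\<in>null_sets vol0. {p \<in> closed_simplex P s. coord P s p \<in> M} \<subseteq> C"
proof -
  interpret S: riem_simplex P s using s by (rule riem_simplexI)
  obtain B where B: "B \<in> null_sets lborel" "M \<subseteq> B"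
    using M by (auto simp: negligible_iff_null_sets null_sets_completion_iff2)
  let ?C = "{p \<in> closed_simplex P s. coord P s p \<in> B}"
  have C: "?C \<in> sets borel" using B(1) by (intro S.coord_preimage_borel) auto
  have "negligible {x \<in> cell P t. point P t x \<in> ?C}" if t: "t \<in> maxs P" for t
  proof (cases "t = s")
    case True
    have "{x \<in> cell P t. point P t x \<in> ?C} \<subseteq> B"
      using True S.coord_point by auto
    moreover have "negligible B"
      using B(1) by (simp add: negligible_iff_null_sets null_sets_completionI)
    ultimately show ?thesis using negligible_subset by blast
  next
    case False
    interpret T: riem_simplex P t using t by (rule riem_simplexI)
    have "{x \<in> cell P t. point P t x \<in> ?C} \<subseteq> cell P t - interior (cell P t)"
    proof safe
      fix x assume x: "x \<in> interior (cell P t)" "point P t x \<in> closed_simplex P s"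
      then have "t \<subseteq> s" using T.carrier_point_interior by (simp add: closed_simplex_def)
      then show False using maxs_maximal[OF t S.scplx] False by blast
    qed
    then show ?thesis using T.negligible_cell_boundary negligible_subset by blast
  qed
  then have "?C \<in> null_sets vol0" unfolding null_sets_vol0_iff[OF C] by (rule ballI)
  moreover have "{p \<in> closed_simplex P s. coord P s p \<in> M} \<subseteq> ?C" using B(2) by auto
  ultimately show ?thesis by (rule bexI[rotated])
qed

lemma null_sets_vol_iff:
  "N \<in> null_sets (vol P) \<longleftrightarrow> (\<forall>s\<in>maxs P. negligible {x \<in> cell P s. point P s x \<in> N})"
proof
  assume "N \<in> null_sets (vol P)"
  then obtain N' where N': "N' \<in> null_sets vol0" "N \<subseteq> N'"
    unfolding vol_eq null_sets_completion_iff2 by (rule bexE)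
  have "N' \<in> sets borel" using null_setsD2[OF N'(1)] by simp
  then have neg: "negligible {x \<in> cell P s. point P s x \<in> N'}" if "s \<in> maxs P" for s
    using N'(1) null_sets_vol0_iff[of N'] that by simp
  show "\<forall>s\<in>maxs P. negligible {x \<in> cell P s. point P s x \<in> N}"
  proof
    fix s assume s: "s \<in> maxs P"
    show "negligible {x \<in> cell P s. point P s x \<in> N}"
      using neg[OF s]
      by (rule negligible_subset) (use N'(2) in auto)
  qed
next
  assume neg: "\<forall>s\<in>maxs P. negligible {x \<in> cell P s. point P s x \<in> N}"
  have "\<forall>s\<in>maxs P. \<exists>C. C \<in> null_sets vol0 \<and>
      {p \<in> closed_simplex P s. coord P s p \<in> {x \<in> cell P s. point P s x \<in> N}} \<subseteq> C"
  proof
    fix s assume s: "s \<in> maxs P"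
    show "\<exists>C. C \<in> null_sets vol0 \<and>
      {p \<in> closed_simplex P s. coord P s p \<in> {x \<in> cell P s. point P s x \<in> N}} \<subseteq> C"
      using negligible_coords_null_set[OF s neg[rule_format, OF s]] by (simp add: Bex_def)
  qed
  from bchoice[OF this] obtain C where "\<forall>s\<in>maxs P. C s \<in> null_sets vol0 \<and>
      {p \<in> closed_simplex P s. coord P s p \<in> {x \<in> cell P s. point P s x \<in> N}} \<subseteq> C s" by (rule exE)
  then have C: "C s \<in> null_sets vol0"
     "{p \<in> closed_simplex P s. coord P s p \<in> {x \<in> cell P s. point P s x \<in> N}} \<subseteq> C s"
    if "s \<in> maxs P" for s using that by simp_all
  have "N \<subseteq> (\<Union>s\<in>maxs P. C s)"
  proof
    fix p assume p: "p \<in> N"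
    obtain s where s: "s \<in> maxs P" "carrier_simplex P p \<subseteq> s" using in_some_maximal_simplex by blast
    interpret S: riem_simplex P s using s(1) by (rule riem_simplexI)
    have "p \<in> {p \<in> closed_simplex P s. coord P s p \<in> {x \<in> cell P s. point P s x \<in> N}}"
      using p s(2) S.coord_in_cell S.point_coord by (simp add: closed_simplex_def)
    then show "p \<in> (\<Union>s\<in>maxs P. C s)" using C(2)[OF s(1)] s(1) by blast
  qed
  moreover have "(\<Union>s\<in>maxs P. C s) \<in> null_sets vol0"
    using C(1) countable_maxs by (intro null_sets_UN') auto
  ultimately show "N \<in> null_sets (vol P)" unfolding vol_eq null_sets_completion_iff2 by (rule bexI)
qed

text \<open>A set with Lebesgue measurable traces on the cells splits, on each closed simplex, into a Borel set and a
null set.\<close>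

lemma sets_vol_iff:
  "A \<in> sets (vol P) \<longleftrightarrow> (\<forall>s\<in>maxs P. {x \<in> cell P s. point P s x \<in> A} \<in> sets lebesgue)"
proof
  assume "A \<in> sets (vol P)"
  then obtain S N N' where A: "A = S \<union> N" "N \<subseteq> N'" "N' \<in> null_sets vol0" "S \<in> sets vol0"
    unfolding vol_eq by (rule sets_completionE)
  have N: "N \<in> null_sets (vol P)" using A(2,3) unfolding vol_eq null_sets_completion_iff2 by (rule bexI)
  show "\<forall>s\<in>maxs P. {x \<in> cell P s. point P s x \<in> A} \<in> sets lebesgue"
  proof
    fix s assume s: "s \<in> maxs P"
    interpret S: riem_simplex P s using s by (rule riem_simplexI)
    have "{x \<in> cell P s. point P s x \<in> A} = {x \<in> cell P s. point P s x \<in> S} \<union> {x \<in> cell P s. point P s x \<in> N}"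
      using A(1) by auto
    moreover have "{x \<in> cell P s. point P s x \<in> S} \<in> sets lebesgue"
      using S.point_preimage_borel[of S] A(4) by simp
    moreover have "{x \<in> cell P s. point P s x \<in> N} \<in> sets lebesgue"
      using N s unfolding null_sets_vol_iff by (intro negligible_imp_sets) simp
    ultimately show "{x \<in> cell P s. point P s x \<in> A} \<in> sets lebesgue" by auto
  qed
next
  assume *: "\<forall>s\<in>maxs P. {x \<in> cell P s. point P s x \<in> A} \<in> sets lebesgue"
  have "A \<inter> closed_simplex P s \<in> sets (vol P)" if s: "s \<in> maxs P" for s
  proof -
    interpret S: riem_simplex P s using s by (rule riem_simplexI)
    obtain B N N' where B: "{x \<in> cell P s. point P s x \<in> A} = B \<union> N" "N \<subseteq> N'" "N' \<in> null_sets lborel" "B \<in> sets lborel"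
      using sets_completionE[OF *[rule_format, OF s]] .
    have "negligible N"
      using B(2,3) unfolding negligible_iff_null_sets null_sets_completion_iff2 by (rule bexI)
    from negligible_coords_null_set[OF s this]
    obtain C where C: "C \<in> null_sets vol0" "{p \<in> closed_simplex P s. coord P s p \<in> N} \<subseteq> C" by (rule bexE)
    then have 1: "{p \<in> closed_simplex P s. coord P s p \<in> N} \<in> null_sets (vol P)"
      unfolding vol_eq null_sets_completion_iff2 by (intro bexI)
    have 2: "{p \<in> closed_simplex P s. coord P s p \<in> B} \<in> sets (vol P)"
      using S.coord_preimage_borel[of B] B(4) unfolding vol_eq by (intro sets_completionI_sets) simp
    have "A \<inter> closed_simplex P s = {p \<in> closed_simplex P s. coord P s p \<in> {x \<in> cell P s. point P s x \<in> A}}"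
      using S.coord_in_cell S.point_coord by (auto simp: closed_simplex_def)
    also have "\<dots> = {p \<in> closed_simplex P s. coord P s p \<in> B} \<union> {p \<in> closed_simplex P s. coord P s p \<in> N}"
      using B(1) by auto
    finally show ?thesis using 1 2 by auto
  qed
  moreover have "A = (\<Union>s\<in>maxs P. A \<inter> closed_simplex P s)"
    using in_some_maximal_simplex by (auto simp: closed_simplex_def)
  ultimately show "A \<in> sets (vol P)"
    using countable_maxs sets.countable_UN'[of "maxs P" "\<lambda>s. A \<inter> closed_simplex P s" "vol P"] by auto
qed

lemma measurable_vol_iff:
  fixes f :: "'a \<Rightarrow> 'b::topological_space"
  shows "f \<in> borel_measurable (vol P) \<longleftrightarrow>
    (\<forall>s\<in>maxs P. (\<lambda>x. f (point P s x)) \<in> borel_measurable (lebesgue_on (cell P s)))"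
proof -
  have "f \<in> borel_measurable (vol P) \<longleftrightarrow> (\<forall>A\<in>sets borel. f -` A \<in> sets (vol P))"
    by (simp add: measurable_def)
  also have "\<dots> \<longleftrightarrow> (\<forall>A\<in>sets borel. \<forall>s\<in>maxs P. {x \<in> cell P s. f (point P s x) \<in> A} \<in> sets lebesgue)"
    unfolding sets_vol_iff vimage_eq ..
  finally have "f \<in> borel_measurable (vol P) \<longleftrightarrow>
    (\<forall>A\<in>sets borel. \<forall>s\<in>maxs P. {x \<in> cell P s. f (point P s x) \<in> A} \<in> sets lebesgue)" .
  moreover have "(\<lambda>x. f (point P s x)) \<in> borel_measurable (lebesgue_on (cell P s)) \<longleftrightarrow>
     (\<forall>A\<in>sets borel. {x \<in> cell P s. f (point P s x) \<in> A} \<in> sets lebesgue)" if s: "s \<in> maxs P" for s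
  proof -
    interpret S: riem_simplex P s using s by (rule riem_simplexI)
    have "(\<lambda>x. f (point P s x)) -` A \<inter> cell P s = {x \<in> cell P s. f (point P s x) \<in> A}" for A by auto
    then show ?thesis
      using S.cell_lebesgue by (auto simp: measurable_def sets_restrict_space_iff space_restrict_space)
  qed
  ultimately show ?thesis by auto
qed

text \<open>The boundaries of the cells are negligible, so properties that hold almost everywhere can be checked in the
interiors, where the carrier and the coordinates are known.\<close>

lemma AE_vol_iff:
  "(AE p in vol P. Q p) \<longleftrightarrow> (\<forall>s\<in>maxs P. negligible {x \<in> interior (cell P s). \<not> Q (point P s x)})"
proof -
  have "(AE p in vol P. Q p) \<longleftrightarrow> {p. \<not> Q p} \<in> null_sets (vol P)"
    unfolding vol_eq by (subst completion.AE_iff_null_sets) auto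
  also have "\<dots> \<longleftrightarrow> (\<forall>s\<in>maxs P. negligible {x \<in> cell P s. \<not> Q (point P s x)})"
    by (simp add: null_sets_vol_iff)
  also have "\<dots> \<longleftrightarrow> (\<forall>s\<in>maxs P. negligible {x \<in> interior (cell P s). \<not> Q (point P s x)})"
  proof (intro ball_cong refl iffI)
    fix s assume s: "s \<in> maxs P"
    interpret S: riem_simplex P s using s by (rule riem_simplexI)
    show "negligible {x \<in> interior (cell P s). \<not> Q (point P s x)}" if "negligible {x \<in> cell P s. \<not> Q (point P s x)}"
      using that by (rule negligible_subset) (use interior_subset in auto)
    show "negligible {x \<in> cell P s. \<not> Q (point P s x)}" if "negligible {x \<in> interior (cell P s). \<not> Q (point P s x)}"
      using negligible_Un[OF that S.negligible_cell_boundary] by (rule negligible_subset) auto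
  qed
  finally show ?thesis .
qed

end

context riem_simplex begin

text \<open>The measure that is carried by one cell is at most the full volume.\<close>

lemma nn_integral_vol_ge_cell:
  assumes f: "f \<in> borel_measurable (vol P)"
  shows "(\<integral>\<^sup>+x. dens s x * f (point P s x) \<partial>lebesgue_on (cell P s)) \<le> (\<integral>\<^sup>+p. f p \<partial>vol P)"
proof -
  let ?D = "density (lebesgue_on (cell P s)) (dens s)"
  let ?\<nu> = "distr ?D (vol P) (point P s)"
  have m: "point P s \<in> measurable ?D (vol P)"
  proof (rule measurableI)
    fix A assume "A \<in> sets (vol P)"
    then have "{x \<in> cell P s. point P s x \<in> A} \<in> sets lebesgue" using smax unfolding sets_vol_iff by (rule bspec)
    moreover have "point P s -` A \<inter> cell P s = {x \<in> cell P s. point P s x \<in> A}" by auto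
    ultimately show "point P s -` A \<inter> space ?D \<in> sets ?D"
      using cell_lebesgue by (auto simp: sets_restrict_space_iff space_restrict_space)
  qed simp
  have "emeasure ?\<nu> A \<le> emeasure (vol P) A" if A: "A \<in> sets (vol P)" for A
  proof -
    obtain S N N' where SN: "A = S \<union> N" "N \<subseteq> N'" "N' \<in> null_sets vol0" "S \<in> sets vol0"
      using A unfolding vol_eq by (rule sets_completionE)
    have N'b: "N' \<in> sets borel" using null_setsD2[OF SN(3)] by simp
    have bor: "emeasure ?\<nu> B = emeasure (cell_vol s) B" if "B \<in> sets borel" for B
    proof -
      have "B \<in> sets (vol P)" using that unfolding vol_eq by (intro sets_completionI_sets) simp
      moreover have "point P s \<in> measurable ?D borel" using point_measurable_borel by simp
      ultimately show ?thesis using that m by (simp add: cell_vol_def emeasure_distr)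
    qed
    have SN': "S \<in> sets borel" "S \<union> N' \<in> sets borel" using SN(4) N'b by auto
    have single: "emeasure (cell_vol s) B \<le> emeasure vol0 B" if "B \<in> sets borel" for B
    proof -
      have "emeasure (cell_vol s) B = (\<integral>\<^sup>+t. emeasure (cell_vol t) B * indicator {s} t \<partial>count_space (maxs P))"
        using smax by (subst nn_integral_indicator_singleton) auto
      also have "\<dots> \<le> (\<integral>\<^sup>+t. emeasure (cell_vol t) B \<partial>count_space (maxs P))"
        by (intro nn_integral_mono) (auto split: split_indicator)
      finally show ?thesis by (simp add: emeasure_vol0 that)
    qed
    have "emeasure ?\<nu> A \<le> emeasure ?\<nu> (S \<union> N')"
      using SN SN' by (intro emeasure_mono) (auto simp: vol_eq intro!: sets_completionI_sets)
    also have "\<dots> \<le> emeasure vol0 (S \<union> N')" using bor[OF SN'(2)] single[OF SN'(2)] by simp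
    also have "\<dots> = emeasure vol0 S" using SN by (intro emeasure_Un_null_set) auto
    also have "\<dots> = emeasure (vol P) S" using SN(4) by (simp add: vol_eq)
    also have "\<dots> \<le> emeasure (vol P) A" using A SN by (intro emeasure_mono) auto
    finally show ?thesis .
  qed
  then have "?\<nu> \<le> vol P" by (subst le_measure) auto
  then have "(\<integral>\<^sup>+p. f p \<partial>?\<nu>) \<le> (\<integral>\<^sup>+p. f p \<partial>vol P)" by (intro nn_integral_mono_measure) auto
  moreover have "(\<integral>\<^sup>+p. f p \<partial>?\<nu>) = (\<integral>\<^sup>+x. f (point P s x) \<partial>?D)"
    using m f by (intro nn_integral_distr) auto
  moreover have "\<dots> = (\<integral>\<^sup>+x. dens s x * f (point P s x) \<partial>lebesgue_on (cell P s))"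
    using dens_measurable f smax measurable_vol_iff by (intro nn_integral_density) auto
  ultimately show ?thesis by simp
qed

lemma nn_integral_chart_le:
  assumes f: "f \<in> borel_measurable (vol P)" and B: "B \<subseteq> cell P s"
  shows "ennreal (sqrt detmin) * (\<integral>\<^sup>+x\<in>B. f (point P s x) \<partial>lebesgue) \<le> (\<integral>\<^sup>+p. f p \<partial>vol P)"
proof -
  have fm: "(\<lambda>x. f (point P s x)) \<in> borel_measurable (lebesgue_on (cell P s))"
    using f smax unfolding measurable_vol_iff by (rule bspec)
  have "(\<integral>\<^sup>+x\<in>B. f (point P s x) \<partial>lebesgue) \<le> (\<integral>\<^sup>+x\<in>cell P s. f (point P s x) \<partial>lebesgue)"
    using B by (intro nn_integral_mono) (auto split: split_indicator)
  also have "\<dots> = (\<integral>\<^sup>+x. f (point P s x) \<partial>lebesgue_on (cell P s))"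
    using cell_lebesgue by (subst nn_integral_restrict_space) auto
  finally have "ennreal (sqrt detmin) * (\<integral>\<^sup>+x\<in>B. f (point P s x) \<partial>lebesgue)
     \<le> ennreal (sqrt detmin) * (\<integral>\<^sup>+x. f (point P s x) \<partial>lebesgue_on (cell P s))"
    by (rule mult_left_mono) simp
  also have "\<dots> = (\<integral>\<^sup>+x. ennreal (sqrt detmin) * f (point P s x) \<partial>lebesgue_on (cell P s))"
    using fm by (simp add: nn_integral_cmult)
  also have "\<dots> \<le> (\<integral>\<^sup>+x. dens s x * f (point P s x) \<partial>lebesgue_on (cell P s))"
  proof (rule nn_integral_mono_AE)
    have "AE x in lebesgue_on (cell P s). gmat P s x \<in> Forms"
      using gmat_Forms_AE by (simp add: AE_lebesgue_on_iff_negligible cell_lebesgue)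
    then show "AE x in lebesgue_on (cell P s). ennreal (sqrt detmin) * f (point P s x) \<le> dens s x * f (point P s x)"
      by eventually_elim (intro mult_right_mono dens_lower_bound, auto)
  qed
  also have "\<dots> \<le> (\<integral>\<^sup>+p. f p \<partial>vol P)" by (rule nn_integral_vol_ge_cell[OF f])
  finally show ?thesis .
qed

end

section \<open>Comparison of the intrinsic and the Euclidean distance\<close>

lemma AE_lebesgue_iff_negligible: "(AE x in lebesgue. Q x) \<longleftrightarrow> negligible {x. \<not> Q x}"
  by (simp add: completion.AE_iff_null_sets negligible_iff_null_sets)

text \<open>Fubini's theorem for the map that sends \<open>z\<close> and \<open>t\<close> to the point \<open>x + t (z - x)\<close>: for every \<open>t \<noteq> 0\<close> it is
an affine isomorphism in \<open>z\<close>.\<close>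

lemma AE_negligible_rays:
  fixes x :: "'b::euclidean_space"
  assumes N: "negligible N"
  shows "AE z in lborel. negligible {t \<in> {0<..1}. x + t *\<^sub>R (z - x) \<in> N}"
proof -
  obtain B where B: "B \<in> null_sets lborel" "N \<subseteq> B"
    using N by (auto simp: negligible_iff_null_sets null_sets_completion_iff2)
  have Bb[measurable]: "B \<in> sets borel" using B(1) by auto
  let ?f = "\<lambda>z t. indicator B (x + t *\<^sub>R (z - x)) * indicator {0<..1} t :: ennreal"
  have m: "(\<lambda>(z, t). ?f z t) \<in> borel_measurable (lborel \<Otimes>\<^sub>M (lborel :: real measure))"
    by measurable
  have "(\<integral>\<^sup>+z. (\<integral>\<^sup>+t. ?f z t \<partial>lborel) \<partial>lborel) = (\<integral>\<^sup>+t. (\<integral>\<^sup>+z. ?f z t \<partial>lborel) \<partial>lborel)"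
    using lborel_pair.Fubini[OF m] by simp
  also have "\<dots> = (\<integral>\<^sup>+(t::real). 0 \<partial>lborel)"
  proof (intro nn_integral_cong)
    fix t :: real
    show "(\<integral>\<^sup>+z. ?f z t \<partial>lborel) = 0"
    proof (cases "t \<in> {0<..1}")
      case True
      then have t: "t \<noteq> 0" by simp
      have "0 = (\<integral>\<^sup>+y. indicator B y \<partial>lborel)" using B(1) by auto
      also have "\<dots> = (\<integral>\<^sup>+y. indicator B y \<partial>density (distr lborel borel (\<lambda>z. (x - t *\<^sub>R x) + t *\<^sub>R z)) (\<lambda>_. \<bar>t\<bar>^DIM('b)))"
        using lborel_affine[OF t, of "x - t *\<^sub>R x"] by simp
      also have "\<dots> = (\<integral>\<^sup>+y. ennreal (\<bar>t\<bar>^DIM('b)) * indicator B y \<partial>distr lborel borel (\<lambda>z. (x - t *\<^sub>R x) + t *\<^sub>R z))"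
        by (subst nn_integral_density) auto
      also have "\<dots> = (\<integral>\<^sup>+z. ennreal (\<bar>t\<bar>^DIM('b)) * indicator B ((x - t *\<^sub>R x) + t *\<^sub>R z) \<partial>lborel)"
        by (subst nn_integral_distr) auto
      also have "\<dots> = ennreal (\<bar>t\<bar>^DIM('b)) * (\<integral>\<^sup>+z. indicator B ((x - t *\<^sub>R x) + t *\<^sub>R z) \<partial>lborel)"
        by (rule nn_integral_cmult) measurable
      finally have "(\<integral>\<^sup>+z. indicator B ((x - t *\<^sub>R x) + t *\<^sub>R z) \<partial>lborel) = 0"
        using t by simp
      moreover have "(\<lambda>z. ?f z t) = (\<lambda>z. indicator B ((x - t *\<^sub>R x) + t *\<^sub>R z))"
        using True by (auto simp: fun_eq_iff algebra_simps)
      ultimately show ?thesis by simp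
    qed simp
  qed
  finally have "(\<integral>\<^sup>+z. (\<integral>\<^sup>+t. ?f z t \<partial>lborel) \<partial>lborel) = 0" by simp
  moreover have "(\<lambda>z. \<integral>\<^sup>+t. ?f z t \<partial>lborel) \<in> borel_measurable lborel"
    using lborel.borel_measurable_nn_integral[OF m] by simp
  ultimately have "AE z in lborel. (\<integral>\<^sup>+t. ?f z t \<partial>lborel) = 0"
    by (simp add: nn_integral_0_iff_AE)
  then show ?thesis
  proof eventually_elim
    case (elim z)
    have "(\<lambda>t. ?f z t) \<in> borel_measurable lborel" by measurable
    then have "AE t in lborel. ?f z t = 0" using elim by (simp add: nn_integral_0_iff_AE)
    then have "AE t in lborel. \<not> (t \<in> {0<..1} \<and> x + t *\<^sub>R (z - x) \<in> N)"
      by eventually_elim (use B(2) in \<open>auto split: split_indicator_asm\<close>)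
    then have "AE t in lebesgue. \<not> (t \<in> {0<..1} \<and> x + t *\<^sub>R (z - x) \<in> N)"
      by (rule AE_completion)
    then show ?case
      by (simp add: completion.AE_iff_null_sets negligible_iff_null_sets conj_ac)
  qed
qed

lemma negligible_affine_preimage_real:
  fixes T :: "real set"
  assumes "negligible T" "a \<noteq> 0"
  shows "negligible {t. a * t + b \<in> T}"
proof -
  have "{t. a * t + b \<in> T} = (\<lambda>u. (u - b) / a) ` T"
    using assms(2) by (force simp: image_iff field_simps)
  moreover have "negligible ((\<lambda>u. (u - b) / a) ` T)"
    by (rule negligible_locally_Lipschitz_image[OF _ assms(1)])
       (auto intro!: exI[of _ UNIV] exI[of _ "1 / \<bar>a\<bar>"] simp: abs_divide simp flip: diff_divide_distrib)
  ultimately show ?thesis by simp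
qed

text \<open>The broken segment from \<open>x\<close> through \<open>z\<close> to \<open>y\<close>, passing \<open>z\<close> at time \<open>1/2\<close>.\<close>

definition elbow :: "real^'n \<Rightarrow> real^'n \<Rightarrow> real^'n \<Rightarrow> real \<Rightarrow> real^'n" where
  "elbow x z y t = x + min (2 * t) 1 *\<^sub>R (z - x) + max (2 * t - 1) 0 *\<^sub>R (y - z)"

lemma elbow_first: "t \<le> 1/2 \<Longrightarrow> elbow x z y t = x + (2 * t) *\<^sub>R (z - x)"
  by (simp add: elbow_def min_def max_def)

lemma elbow_second: "1/2 \<le> t \<Longrightarrow> elbow x z y t = y + (2 - 2 * t) *\<^sub>R (z - y)"
proof -
  assume t: "1/2 \<le> t"
  have "z + (1 - k) *\<^sub>R (y - z) = y + k *\<^sub>R (z - y)" for k by (simp add: algebra_simps)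
  from this[of "2 - 2 * t"] show ?thesis using t by (simp add: elbow_def)
qed

lemma elbow_lipschitz: "(2 * norm (z - x) + 2 * norm (y - z))-lipschitz_on {0..1} (elbow x z y)"
proof (rule lipschitz_onI)
  fix t u :: real
  have "elbow x z y t - elbow x z y u = (min (2 * t) 1 - min (2 * u) 1) *\<^sub>R (z - x)
      + (max (2 * t - 1) 0 - max (2 * u - 1) 0) *\<^sub>R (y - z)"
    by (simp add: elbow_def scaleR_left_diff_distrib)
  then have "dist (elbow x z y t) (elbow x z y u) \<le> \<bar>min (2 * t) 1 - min (2 * u) 1\<bar> * norm (z - x)
      + \<bar>max (2 * t - 1) 0 - max (2 * u - 1) 0\<bar> * norm (y - z)"
    unfolding dist_norm by (metis norm_scaleR norm_triangle_ineq)
  also have "\<dots> \<le> (2 * \<bar>t - u\<bar>) * norm (z - x) + (2 * \<bar>t - u\<bar>) * norm (y - z)"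
    by (intro add_mono mult_right_mono) (auto simp: min_def max_def abs_if)
  finally show "dist (elbow x z y t) (elbow x z y u) \<le> (2 * norm (z - x) + 2 * norm (y - z)) * dist t u"
    by (simp add: dist_real_def algebra_simps)
qed simp

lemma elbow_vector_derivative:
  assumes t: "0 < t" "t < 1" "t \<noteq> 1/2"
  shows "\<exists>D. norm D \<le> 2 * max (norm (z - x)) (norm (y - z)) \<and>
     (elbow x z y has_vector_derivative D) (at t within {0..1})"
proof (cases "t < 1/2")
  case True
  have "((\<lambda>t. x + (2 * t) *\<^sub>R (z - x)) has_vector_derivative 2 *\<^sub>R (z - x)) (at t)"
    by (auto intro!: derivative_eq_intros)
  then have "(elbow x z y has_vector_derivative 2 *\<^sub>R (z - x)) (at t)"
    by (rule has_vector_derivative_transform_within_open[of _ _ _ "{..<1/2}"]) (use True in \<open>auto simp: elbow_first\<close>)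
  then show ?thesis
    by (intro exI[of _ "2 *\<^sub>R (z - x)"]) (auto intro: has_vector_derivative_at_within)
next
  case False
  with t have t2: "1/2 < t" by simp
  have "((\<lambda>t. y + (2 - 2 * t) *\<^sub>R (z - y)) has_vector_derivative (-2) *\<^sub>R (z - y)) (at t)"
    by (auto intro!: derivative_eq_intros)
  then have "(elbow x z y has_vector_derivative (-2) *\<^sub>R (z - y)) (at t)"
    by (rule has_vector_derivative_transform_within_open[of _ _ _ "{1/2<..}"]) (use t2 in \<open>auto simp: elbow_second\<close>)
  then show ?thesis
    by (intro exI[of _ "(-2) *\<^sub>R (z - y)"]) (auto intro: has_vector_derivative_at_within simp: norm_minus_commute)
qed

lemma elbow_negligible:
  assumes "negligible {t \<in> {0<..1}. x + t *\<^sub>R (z - x) \<in> N}" "negligible {t \<in> {0<..1}. y + t *\<^sub>R (z - y) \<in> N}"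
  shows "negligible {t \<in> {0..1}. elbow x z y t \<in> N}"
proof -
  have "negligible ({0, 1} \<union> {t. 2 * t + 0 \<in> {t \<in> {0<..1}. x + t *\<^sub>R (z - x) \<in> N}} \<union>
      {t. (-2) * t + 2 \<in> {t \<in> {0<..1}. y + t *\<^sub>R (z - y) \<in> N}})"
    by (intro negligible_Un negligible_affine_preimage_real assms) auto
  then show ?thesis
  proof (rule negligible_subset, intro subsetI)
    fix t assume t: "t \<in> {t \<in> {0..1}. elbow x z y t \<in> N}"
    then show "t \<in> {0, 1} \<union> {t. 2 * t + 0 \<in> {t \<in> {0<..1}. x + t *\<^sub>R (z - x) \<in> N}} \<union>
      {t. (-2) * t + 2 \<in> {t \<in> {0<..1}. y + t *\<^sub>R (z - y) \<in> N}}"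
      using elbow_first[of t x z y] elbow_second[of t x z y]
      by (cases "t \<le> 1/2") (auto simp: algebra_simps)
  qed
qed

context riem_simplex begin

lemma g_at_point: "x \<in> interior (cell P s) \<Longrightarrow> g_at P (point P s x) = gmat P s x"
  using interior_subset[of "cell P s"] by (auto simp: g_at_def carrier_point_interior coord_point)

lemma gnorm_point_le:
  assumes x: "x \<in> interior (cell P s)" and g: "gmat P s x \<in> Forms"
  shows "gnorm P (point P s x) \<xi> \<le> Lam * norm \<xi>"
proof -
  have "ginner P (point P s x) \<xi> \<xi> \<le> Lam\<^sup>2 * (norm \<xi>)\<^sup>2"
    using g by (simp add: ginner_def g_at_point[OF x] bounded_forms_def)
  then have "gnorm P (point P s x) \<xi> \<le> sqrt ((Lam * norm \<xi>)\<^sup>2)"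
    unfolding gnorm_def by (intro real_sqrt_le_mono) (simp add: power_mult_distrib)
  then show ?thesis using Lam_pos by simp
qed

lemma elbow_interior:
  assumes x: "x \<in> cell P s" and y: "y \<in> cell P s" and z: "z \<in> interior (cell P s)" and t: "0 < t" "t < 1"
  shows "elbow x z y t \<in> interior (cell P s)"
proof (cases "t \<le> 1/2")
  case True
  have "x - (2 * t) *\<^sub>R (x - z) \<in> interior (cell P s)"
    using True t by (intro mem_interior_convex_shrink convex_cell z x) auto
  then show ?thesis by (simp add: elbow_first[OF True] algebra_simps)
next
  case False
  have "y - (2 - 2 * t) *\<^sub>R (y - z) \<in> interior (cell P s)"
    using False t by (intro mem_interior_convex_shrink convex_cell z y) auto
  then show ?thesis using False by (simp add: elbow_second algebra_simps)
qed

lemma elbow_in_cell: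
  assumes x: "x \<in> cell P s" and y: "y \<in> cell P s" and z: "z \<in> interior (cell P s)" and t: "t \<in> {0..1}"
  shows "elbow x z y t \<in> cell P s"
proof -
  have "elbow x z y 0 = x" "elbow x z y 1 = y" by (simp_all add: elbow_def)
  then show ?thesis
    using elbow_interior[OF x y z, of t] interior_subset[of "cell P s"] x y t
    by (cases "t = 0 \<or> t = 1") auto
qed

text \<open>The admissible corners form a nonempty open set, namely the interior points of the cell near the midpoint
of \<open>x\<close> and \<open>y\<close>, and almost every corner avoids \<open>N\<close>.\<close>

lemma generic_elbow_point:
  assumes x: "x \<in> cell P s" and y: "y \<in> cell P s" and xy: "x \<noteq> y" and N: "negligible N"
  obtains z where "z \<in> interior (cell P s)" "norm (z - x) \<le> 3/2 * dist x y" "norm (y - z) \<le> 3/2 * dist x y"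
    "negligible {t \<in> {0..1}. elbow x z y t \<in> N}"
proof -
  let ?m = "midpoint x y"
  have ne: "interior (cell P s) \<noteq> {}"
  proof -
    have "s \<noteq> {}" using scplx by (rule simplex_nonempty)
    then have "rel_interior (convex hull s) \<noteq> {}" by (simp add: rel_interior_eq_empty)
    then obtain w where w: "w \<in> rel_interior (convex hull s)" by blast
    then have "w \<in> affine hull s" using rel_interior_subset hull_subset_affine by blast
    then have "unlin w \<in> interior (cell P s)" using w by (simp add: interior_cell_rel_interior chart_unlin)
    then show ?thesis by blast
  qed
  have "?m \<in> cell P s" using convex_cell x y by (simp add: midpoints_in_convex_hull convexD_alt midpoint_def convexD scaleR_right_distrib)
  then have "?m \<in> closure (interior (cell P s))"
    using convex_closure_interior[OF convex_cell ne] closure_subset by blast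
  moreover have d: "0 < dist x y" using xy by simp
  ultimately obtain w where w: "w \<in> interior (cell P s)" "dist w ?m < dist x y"
    unfolding closure_approachable by blast
  let ?W = "interior (cell P s) \<inter> ball ?m (dist x y)"
  have W: "open ?W" "?W \<noteq> {}" using w by (auto simp: dist_commute)
  have "AE z in lborel. negligible {t \<in> {0<..1}. x + t *\<^sub>R (z - x) \<in> N} \<and> negligible {t \<in> {0<..1}. y + t *\<^sub>R (z - y) \<in> N}"
    using AE_negligible_rays[OF N, of x] AE_negligible_rays[OF N, of y] by eventually_elim blast
  then have "AE z in lebesgue. negligible {t \<in> {0<..1}. x + t *\<^sub>R (z - x) \<in> N} \<and> negligible {t \<in> {0<..1}. y + t *\<^sub>R (z - y) \<in> N}"
    by (rule AE_completion)
  then have "negligible {z. \<not> (negligible {t \<in> {0<..1}. x + t *\<^sub>R (z - x) \<in> N} \<and> negligible {t \<in> {0<..1}. y + t *\<^sub>R (z - y) \<in> N})}"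
    (is "negligible ?Z")
    unfolding AE_lebesgue_iff_negligible .
  then have "\<not> ?W \<subseteq> ?Z" using open_not_negligible[OF W] negligible_subset by blast
  then obtain z where z: "z \<in> interior (cell P s)" "dist ?m z < dist x y"
     "negligible {t \<in> {0<..1}. x + t *\<^sub>R (z - x) \<in> N}" "negligible {t \<in> {0<..1}. y + t *\<^sub>R (z - y) \<in> N}"
    by auto
  have mid: "dist ?m x = dist x y / 2" "dist ?m y = dist x y / 2" by (simp_all add: dist_midpoint)
  have 1: "norm (z - x) \<le> 3/2 * dist x y"
    using dist_triangle3[of z x ?m] z(2) mid by (simp add: dist_norm)
  have 2: "norm (y - z) \<le> 3/2 * dist x y"
    using dist_triangle3[of y z ?m] z(2) mid by (simp add: dist_norm)
  show ?thesis by (rule that[OF z(1) 1 2 elbow_negligible[OF z(3,4)]])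
qed

text \<open>Points with a bad value of the metric are added to the null set that the path has to avoid. Then the path
has speed at most \<open>\<Lambda>\<close> times its Euclidean speed, and its Euclidean length is at most three times the
distance.\<close>

lemma intrinsic_dist_le:
  assumes x: "x \<in> cell P s" and y: "y \<in> cell P s" and xy: "x \<noteq> y"
  shows "intrinsic_dist P (point P s x) (point P s y) \<le> ennreal (3 * Lam * dist x y)"
  unfolding intrinsic_dist_def
proof (rule SUP_least)
  fix Z assume Z: "Z \<in> null_sets (vol P)"
  let ?Bad = "{u \<in> cell P s. gmat P s u \<notin> Forms}"
  let ?N = "{u \<in> cell P s. point P s u \<in> Z}"
  \<comment> \<open>The times in \<open>?Bad\<close> are excluded together with those in the given null set.\<close>
  have "negligible (?N \<union> ?Bad)"
    using Z smax null_sets_vol_iff gmat_Forms_AE by (intro negligible_Un) auto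
  from generic_elbow_point[OF x y xy this]
  obtain z where z: "z \<in> interior (cell P s)" "norm (z - x) \<le> 3/2 * dist x y" "norm (y - z) \<le> 3/2 * dist x y"
    "negligible {t \<in> {0..1}. elbow x z y t \<in> ?N \<union> ?Bad}" .
  define \<gamma> where "\<gamma> t = point P s (elbow x z y t)" for t
  note ein = elbow_in_cell[OF x y z(1)]
  have "\<gamma> \<in> transversal_paths Z (point P s x) (point P s y)"
    unfolding transversal_paths_def
  proof (intro CollectI conjI)
    obtain L where L: "L-lipschitz_on (cell P s) (point P s)" using point_lipschitz by blast
    have "(L * (2 * norm (z - x) + 2 * norm (y - z)))-lipschitz_on {0..1} (point P s \<circ> elbow x z y)"
      by (intro lipschitz_on_compose elbow_lipschitz lipschitz_on_subset[OF L]) (use ein in auto)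
    then show "\<exists>L. L-lipschitz_on {0..1} \<gamma>" by (auto simp: \<gamma>_def[abs_def] comp_def)
    show "\<gamma> 0 = point P s x" "\<gamma> 1 = point P s y" by (simp_all add: \<gamma>_def elbow_def)
    show "negligible {t \<in> {0..1}. \<gamma> t \<in> Z}"
      using z(4) by (rule negligible_subset) (use ein in \<open>auto simp: \<gamma>_def\<close>)
  qed
  moreover have "glength P \<gamma> \<le> ennreal (3 * Lam * dist x y)"
  proof -
    have sp: "gspeed P \<gamma> t \<le> 3 * Lam * dist x y"
      if t: "0 < t" "t < 1" "t \<noteq> 1/2" "elbow x z y t \<notin> ?Bad" for t
    proof -
      have ei: "elbow x z y t \<in> interior (cell P s)" using elbow_interior[OF x y z(1) t(1,2)] .
      then have car: "carrier_simplex P (\<gamma> t) = s" by (simp add: \<gamma>_def carrier_point_interior)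
      have gF: "gmat P s (elbow x z y t) \<in> Forms" using t(4) ei interior_subset[of "cell P s"] by auto
      obtain D where D: "norm D \<le> 2 * max (norm (z - x)) (norm (y - z))"
        "(elbow x z y has_vector_derivative D) (at t within {0..1})"
        using elbow_vector_derivative[OF t(1-3)] by blast
      have "((\<lambda>\<tau>. coord P s (\<gamma> \<tau>)) has_vector_derivative D) (at t within {0..1})"
        by (rule has_vector_derivative_transform[OF _ _ D(2)])
           (use t ein in \<open>auto simp: \<gamma>_def coord_point\<close>)
      then have vd: "vector_derivative (\<lambda>\<tau>. coord P s (\<gamma> \<tau>)) (at t within {0..1}) = D"
        using vector_derivative_within_cbox[of 0 1 t] t by simp
      have "gspeed P \<gamma> t = gnorm P (\<gamma> t) D"
        using car smax vd by (simp add: gspeed_def)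
      also have "\<dots> \<le> Lam * norm D" unfolding \<gamma>_def by (rule gnorm_point_le[OF ei gF])
      also have "\<dots> \<le> Lam * (2 * (3/2 * dist x y))"
        using D(1) z(2,3) Lam_pos by (intro mult_left_mono) auto
      finally show ?thesis by simp
    qed
    have neg: "negligible ({0, 1/2, 1} \<union> {t \<in> {0..1}. elbow x z y t \<in> ?N \<union> ?Bad})" (is "negligible ?E")
      using z(4) by (intro negligible_Un) auto
    have "AE t in lebesgue. t \<notin> ?E"
      using neg unfolding negligible_iff_null_sets by (rule AE_not_in)
    then have "AE t in lebesgue. ennreal (gspeed P \<gamma> t) * indicator {0..1} t \<le> ennreal (3 * Lam * dist x y) * indicator {0..1} t"
    proof eventually_elim
      case (elim t)
      then show ?case
        using sp[of t] by (cases "t \<in> {0..1}") (auto intro!: ennreal_leI)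
    qed
    then have "glength P \<gamma> \<le> (\<integral>\<^sup>+t. ennreal (3 * Lam * dist x y) * indicator {0..1::real} t \<partial>lebesgue)"
      unfolding glength_def by (rule nn_integral_mono_AE)
    also have "\<dots> = ennreal (3 * Lam * dist x y)"
      by (subst nn_integral_cmult_indicator) auto
    finally show ?thesis .
  qed
  ultimately show "(INF \<gamma>\<in>transversal_paths Z (point P s x) (point P s y). glength P \<gamma>) \<le> ennreal (3 * Lam * dist x y)"
    by (rule INF_lower2[where f="glength P"])
qed

lemma lip_on_chart_lipschitz:
  assumes "lip_on P U u"
  shows "\<exists>L\<ge>0. \<forall>x\<in>cell P s. \<forall>y\<in>cell P s. point P s x \<in> U \<longrightarrow> point P s y \<in> U \<longrightarrow>
     \<bar>u (point P s x) - u (point P s y)\<bar> \<le> L * dist x y"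
proof -
  obtain L where L: "L \<ge> 0" "\<forall>x\<in>U. \<forall>y\<in>U. ennreal \<bar>u x - u y\<bar> \<le> ennreal L * intrinsic_dist P x y"
    using assms unfolding lip_on_def by (elim exE conjE)
  have "\<bar>u (point P s x) - u (point P s y)\<bar> \<le> (L * (3 * Lam)) * dist x y"
    if xy: "x \<in> cell P s" "y \<in> cell P s" "point P s x \<in> U" "point P s y \<in> U" for x y
  proof (cases "x = y")
    case False
    have "ennreal \<bar>u (point P s x) - u (point P s y)\<bar> \<le> ennreal L * intrinsic_dist P (point P s x) (point P s y)"
      using L(2) xy by simp
    also have "\<dots> \<le> ennreal L * ennreal (3 * Lam * dist x y)"
      by (intro mult_left_mono intrinsic_dist_le xy False) simp
    also have "\<dots> = ennreal ((L * (3 * Lam)) * dist x y)"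
      using L(1) Lam_pos by (simp add: ennreal_mult'[symmetric] mult.assoc)
    finally show ?thesis using L(1) Lam_pos by (simp add: ennreal_le_iff)
  qed simp
  moreover have "0 \<le> L * (3 * Lam)" using L(1) Lam_pos by simp
  ultimately show ?thesis by (intro exI[of _ "L * (3 * Lam)"]) simp
qed

end

section \<open>Gradients of Lipschitz functions\<close>

lemma GDERIV_unique: "GDERIV f x :> D \<Longrightarrow> GDERIV f x :> D' \<Longrightarrow> D = D'"
  for D D' :: "'b::euclidean_space"
proof -
  assume "GDERIV f x :> D" "GDERIV f x :> D'"
  then have "(\<lambda>h. h \<bullet> D) = (\<lambda>h. h \<bullet> D')" unfolding gderiv_def by (rule has_derivative_unique)
  then have "\<forall>h. h \<bullet> D = h \<bullet> D'" by (simp add: fun_eq_iff)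
  then show "D = D'" by (simp add: vector_eq_ldot)
qed

lemma GDERIV_transform_within_open:
  assumes "GDERIV f x :> D" "open S" "x \<in> S" "\<And>y. y \<in> S \<Longrightarrow> f y = g y"
  shows "GDERIV g x :> D"
  using assms unfolding gderiv_def by (rule has_derivative_transform_within_open)

lemma measurable_lebesgue_on_negligible_cong:
  assumes S: "S \<in> sets lebesgue" and g: "g \<in> borel_measurable (lebesgue_on S)"
    and neg: "negligible {x \<in> S. f x \<noteq> g x}"
  shows "f \<in> borel_measurable (lebesgue_on S)"
proof (rule measurableI)
  fix A :: "'b set" assume A: "A \<in> sets borel"
  let ?N = "{x \<in> S. f x \<noteq> g x}"
  have "g -` A \<inter> S \<in> sets lebesgue"
    using measurable_sets[OF g A] S by (simp add: sets_restrict_space_iff space_restrict_space)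
  moreover have "negligible (f -` A \<inter> ?N)" using neg by (rule negligible_subset) auto
  then have "f -` A \<inter> ?N \<in> sets lebesgue" by (rule negligible_imp_sets)
  moreover have "?N \<in> sets lebesgue" using neg by (rule negligible_imp_sets)
  moreover have "f -` A \<inter> S = (g -` A \<inter> S - ?N) \<union> (f -` A \<inter> ?N)" by auto
  ultimately have "f -` A \<inter> S \<in> sets lebesgue" by auto
  then show "f -` A \<inter> space (lebesgue_on S) \<in> sets (lebesgue_on S)"
    using S by (simp add: sets_restrict_space_iff space_restrict_space)
qed simp

lemma measurable_lebesgue_on_countable_Union:
  assumes D: "countable D" and f: "\<And>Q. Q \<in> D \<Longrightarrow> Q \<in> sets lebesgue \<and> f \<in> borel_measurable (lebesgue_on Q)"
  shows "f \<in> borel_measurable (lebesgue_on (\<Union>D))"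
proof (rule measurableI)
  fix A :: "'b set" assume A: "A \<in> sets borel"
  have "f -` A \<inter> Q \<in> sets lebesgue" if "Q \<in> D" for Q
    using measurable_sets[OF conjunct2[OF f[OF that]] A] f[OF that]
    by (simp add: sets_restrict_space_iff space_restrict_space)
  then have "(\<Union>Q\<in>D. f -` A \<inter> Q) \<in> sets lebesgue" using D by (intro sets.countable_UN') auto
  moreover have "(\<Union>Q\<in>D. f -` A \<inter> Q) = f -` A \<inter> \<Union>D" by auto
  moreover have "\<Union>D \<in> sets lebesgue" using D f by (intro sets.countable_Union) auto
  ultimately show "f -` A \<inter> space (lebesgue_on (\<Union>D)) \<in> sets (lebesgue_on (\<Union>D))"
    by (simp add: sets_restrict_space_iff space_restrict_space)
qed simp

lemma open_countable_union_cboxes: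
  assumes "open (W :: 'b::euclidean_space set)"
  shows "\<exists>D. countable D \<and> (\<forall>Q\<in>D. \<exists>a b. Q = cbox a b \<and> cbox a b \<subseteq> W) \<and> \<Union>D = W"
proof -
  obtain D where D: "countable D" "D \<subseteq> Pow W" "\<And>X. X \<in> D \<Longrightarrow> \<exists>a b. X = cbox a b" "\<Union>D = W"
    using open_countable_Union_open_cbox[OF assms] by blast
  have "\<forall>Q\<in>D. \<exists>a b. Q = cbox a b \<and> cbox a b \<subseteq> W"
  proof
    fix Q assume Q: "Q \<in> D"
    obtain a b where "Q = cbox a b" using D(3)[OF Q] by (elim exE)
    moreover have "Q \<subseteq> W" using D(2) Q by auto
    ultimately show "\<exists>a b. Q = cbox a b \<and> cbox a b \<subseteq> W" by (intro exI[of _ a] exI[of _ b]) simp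
  qed
  then show ?thesis using D(1,4) by (intro exI[of _ D] conjI)
qed

lemma borel_measurable_matrix_vector_mult:
  fixes A :: "'c \<Rightarrow> real^'n^'m" and v :: "'c \<Rightarrow> real^'n"
  assumes "A \<in> borel_measurable M" "v \<in> borel_measurable M"
  shows "(\<lambda>x. A x *v v x) \<in> borel_measurable M"
proof -
  have "continuous_on UNIV (\<lambda>p::(real^'n^'m) \<times> (real^'n). fst p *v snd p)"
    unfolding matrix_vector_mult_def by (intro continuous_intros)
  from borel_measurable_continuous_on[OF this borel_measurable_Pair[OF assms]] show ?thesis by simp
qed

text \<open>By Cramer's rule this is the solution of the linear system, as a continuous expression in the data; the
inverse matrix itself is given by a choice operator.\<close>

lemma borel_measurable_linear_solve:
  fixes A :: "'c \<Rightarrow> real^'n^'n" and v w :: "'c \<Rightarrow> real^'n"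
  assumes A: "A \<in> borel_measurable M" and v: "v \<in> borel_measurable M"
  shows "(\<lambda>x. (1 / det (A x)) *\<^sub>R (\<chi> k. det (\<chi> i j. if j = k then v x $ i else A x $ i $ j))) \<in> borel_measurable M"
proof -
  have cdet: "continuous_on UNIV (det :: real^'n^'n \<Rightarrow> real)"
    unfolding det_def[abs_def] by (intro continuous_intros)
  have "continuous_on UNIV (\<lambda>p::(real^'n^'n) \<times> (real^'n). (\<chi> i j. if j = k then snd p $ i else fst p $ i $ j) :: real^'n^'n)" for k
  proof (intro continuous_on_vec_lambda)
    fix i j
    show "continuous_on UNIV (\<lambda>p::(real^'n^'n) \<times> (real^'n). if j = k then snd p $ i else fst p $ i $ j)"
      by (cases "j = k") (auto intro!: continuous_intros)
  qed
  then have "continuous_on UNIV (\<lambda>p::(real^'n^'n) \<times> (real^'n). det (\<chi> i j. if j = k then snd p $ i else fst p $ i $ j))" for k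
    by (intro continuous_on_compose2[OF cdet]) auto
  then have "continuous_on UNIV (\<lambda>p::(real^'n^'n) \<times> (real^'n). (\<chi> k. det (\<chi> i j. if j = k then snd p $ i else fst p $ i $ j)) :: real^'n)"
    by (intro continuous_on_vec_lambda)
  from borel_measurable_continuous_on[OF this borel_measurable_Pair[OF A v]]
  have "(\<lambda>x. (\<chi> k. det (\<chi> i j. if j = k then v x $ i else A x $ i $ j)) :: real^'n) \<in> borel_measurable M"
    unfolding fst_conv snd_conv .
  moreover have "(\<lambda>x. det (A x)) \<in> borel_measurable M"
    using borel_measurable_continuous_on[OF cdet A] .
  ultimately show ?thesis by (intro borel_measurable_scaleR borel_measurable_divide borel_measurable_const)
qed

lemma matrix_inv_mult_vector:
  fixes A :: "real^'n^'n"
  assumes d: "det A \<noteq> 0"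
  shows "A *v (matrix_inv A *v b) = b"
    and "matrix_inv A *v b = (1 / det A) *\<^sub>R (\<chi> k. det (\<chi> i j. if j = k then b $ i else A $ i $ j))"
proof -
  have "A ** matrix_inv A = mat 1"
    using d unfolding invertible_det_nz[symmetric] invertible_def matrix_inv_def
    by (rule conjunct1[OF someI_ex])
  then show 1: "A *v (matrix_inv A *v b) = b"
    by (simp add: matrix_vector_mul_assoc)
  have "matrix_inv A *v b = (\<chi> k. det (\<chi> i j. if j = k then b $ i else A $ i $ j) / det A)"
    using 1 cramer[OF d, of "matrix_inv A *v b" b] by blast
  then show "matrix_inv A *v b = (1 / det A) *\<^sub>R (\<chi> k. det (\<chi> i j. if j = k then b $ i else A $ i $ j))"
    by (simp add: vec_eq_iff)
qed

context riem_poly begin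

lemma Forms_det_nonzero: "A \<in> Forms \<Longrightarrow> det A \<noteq> 0"
  using detmin_le[of A] detmin_pos by auto

lemma Forms_symmetric: "A \<in> Forms \<Longrightarrow> v \<bullet> (A *v w) = w \<bullet> (A *v v)"
proof -
  assume "A \<in> Forms"
  then have "transpose A = A" by (simp add: bounded_forms_def)
  then have "v \<bullet> (A *v w) = (A *v v) \<bullet> w"
    by (metis dot_lmul_matrix transpose_matrix_vector)
  then show ?thesis by (simp add: inner_commute)
qed

lemma Forms_nonneg: "A \<in> Forms \<Longrightarrow> 0 \<le> v \<bullet> (A *v v)"
proof -
  assume "A \<in> Forms"
  then have "inverse (Lam\<^sup>2) * (norm v)\<^sup>2 \<le> v \<bullet> (A *v v)" by (simp add: bounded_forms_def)
  moreover have "0 \<le> inverse (Lam\<^sup>2) * (norm v)\<^sup>2" by simp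
  ultimately show ?thesis by linarith
qed

lemma Forms_definite: "A \<in> Forms \<Longrightarrow> v \<bullet> (A *v v) = 0 \<Longrightarrow> v = 0"
proof -
  assume A: "A \<in> Forms" "v \<bullet> (A *v v) = 0"
  have "inverse (Lam\<^sup>2) * (norm v)\<^sup>2 \<le> v \<bullet> (A *v v)" using A(1) by (simp add: bounded_forms_def)
  then have "inverse (Lam\<^sup>2) * (norm v)\<^sup>2 \<le> 0" using A(2) by simp
  then have "(norm v)\<^sup>2 \<le> 0" using Lam_pos by (simp add: mult_le_0_iff)
  then show "v = 0" by simp
qed

text \<open>The Euclidean gradient in the chart of the carrier, to which \<open>lip_grad\<close> applies the inverse of the metric.\<close>

definition egrad :: "('a \<Rightarrow> real) \<Rightarrow> 'a \<Rightarrow> real^'n" where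
  "egrad u p = (THE D. GDERIV (\<lambda>x. u (point P (carrier_simplex P p) x))
               (coord P (carrier_simplex P p) p) :> D)"

definition differentiable_pt :: "('a \<Rightarrow> real) \<Rightarrow> 'a \<Rightarrow> bool" where
  "differentiable_pt u p \<longleftrightarrow> (GDERIV (\<lambda>x. u (point P (carrier_simplex P p) x))
               (coord P (carrier_simplex P p) p) :> egrad u p)"

lemma lip_grad_egrad: "lip_grad P u p = matrix_inv (g_at P p) *v egrad u p"
  by (simp add: lip_grad_def egrad_def)

lemma egrad_eqI:
  assumes "GDERIV (\<lambda>x. u (point P (carrier_simplex P p) x)) (coord P (carrier_simplex P p) p) :> D"
  shows "egrad u p = D" "differentiable_pt u p"
proof -
  show "egrad u p = D" unfolding egrad_def using assms by (rule the_equality) (rule GDERIV_unique[OF _ assms])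
  with assms show "differentiable_pt u p" by (simp add: differentiable_pt_def)
qed

text \<open>The metric cancels its inverse.\<close>

lemma ginner_lip_grad:
  assumes "g_at P p \<in> Forms"
  shows "ginner P p \<xi> (lip_grad P u p) = \<xi> \<bullet> egrad u p"
  unfolding ginner_def lip_grad_egrad
  by (simp add: matrix_inv_mult_vector(1)[OF Forms_det_nonzero[OF assms]])

lemma g_at_Forms_AE: "AE p in vol P. g_at P p \<in> Forms"
  unfolding AE_vol_iff
proof
  fix s assume s: "s \<in> maxs P"
  interpret S: riem_simplex P s using s by (rule riem_simplexI)
  show "negligible {x \<in> interior (cell P s). g_at P (point P s x) \<notin> Forms}"
    using S.gmat_Forms_AE by (rule negligible_subset) (use interior_subset[of "cell P s"] in \<open>auto simp: S.g_at_point\<close>)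
qed

lemma measurable_vol_interiorI:
  fixes f :: "'a \<Rightarrow> 'b::topological_space"
  assumes "\<And>s. s \<in> maxs P \<Longrightarrow> (\<lambda>x. f (point P s x)) \<in> borel_measurable (lebesgue_on (interior (cell P s)))"
  shows "f \<in> borel_measurable (vol P)"
  unfolding measurable_vol_iff
proof
  fix s assume s: "s \<in> maxs P"
  interpret S: riem_simplex P s using s by (rule riem_simplexI)
  let ?B = "cell P s - interior (cell P s)"
  have I: "interior (cell P s) \<in> sets lebesgue" by (simp add: borel_open)
  show "(\<lambda>x. f (point P s x)) \<in> borel_measurable (lebesgue_on (cell P s))"
  proof (rule measurableI)
    fix A :: "'b set" assume A: "A \<in> sets borel"
    let ?f = "\<lambda>x. f (point P s x)"
    have "?f -` A \<inter> interior (cell P s) \<in> sets lebesgue"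
      using measurable_sets[OF assms[OF s] A] I by (simp add: sets_restrict_space_iff space_restrict_space)
    moreover have "negligible (?f -` A \<inter> ?B)" using S.negligible_cell_boundary by (rule negligible_subset) auto
    then have "?f -` A \<inter> ?B \<in> sets lebesgue" by (rule negligible_imp_sets)
    moreover have "?f -` A \<inter> cell P s = (?f -` A \<inter> interior (cell P s)) \<union> (?f -` A \<inter> ?B)"
      using interior_subset[of "cell P s"] by auto
    ultimately have "?f -` A \<inter> cell P s \<in> sets lebesgue" by auto
    then show "?f -` A \<inter> space (lebesgue_on (cell P s)) \<in> sets (lebesgue_on (cell P s))"
      using S.cell_lebesgue by (simp add: sets_restrict_space_iff space_restrict_space)
  qed simp
qed

lemma g_at_measurable: "g_at P \<in> borel_measurable (vol P)"
proof (rule measurable_vol_interiorI)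
  fix s assume s: "s \<in> maxs P"
  interpret S: riem_simplex P s using s by (rule riem_simplexI)
  have I: "interior (cell P s) \<in> sets lebesgue" by (simp add: borel_open)
  have "gmat P s \<in> borel_measurable (lebesgue_on (interior (cell P s)))"
    using S.gmat_measurable by (rule measurable_restrict_mono) (rule interior_subset)
  then show "(\<lambda>x. g_at P (point P s x)) \<in> borel_measurable (lebesgue_on (interior (cell P s)))"
  proof (rule measurable_lebesgue_on_negligible_cong[OF I])
    have e: "{x \<in> interior (cell P s). g_at P (point P s x) \<noteq> gmat P s x} = {}"
      by (auto simp: S.g_at_point)
    show "negligible {x \<in> interior (cell P s). g_at P (point P s x) \<noteq> gmat P s x}"
      unfolding e by (rule negligible_empty)
  qed
qed

lemma ginner_measurable:
  assumes "\<xi> \<in> borel_measurable (vol P)" "\<eta> \<in> borel_measurable (vol P)"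
  shows "(\<lambda>p. ginner P p (\<xi> p) (\<eta> p)) \<in> borel_measurable (vol P)"
  unfolding ginner_def
  using assms g_at_measurable by (intro borel_measurable_inner borel_measurable_matrix_vector_mult)

lemma gnorm_measurable:
  assumes "\<xi> \<in> borel_measurable (vol P)"
  shows "(\<lambda>p. gnorm P p (\<xi> p)) \<in> borel_measurable (vol P)"
  unfolding gnorm_def using ginner_measurable[OF assms assms] by measurable

end

context riem_simplex begin

text \<open>The open set of the cell that corresponds to the part of \<open>U\<close> in the open simplex.\<close>

definition chart_dom :: "'a set \<Rightarrow> (real^'n) set" where
  "chart_dom U = {x \<in> interior (cell P s). point P s x \<in> U}"

lemma chart_dom_subset: "chart_dom U \<subseteq> interior (cell P s)" by (auto simp: chart_dom_def)

lemma open_chart_dom: "open U \<Longrightarrow> open (chart_dom U)"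
proof -
  assume U: "open U"
  have "continuous_on (interior (cell P s)) (point P s)"
    using continuous_point interior_subset by (rule continuous_on_subset)
  from continuous_open_preimage[OF this open_interior U]
  show ?thesis by (simp add: chart_dom_def vimage_def Int_def)
qed

lemma carrier_coord_point:
  assumes "x \<in> interior (cell P s)"
  shows "carrier_simplex P (point P s x) = s" "coord P s (point P s x) = x"
  using assms interior_subset[of "cell P s"] carrier_point_interior coord_point by auto

text \<open>The nearest point projection onto a convex set is nonexpansive. The extension allows results on globally
Lipschitz functions to be applied in a box.\<close>

lemma lip_on_cbox_extension:
  assumes u: "lip_on P U u" and Q: "cbox a b \<subseteq> chart_dom U" "cbox a b \<noteq> {}"
  shows "\<exists>L F. L-lipschitz_on UNIV F \<and> (\<forall>x\<in>cbox a b. F x = u (point P s x))"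
proof -
  obtain L where L: "L \<ge> 0" "\<forall>x\<in>cell P s. \<forall>y\<in>cell P s. point P s x \<in> U \<longrightarrow> point P s y \<in> U \<longrightarrow>
     \<bar>u (point P s x) - u (point P s y)\<bar> \<le> L * dist x y"
    using lip_on_chart_lipschitz[OF u] by (elim exE conjE)
  have QW: "x \<in> cell P s \<and> point P s x \<in> U" if "x \<in> cbox a b" for x
    using that Q(1) interior_subset[of "cell P s"] by (auto simp: chart_dom_def)
  let ?c = "closest_point (cbox a b)"
  have cQ: "?c x \<in> cbox a b" for x using Q(2) by (intro closest_point_in_set) auto
  show ?thesis
  proof (intro exI[of _ L] exI[of _ "\<lambda>x. u (point P s (?c x))"] conjI ballI)
    show "L-lipschitz_on UNIV (\<lambda>x. u (point P s (?c x)))"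
    proof (rule lipschitz_onI[OF _ L(1)])
      fix x y
      have "dist (u (point P s (?c x))) (u (point P s (?c y))) \<le> L * dist (?c x) (?c y)"
        using L(2) QW[OF cQ] by (simp add: dist_real_def)
      also have "\<dots> \<le> L * dist x y"
        using L(1) Q(2) by (intro mult_left_mono closest_point_lipschitz) auto
      finally show "dist (u (point P s (?c x))) (u (point P s (?c y))) \<le> L * dist x y" .
    qed
    show "u (point P s (?c x)) = u (point P s x)" if "x \<in> cbox a b" for x
      using that by (simp add: closest_point_self)
  qed
qed

lemma egrad_point_eqI:
  assumes x: "x \<in> interior (cell P s)" and D: "GDERIV (\<lambda>x. u (point P s x)) x :> D"
  shows "egrad u (point P s x) = D" "differentiable_pt u (point P s x)"
  using egrad_eqI[of u "point P s x" D] D by (simp_all add: carrier_coord_point[OF x])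

text \<open>On the open box the function and its extension agree near every point, and the boundary of the box is
negligible.\<close>

lemma egrad_on_cbox:
  assumes F: "L-lipschitz_on UNIV F" "\<And>x. x \<in> cbox a b \<Longrightarrow> F x = u (point P s x)"
    and Q: "cbox a b \<subseteq> chart_dom U"
  shows "negligible {x \<in> cbox a b. \<not> (differentiable_pt u (point P s x) \<and>
      egrad u (point P s x) = (\<Sum>i\<in>Basis. dir_deriv F i x *\<^sub>R i))}"
proof -
  have "AE x in lebesgue. GDERIV F x :> (\<Sum>i\<in>Basis. dir_deriv F i x *\<^sub>R i)"
    by (rule AE_completion[OF rademacher[OF F(1)]])
  then have n1: "negligible {x. \<not> (GDERIV F x :> (\<Sum>i\<in>Basis. dir_deriv F i x *\<^sub>R i))}"
    unfolding AE_lebesgue_iff_negligible .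
  have n2: "negligible (cbox a b - box a b)"
    using negligible_convex_frontier[of "cbox a b"] by (simp add: frontier_cbox)
  show ?thesis
  proof (rule negligible_subset[OF negligible_Un[OF n1 n2]], safe)
    fix x assume x: "x \<in> cbox a b" "x \<in> box a b" and
      D: "GDERIV F x :> (\<Sum>i\<in>Basis. dir_deriv F i x *\<^sub>R i)"
    have xi: "x \<in> interior (cell P s)" using x(1) Q by (auto simp: chart_dom_def)
    have "GDERIV (\<lambda>x. u (point P s x)) x :> (\<Sum>i\<in>Basis. dir_deriv F i x *\<^sub>R i)"
      by (rule GDERIV_transform_within_open[OF D open_box x(2)])
         (use F(2) box_subset_cbox in blast)
    note * = egrad_point_eqI[OF xi this]
    show "differentiable_pt u (point P s x)" by (rule *(2))
    show "egrad u (point P s x) = (\<Sum>i\<in>Basis. dir_deriv F i x *\<^sub>R i)" by (rule *(1))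
  qed
qed

lemma lip_on_differentiable_AE:
  assumes u: "lip_on P U u" and U: "open U"
  shows "negligible {x \<in> chart_dom U. \<not> differentiable_pt u (point P s x)}"
proof -
  obtain D where D: "countable D" "\<forall>Q\<in>D. \<exists>a b. Q = cbox a b \<and> cbox a b \<subseteq> chart_dom U" "\<Union>D = chart_dom U"
    using open_countable_union_cboxes[OF open_chart_dom[OF U]] by (elim exE conjE)
  have "negligible {x \<in> Q. \<not> differentiable_pt u (point P s x)}" if Qd: "Q \<in> D" for Q
  proof -
    obtain a b where Q: "Q = cbox a b" "cbox a b \<subseteq> chart_dom U" using bspec[OF D(2) Qd] by (elim exE conjE)
    show ?thesis
    proof (cases "cbox a b = {}")
      case False
      obtain L F where F0: "L-lipschitz_on UNIV F" "\<forall>x\<in>cbox a b. F x = u (point P s x)"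
        using lip_on_cbox_extension[OF u Q(2) False] by (elim exE conjE)
      note F = F0(1) bspec[OF F0(2)]
      show ?thesis unfolding Q(1)
        by (rule negligible_subset[OF egrad_on_cbox[OF F Q(2)]]) auto
    qed (simp add: Q)
  qed
  then have "negligible (\<Union>Q\<in>D. {x \<in> Q. \<not> differentiable_pt u (point P s x)})"
    using D(1) by (intro negligible_countable_Union) auto
  then show ?thesis by (rule negligible_subset) (use D(3) in auto)
qed

lemma egrad_measurable_chart:
  assumes u: "lip_on P U u" and U: "open U"
  shows "(\<lambda>x. egrad u (point P s x)) \<in> borel_measurable (lebesgue_on (chart_dom U))"
proof -
  obtain D where D: "countable D" "\<forall>Q\<in>D. \<exists>a b. Q = cbox a b \<and> cbox a b \<subseteq> chart_dom U" "\<Union>D = chart_dom U"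
    using open_countable_union_cboxes[OF open_chart_dom[OF U]] by (elim exE conjE)
  have "Q \<in> sets lebesgue \<and> (\<lambda>x. egrad u (point P s x)) \<in> borel_measurable (lebesgue_on Q)" if Qd: "Q \<in> D" for Q
  proof -
    obtain a b where Q: "Q = cbox a b" "cbox a b \<subseteq> chart_dom U" using bspec[OF D(2) Qd] by (elim exE conjE)
    have "(\<lambda>x. egrad u (point P s x)) \<in> borel_measurable (lebesgue_on Q)"
    proof (cases "cbox a b = {}")
      case True
      then show ?thesis by (intro measurableI) (auto simp: Q space_restrict_space)
    next
      case False
      obtain L F where F0: "L-lipschitz_on UNIV F" "\<forall>x\<in>cbox a b. F x = u (point P s x)"
        using lip_on_cbox_extension[OF u Q(2) False] by (elim exE conjE)
      note F = F0(1) bspec[OF F0(2)]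
      have "(\<lambda>x. \<Sum>i\<in>Basis. dir_deriv F i x *\<^sub>R i) \<in> borel_measurable borel"
        using dir_deriv_measurable[OF lipschitz_on_continuous_on[OF F(1)]] by measurable
      then have "(\<lambda>x. \<Sum>i\<in>Basis. dir_deriv F i x *\<^sub>R i) \<in> borel_measurable lebesgue"
        by (simp add: measurable_completion)
      then have m: "(\<lambda>x. \<Sum>i\<in>Basis. dir_deriv F i x *\<^sub>R i) \<in> borel_measurable (lebesgue_on Q)"
        by (rule measurable_restrict_space1)
      show ?thesis
        by (rule measurable_lebesgue_on_negligible_cong[OF _ m])
           (auto simp: Q(1) intro: negligible_subset[OF egrad_on_cbox[OF F Q(2)]])
    qed
    then show ?thesis using Q by simp
  qed
  from measurable_lebesgue_on_countable_Union[OF D(1) this] show ?thesis by (simp add: D(3))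
qed

lemma chart_dom_lebesgue: "open U \<Longrightarrow> chart_dom U \<in> sets lebesgue"
  using open_chart_dom by (simp add: borel_open)

lemma gmat_measurable_chart_dom: "gmat P s \<in> borel_measurable (lebesgue_on (chart_dom U))"
  using gmat_measurable
  by (rule measurable_restrict_mono) (use chart_dom_subset interior_subset in blast)

lemma lip_grad_measurable_chart:
  assumes u: "lip_on P U u" and U: "open U"
  shows "(\<lambda>x. lip_grad P u (point P s x)) \<in> borel_measurable (lebesgue_on (chart_dom U))"
proof (rule measurable_lebesgue_on_negligible_cong[OF chart_dom_lebesgue[OF U]
      borel_measurable_linear_solve[OF gmat_measurable_chart_dom egrad_measurable_chart[OF u U]]])
  show "negligible {x \<in> chart_dom U. lip_grad P u (point P s x) \<noteq>
     (1 / det (gmat P s x)) *\<^sub>R (\<chi> k. det (\<chi> i j. if j = k then egrad u (point P s x) $ i else gmat P s x $ i $ j))}"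
  proof (rule negligible_subset[OF gmat_Forms_AE], safe)
    fix x assume x: "x \<in> chart_dom U" and ne: "lip_grad P u (point P s x) \<noteq>
     (1 / det (gmat P s x)) *\<^sub>R (\<chi> k. det (\<chi> i j. if j = k then egrad u (point P s x) $ i else gmat P s x $ i $ j))"
    have xi: "x \<in> interior (cell P s)" using x chart_dom_subset by blast
    show "x \<in> cell P s" using xi interior_subset by blast
    assume "gmat P s x \<in> Forms"
    then show False using ne matrix_inv_mult_vector(2)[OF Forms_det_nonzero]
      by (simp add: lip_grad_egrad g_at_point[OF xi])
  qed
qed

lemma lip_on_continuous_chart:
  assumes u: "lip_on P U u"
  shows "continuous_on (chart_dom U) (\<lambda>x. u (point P s x))"
proof -
  obtain L where L: "L \<ge> 0" "\<forall>x\<in>cell P s. \<forall>y\<in>cell P s. point P s x \<in> U \<longrightarrow> point P s y \<in> U \<longrightarrow>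
     \<bar>u (point P s x) - u (point P s y)\<bar> \<le> L * dist x y"
    using lip_on_chart_lipschitz[OF u] by (elim exE conjE)
  have "L-lipschitz_on (chart_dom U) (\<lambda>x. u (point P s x))"
    using L interior_subset[of "cell P s"]
    by (intro lipschitz_onI) (auto simp: dist_real_def chart_dom_def subset_iff)
  then show ?thesis by (rule lipschitz_on_continuous_on)
qed

lemma chart_dom_UNIV: "chart_dom UNIV = interior (cell P s)" by (simp add: chart_dom_def)

end

context riem_poly begin

lemma lip_on_measurable:
  assumes "lip_on P UNIV u"
  shows "u \<in> borel_measurable (vol P)" "lip_grad P u \<in> borel_measurable (vol P)" "egrad u \<in> borel_measurable (vol P)"
proof -
  show "u \<in> borel_measurable (vol P)"
  proof (rule measurable_vol_interiorI)
    fix s assume s: "s \<in> maxs P"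
    interpret S: riem_simplex P s using s by (rule riem_simplexI)
    show "(\<lambda>x. u (point P s x)) \<in> borel_measurable (lebesgue_on (interior (cell P s)))"
      using S.lip_on_continuous_chart[OF assms] unfolding S.chart_dom_UNIV
      by (intro continuous_imp_measurable_on_sets_lebesgue) (auto simp: borel_open)
  qed
  show "lip_grad P u \<in> borel_measurable (vol P)"
  proof (rule measurable_vol_interiorI)
    fix s assume s: "s \<in> maxs P"
    interpret S: riem_simplex P s using s by (rule riem_simplexI)
    show "(\<lambda>x. lip_grad P u (point P s x)) \<in> borel_measurable (lebesgue_on (interior (cell P s)))"
      using S.lip_grad_measurable_chart[OF assms open_UNIV] unfolding S.chart_dom_UNIV .
  qed
  show "egrad u \<in> borel_measurable (vol P)"
  proof (rule measurable_vol_interiorI)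
    fix s assume s: "s \<in> maxs P"
    interpret S: riem_simplex P s using s by (rule riem_simplexI)
    show "(\<lambda>x. egrad u (point P s x)) \<in> borel_measurable (lebesgue_on (interior (cell P s)))"
      using S.egrad_measurable_chart[OF assms open_UNIV] unfolding S.chart_dom_UNIV .
  qed
qed

lemma lip_on_differentiable_pt_AE:
  assumes "lip_on P UNIV u"
  shows "AE p in vol P. differentiable_pt u p"
  unfolding AE_vol_iff
proof
  fix s assume s: "s \<in> maxs P"
  interpret S: riem_simplex P s using s by (rule riem_simplexI)
  show "negligible {x \<in> interior (cell P s). \<not> differentiable_pt u (point P s x)}"
    using S.lip_on_differentiable_AE[OF assms open_UNIV] unfolding S.chart_dom_UNIV .
qed

end

section \<open>Uniqueness of Sobolev gradients\<close>

lemma tendsto_zero_if_square_le: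
  fixes x y :: "nat \<Rightarrow> ennreal"
  assumes "y \<longlonglongrightarrow> 0" "\<And>k. (x k)\<^sup>2 \<le> y k"
  shows "x \<longlonglongrightarrow> 0"
proof (rule order_tendstoI)
  fix a :: ennreal assume a: "0 < a"
  then have "0 < a\<^sup>2" by (simp add: power2_eq_square ennreal_zero_less_mult_iff)
  with assms(1) have "\<forall>\<^sub>F k in sequentially. y k < a\<^sup>2" by (rule order_tendstoD)
  then show "\<forall>\<^sub>F k in sequentially. x k < a"
  proof eventually_elim
    case (elim k)
    show ?case
    proof (rule ccontr)
      assume "\<not> x k < a"
      then have "a\<^sup>2 \<le> (x k)\<^sup>2" by (intro power_mono) auto
      then show False using elim assms(2)[of k] by simp
    qed
  qed
qed simp

text \<open>The inequality of Cauchy and Schwarz against the constant \<open>1\<close>.\<close>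

lemma L1_tendsto_zero_if_L2:
  fixes e q :: "nat \<Rightarrow> 'c \<Rightarrow> real"
  assumes fin: "emeasure M (space M) < \<infinity>" and e: "\<And>k. e k \<in> borel_measurable M"
    and le: "\<And>k. AE x in M. (e k x)\<^sup>2 \<le> C * q k x" and C: "C \<ge> 0"
    and q: "(\<lambda>k. \<integral>\<^sup>+x. ennreal (q k x) \<partial>M) \<longlonglongrightarrow> 0" and qm: "\<And>k. q k \<in> borel_measurable M"
  shows "(\<lambda>k. \<integral>\<^sup>+x. ennreal \<bar>e k x\<bar> \<partial>M) \<longlonglongrightarrow> 0"
proof (rule tendsto_zero_if_square_le)
  fix k
  have "(\<integral>\<^sup>+x. ennreal \<bar>e k x\<bar> * 1 \<partial>M)\<^sup>2 \<le> (\<integral>\<^sup>+x. (ennreal \<bar>e k x\<bar>)\<^sup>2 \<partial>M) * (\<integral>\<^sup>+x. 1\<^sup>2 \<partial>M)"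
    using e by (intro Cauchy_Schwarz_nn_integral) auto
  also have "(\<integral>\<^sup>+x. (ennreal \<bar>e k x\<bar>)\<^sup>2 \<partial>M) \<le> (\<integral>\<^sup>+x. ennreal C * ennreal (q k x) \<partial>M)"
    using le[of k]
    by (intro nn_integral_mono_AE) (auto elim!: eventually_mono simp: ennreal_power ennreal_mult'[OF C, symmetric] intro!: ennreal_leI)
  also have "\<dots> = ennreal C * (\<integral>\<^sup>+x. ennreal (q k x) \<partial>M)"
    using qm by (intro nn_integral_cmult) measurable
  finally show "(\<integral>\<^sup>+x. ennreal \<bar>e k x\<bar> \<partial>M)\<^sup>2 \<le> ennreal C * (\<integral>\<^sup>+x. ennreal (q k x) \<partial>M) * emeasure M (space M)"
    by (simp add: mult_right_mono)
next
  have "(\<lambda>k. (ennreal C * emeasure M (space M)) * (\<integral>\<^sup>+x. ennreal (q k x) \<partial>M)) \<longlonglongrightarrow> (ennreal C * emeasure M (space M)) * 0"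
    using fin by (intro ennreal_tendsto_cmult q) (simp add: ennreal_mult_less_top)
  then show "(\<lambda>k. ennreal C * (\<integral>\<^sup>+x. ennreal (q k x) \<partial>M) * emeasure M (space M)) \<longlonglongrightarrow> 0" by (simp add: mult_ac)
qed

lemma integrable_mult_AE_bounded:
  fixes h \<phi> :: "'c \<Rightarrow> real"
  assumes h: "integrable M h" and \<phi>: "\<phi> \<in> borel_measurable M" "AE x in M. \<bar>\<phi> x\<bar> \<le> B"
  shows "integrable M (\<lambda>x. h x * \<phi> x)"
proof (rule Bochner_Integration.integrable_bound)
  show "integrable M (\<lambda>x. B * \<bar>h x\<bar>)" using h by simp
  show "(\<lambda>x. h x * \<phi> x) \<in> borel_measurable M" using h \<phi>(1) by measurable
  show "AE x in M. norm (h x * \<phi> x) \<le> norm (B * \<bar>h x\<bar>)"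
    using \<phi>(2)
  proof eventually_elim
    case (elim x)
    then have "\<bar>h x\<bar> * \<bar>\<phi> x\<bar> \<le> \<bar>h x\<bar> * B" by (intro mult_left_mono) auto
    moreover have "0 \<le> B" using elim by linarith
    ultimately show ?case by (simp add: abs_mult mult.commute)
  qed
qed

lemma L1_limit_times_bounded:
  fixes h :: "nat \<Rightarrow> 'c \<Rightarrow> real"
  assumes h: "\<And>n. integrable M (h n)" "integrable M h0"
    and lim: "(\<lambda>n. \<integral>\<^sup>+x. ennreal \<bar>h n x - h0 x\<bar> \<partial>M) \<longlonglongrightarrow> 0"
    and \<phi>: "\<phi> \<in> borel_measurable M" "AE x in M. \<bar>\<phi> x\<bar> \<le> B"
  shows "(\<lambda>n. \<integral>x. h n x * \<phi> x \<partial>M) \<longlonglongrightarrow> (\<integral>x. h0 x * \<phi> x \<partial>M)"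
proof (rule tendsto_L1_int)
  show "integrable M (\<lambda>x. h n x * \<phi> x)" for n by (rule integrable_mult_AE_bounded[OF h(1) \<phi>])
  show "integrable M (\<lambda>x. h0 x * \<phi> x)" by (rule integrable_mult_AE_bounded[OF h(2) \<phi>])
  have le: "(\<integral>\<^sup>+x. ennreal (norm (h n x * \<phi> x - h0 x * \<phi> x)) \<partial>M) \<le> ennreal \<bar>B\<bar> * (\<integral>\<^sup>+x. ennreal \<bar>h n x - h0 x\<bar> \<partial>M)" for n
  proof -
    have "(\<integral>\<^sup>+x. ennreal (norm (h n x * \<phi> x - h0 x * \<phi> x)) \<partial>M) \<le> (\<integral>\<^sup>+x. ennreal \<bar>B\<bar> * ennreal \<bar>h n x - h0 x\<bar> \<partial>M)"
    proof (rule nn_integral_mono_AE)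
      show "AE x in M. ennreal (norm (h n x * \<phi> x - h0 x * \<phi> x)) \<le> ennreal \<bar>B\<bar> * ennreal \<bar>h n x - h0 x\<bar>"
        using \<phi>(2)
      proof eventually_elim
        case (elim x)
        have "norm (h n x * \<phi> x - h0 x * \<phi> x) = \<bar>\<phi> x\<bar> * \<bar>h n x - h0 x\<bar>"
          unfolding left_diff_distrib[symmetric] real_norm_def abs_mult by (rule mult.commute)
        also have "\<dots> \<le> \<bar>B\<bar> * \<bar>h n x - h0 x\<bar>" using elim by (intro mult_right_mono) auto
        finally show ?case by (simp add: ennreal_mult[symmetric] ennreal_leI)
      qed
    qed
    also have "\<dots> = ennreal \<bar>B\<bar> * (\<integral>\<^sup>+x. ennreal \<bar>h n x - h0 x\<bar> \<partial>M)"
      using borel_measurable_integrable[OF h(1)[of n]] borel_measurable_integrable[OF h(2)]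
      by (intro nn_integral_cmult) measurable
    finally show ?thesis .
  qed
  have "(\<lambda>n. ennreal \<bar>B\<bar> * (\<integral>\<^sup>+x. ennreal \<bar>h n x - h0 x\<bar> \<partial>M)) \<longlonglongrightarrow> ennreal \<bar>B\<bar> * 0"
    using lim by (intro ennreal_tendsto_cmult) auto
  then have lim0: "(\<lambda>n. ennreal \<bar>B\<bar> * (\<integral>\<^sup>+x. ennreal \<bar>h n x - h0 x\<bar> \<partial>M)) \<longlonglongrightarrow> 0" by simp
  show "(\<lambda>n. \<integral>\<^sup>+x. ennreal (norm (h n x * \<phi> x - h0 x * \<phi> x)) \<partial>M) \<longlonglongrightarrow> 0"
    by (rule tendsto_sandwich[OF _ _ tendsto_const lim0])
       (rule always_eventually, rule allI, rule zero_le, rule always_eventually, rule allI, rule le)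
qed

lemma integrable_if_L1_close:
  fixes h h0 :: "'c \<Rightarrow> real"
  assumes "integrable M h" "h0 \<in> borel_measurable M" "(\<integral>\<^sup>+x. ennreal \<bar>h x - h0 x\<bar> \<partial>M) < \<infinity>"
  shows "integrable M h0"
proof -
  have "integrable M (\<lambda>x. h x - h0 x)"
    using assms by (intro integrableI_bounded) auto
  from Bochner_Integration.integrable_diff[OF assms(1) this] show ?thesis by simp
qed

lemma integrable_AE_bounded_finite:
  fixes h :: "'c \<Rightarrow> real"
  assumes "emeasure M (space M) < \<infinity>" "h \<in> borel_measurable M" "AE x in M. \<bar>h x\<bar> \<le> B"
  shows "integrable M h"
proof -
  have "integrable M (\<lambda>x. 1::real)" using assms(1) by (intro integrableI_bounded) auto
  from integrable_mult_AE_bounded[OF this assms(2,3)] show ?thesis by simp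
qed

lemma integral_lborel_eq_lebesgue_on:
  fixes h :: "'b::euclidean_space \<Rightarrow> real"
  assumes h: "h \<in> borel_measurable borel" and Q: "Q \<in> sets lebesgue" and z: "\<And>x. x \<notin> Q \<Longrightarrow> h x = 0"
  shows "(\<integral>x. h x \<partial>lborel) = (\<integral>x. h x \<partial>lebesgue_on Q)"
proof -
  have "(\<integral>x. h x \<partial>lebesgue_on Q) = (\<integral>x. indicator Q x *\<^sub>R h x \<partial>lebesgue)"
    using Q by (intro integral_restrict_space) simp
  also have "(\<lambda>x. indicator Q x *\<^sub>R h x) = h" using z by (auto simp: fun_eq_iff indicator_def)
  also have "(\<integral>x. h x \<partial>lebesgue) = (\<integral>x. h x \<partial>lborel)"
    using h by (intro integral_completion) simp
  finally show ?thesis by simp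
qed

context riem_poly begin

text \<open>Nonnegativity of the form at \<open>b v - c w\<close> with \<open>b = w \<bullet> A w\<close> and \<open>c = v \<bullet> A w\<close>.\<close>

lemma Forms_Cauchy_Schwarz:
  assumes A: "A \<in> Forms"
  shows "(v \<bullet> (A *v w))\<^sup>2 \<le> (v \<bullet> (A *v v)) * (w \<bullet> (A *v w))"
proof (cases "w = 0")
  case False
  define b where "b = w \<bullet> (A *v w)"
  have b: "b > 0" using Forms_nonneg[OF A, of w] Forms_definite[OF A, of w] False by (auto simp: b_def less_le)
  define c where "c = v \<bullet> (A *v w)"
  have "0 \<le> (b *\<^sub>R v - c *\<^sub>R w) \<bullet> (A *v (b *\<^sub>R v - c *\<^sub>R w))" by (rule Forms_nonneg[OF A])
  also have "\<dots> = b * (b * (v \<bullet> (A *v v)) - c\<^sup>2)"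
    using Forms_symmetric[OF A, of w v]
    by (simp add: matrix_vector_mult_diff_distrib matrix_vector_mult_scaleR inner_diff b_def c_def power2_eq_square algebra_simps)
  finally have "0 \<le> b * (v \<bullet> (A *v v)) - c\<^sup>2" using b by (simp add: zero_le_mult_iff)
  then show ?thesis by (simp add: b_def c_def mult.commute)
qed simp

lemma gnorm_square: "g_at P p \<in> Forms \<Longrightarrow> (gnorm P p \<xi>)\<^sup>2 = ginner P p \<xi> \<xi>"
  unfolding gnorm_def ginner_def using Forms_nonneg by simp

lemma open_sets_vol: "open U \<Longrightarrow> U \<in> sets (vol P)"
  unfolding vol_eq by (intro sets_completionI_sets) (simp add: borel_open)

text \<open>As \<open>U\<close> may have a complicated boundary, measurability on \<open>U\<close> is checked on its traces in the open
simplexes; the rest of \<open>U\<close> is a null set.\<close>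

lemma restrict_vol_measurable_iff:
  fixes h :: "'a \<Rightarrow> 'b::topological_space"
  assumes U: "open U"
  shows "h \<in> borel_measurable (restrict_space (vol P) U) \<longleftrightarrow>
    (\<forall>s\<in>maxs P. (\<lambda>x. h (point P s x)) \<in> borel_measurable (lebesgue_on (riem_simplex.chart_dom P s U)))"
proof -
  have "h \<in> borel_measurable (restrict_space (vol P) U) \<longleftrightarrow> (\<forall>A\<in>sets borel. h -` A \<inter> U \<in> sets (vol P))"
    using open_sets_vol[OF U] by (auto simp: measurable_def sets_restrict_space_iff space_restrict_space)
  also have "\<dots> \<longleftrightarrow> (\<forall>A\<in>sets borel. \<forall>s\<in>maxs P. {x \<in> cell P s. point P s x \<in> h -` A \<inter> U} \<in> sets lebesgue)"
    unfolding sets_vol_iff ..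
  also have "\<dots> \<longleftrightarrow> (\<forall>A\<in>sets borel. \<forall>s\<in>maxs P. {x \<in> riem_simplex.chart_dom P s U. h (point P s x) \<in> A} \<in> sets lebesgue)"
  proof (intro ball_cong refl)
    fix A :: "'b set" and s assume s: "s \<in> maxs P"
    interpret S: riem_simplex P s using s by (rule riem_simplexI)
    let ?X = "{x \<in> cell P s. point P s x \<in> h -` A \<inter> U}" and ?Y = "{x \<in> S.chart_dom U. h (point P s x) \<in> A}"
    have I: "interior (cell P s) \<in> sets lebesgue" by (simp add: borel_open)
    have "negligible (?X - interior (cell P s))" using S.negligible_cell_boundary by (rule negligible_subset) auto
    then have 1: "?X - interior (cell P s) \<in> sets lebesgue" by (rule negligible_imp_sets)
    have 2: "?X = ?Y \<union> (?X - interior (cell P s))" "?Y = ?X \<inter> interior (cell P s)"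
      using interior_subset[of "cell P s"] by (auto simp: S.chart_dom_def)
    show "?X \<in> sets lebesgue \<longleftrightarrow> ?Y \<in> sets lebesgue"
    proof
      assume "?X \<in> sets lebesgue"
      then show "?Y \<in> sets lebesgue" by (subst 2(2)) (rule sets.Int[OF _ I])
    next
      assume "?Y \<in> sets lebesgue"
      then show "?X \<in> sets lebesgue" by (subst 2(1)) (rule sets.Un[OF _ 1])
    qed
  qed
  also have "\<dots> \<longleftrightarrow> (\<forall>s\<in>maxs P. \<forall>A\<in>sets borel. {x \<in> riem_simplex.chart_dom P s U. h (point P s x) \<in> A} \<in> sets lebesgue)"
    by (rule iffI) (intro ballI, elim ballE, assumption+, simp_all)+
  also have "\<dots> \<longleftrightarrow> (\<forall>s\<in>maxs P. (\<lambda>x. h (point P s x)) \<in> borel_measurable (lebesgue_on (riem_simplex.chart_dom P s U)))"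
  proof (intro ball_cong refl)
    fix s assume s: "s \<in> maxs P"
    interpret S: riem_simplex P s using s by (rule riem_simplexI)
    have "(\<lambda>x. h (point P s x)) -` A \<inter> S.chart_dom U = {x \<in> S.chart_dom U. h (point P s x) \<in> A}" for A by auto
    then show "(\<forall>A\<in>sets borel. {x \<in> S.chart_dom U. h (point P s x) \<in> A} \<in> sets lebesgue) \<longleftrightarrow>
        (\<lambda>x. h (point P s x)) \<in> borel_measurable (lebesgue_on (S.chart_dom U))"
      using S.chart_dom_lebesgue[OF U] by (auto simp: measurable_def sets_restrict_space_iff space_restrict_space)
  qed
  finally show ?thesis .
qed

lemma restrict_gnorm_measurable:
  assumes "\<xi> \<in> borel_measurable (restrict_space (vol P) U)"
  shows "(\<lambda>p. gnorm P p (\<xi> p)) \<in> borel_measurable (restrict_space (vol P) U)"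
proof -
  have "g_at P \<in> borel_measurable (restrict_space (vol P) U)"
    using g_at_measurable by (rule measurable_restrict_space1)
  then have "(\<lambda>p. \<xi> p \<bullet> (g_at P p *v \<xi> p)) \<in> borel_measurable (restrict_space (vol P) U)"
    using assms by (intro borel_measurable_inner borel_measurable_matrix_vector_mult)
  then show ?thesis unfolding gnorm_def ginner_def by measurable
qed

lemma lip_on_restrict_measurable:
  assumes u: "lip_on P U u" and U: "open U"
  shows "u \<in> borel_measurable (restrict_space (vol P) U)" "lip_grad P u \<in> borel_measurable (restrict_space (vol P) U)"
  unfolding restrict_vol_measurable_iff[OF U]
proof (safe)
  fix s assume s: "s \<in> maxs P"
  interpret S: riem_simplex P s using s by (rule riem_simplexI)
  show "(\<lambda>x. u (point P s x)) \<in> borel_measurable (lebesgue_on (S.chart_dom U))"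
    by (intro continuous_imp_measurable_on_sets_lebesgue S.lip_on_continuous_chart u S.chart_dom_lebesgue U)
  show "(\<lambda>x. lip_grad P u (point P s x)) \<in> borel_measurable (lebesgue_on (S.chart_dom U))"
    by (rule S.lip_grad_measurable_chart[OF u U])
qed

lemma sobolev_integrand_measurable:
  assumes U: "open U" and v: "lip_on P U v" and u: "u \<in> borel_measurable (restrict_space (vol P) U)"
    and G: "G \<in> borel_measurable (restrict_space (vol P) U)"
  shows "(\<lambda>p. ennreal ((v p - u p)\<^sup>2 + (gnorm P p (lip_grad P v p - G p))\<^sup>2) * indicator U p) \<in> borel_measurable (vol P)"
proof -
  have "(\<lambda>p. gnorm P p (lip_grad P v p - G p)) \<in> borel_measurable (restrict_space (vol P) U)"
    by (intro restrict_gnorm_measurable borel_measurable_diff lip_on_restrict_measurable v U G)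
  then have "(\<lambda>p. ennreal ((v p - u p)\<^sup>2 + (gnorm P p (lip_grad P v p - G p))\<^sup>2)) \<in> borel_measurable (restrict_space (vol P) U)"
    using lip_on_restrict_measurable(1)[OF v U] u by measurable
  then show ?thesis
    using open_sets_vol[OF U] by (subst (asm) borel_measurable_restrict_space_iff_ennreal) auto
qed

end

context riem_simplex begin

text \<open>The covector field \<open>g G\<close> is the distributional derivative of \<open>u\<close> in the chart. This holds for the
approximating Lipschitz functions by integration by parts. On a box, where the volume dominates a multiple of
Lebesgue measure, the Sobolev convergence implies convergence of the functions and of their derivatives in
\<open>L\<^sup>1\<close>, and the bumps and their derivatives are bounded.\<close>

lemma weak_gradient_on_cbox:
  assumes sg: "has_sobolev_grad P U u G" and U: "open U"
    and Q: "cbox a b \<subseteq> chart_dom U" and i: "i \<in> Basis"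
  shows "integrable (lebesgue_on (cbox a b)) (\<lambda>x. (gmat P s x *v G (point P s x)) \<bullet> i)" (is ?A)
    and "m > 0 \<Longrightarrow> box c d \<subseteq> box a b \<Longrightarrow>
      (\<integral>x. ((gmat P s x *v G (point P s x)) \<bullet> i) * bump m c d x \<partial>lebesgue_on (cbox a b))
        = - (\<integral>x. u (point P s x) * dir_deriv (bump m c d) i x \<partial>lebesgue_on (cbox a b))" (is "_ \<Longrightarrow> _ \<Longrightarrow> ?B m c d")
proof -
  let ?Q = "cbox a b" and ?M = "lebesgue_on (cbox a b)"
  define k where "k x = (gmat P s x *v G (point P s x)) \<bullet> i" for x
  have "?A \<and> (\<forall>m c d. m > 0 \<longrightarrow> box c d \<subseteq> box a b \<longrightarrow> ?B m c d)"
  proof (cases "?Q = {}")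
    case True
    have sp: "space ?M = {}" using True by (simp add: space_restrict_space)
    have "integrable ?M k \<longleftrightarrow> integrable ?M (\<lambda>_. 0::real)"
      using sp by (intro Bochner_Integration.integrable_cong) auto
    then have "integrable ?M (\<lambda>x. k x)" by simp
    moreover have "(\<integral>x. h x \<partial>?M) = 0" for h :: "real^'n \<Rightarrow> real"
      using sp by (intro integral_eq_zero_AE AE_I2) simp
    ultimately show ?thesis by (simp add: k_def)
  next
    case False
    have fin: "emeasure ?M (space ?M) < \<infinity>"
      by (simp add: emeasure_restrict_space space_restrict_space emeasure_lborel_cbox_eq)
    have Qint: "x \<in> interior (cell P s)" "point P s x \<in> U" "x \<in> cell P s" if "x \<in> ?Q" for x
      using that Q interior_subset[of "cell P s"] by (auto simp: chart_dom_def)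
    have Qcell: "?Q \<subseteq> cell P s" using Qint(3) by auto
    have um: "u \<in> borel_measurable (restrict_space (vol P) U)" and Gm: "G \<in> borel_measurable (restrict_space (vol P) U)"
      using sg by (auto simp: has_sobolev_grad_def)
    obtain v where v: "\<And>k. lip_on P U (v k)"
      and lim: "(\<lambda>k. sobolev_sq P U (\<lambda>p. v k p - u p) (\<lambda>p. lip_grad P (v k) p - G p)) \<longlonglongrightarrow> 0"
    proof -
      assume *: "\<And>v. (\<And>k. lip_on P U (v k)) \<Longrightarrow>
        (\<lambda>k. sobolev_sq P U (\<lambda>p. v k p - u p) (\<lambda>p. lip_grad P (v k) p - G p)) \<longlonglongrightarrow> 0 \<Longrightarrow> thesis"
      show thesis
        using sg unfolding has_sobolev_grad_def by (elim conjE exE) (rule *, simp_all)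
    qed
    define q where "q k x = (v k (point P s x) - u (point P s x))\<^sup>2
        + (gnorm P (point P s x) (lip_grad P (v k) (point P s x) - G (point P s x)))\<^sup>2" for k x
    have chartm: "(\<lambda>x. h (point P s x)) \<in> borel_measurable ?M"
      if "h \<in> borel_measurable (restrict_space (vol P) U)" for h :: "'a \<Rightarrow> 'z::topological_space"
    proof -
      have "(\<lambda>x. h (point P s x)) \<in> borel_measurable (lebesgue_on (chart_dom U))"
        using that smax unfolding restrict_vol_measurable_iff[OF U] by (rule bspec)
      then show ?thesis using Q by (rule measurable_restrict_mono)
    qed
    note vm = chartm[OF lip_on_restrict_measurable(1)[OF v U]]
    note gvm = chartm[OF lip_on_restrict_measurable(2)[OF v U]]
    note uom = chartm[OF um] and Gom = chartm[OF Gm]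
    have gm: "gmat P s \<in> borel_measurable ?M"
      using gmat_measurable Qcell by (rule measurable_restrict_mono)
    have km: "k \<in> borel_measurable ?M"
      unfolding k_def[abs_def] by (intro borel_measurable_inner borel_measurable_matrix_vector_mult gm Gom borel_measurable_const)
    have em: "(\<lambda>x. egrad (v k) (point P s x)) \<in> borel_measurable ?M" for k
      using egrad_measurable_chart[OF v U] Q by (rule measurable_restrict_mono)
    have qm: "q k \<in> borel_measurable ?M" for k
    proof -
      have "(\<lambda>x. gnorm P (point P s x) (lip_grad P (v k) (point P s x) - G (point P s x))) \<in> borel_measurable ?M"
        using chartm[OF restrict_gnorm_measurable[OF borel_measurable_diff[OF lip_on_restrict_measurable(2)[OF v U] Gm]]] .
      then show ?thesis unfolding q_def[abs_def] using vm uom by measurable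
    qed
    have ql: "(\<lambda>k. \<integral>\<^sup>+x. ennreal (q k x) \<partial>?M) \<longlonglongrightarrow> 0"
    proof -
      have le: "ennreal (sqrt detmin) * (\<integral>\<^sup>+x. ennreal (q k x) \<partial>?M)
          \<le> sobolev_sq P U (\<lambda>p. v k p - u p) (\<lambda>p. lip_grad P (v k) p - G p)" for k
      proof -
        have "(\<integral>\<^sup>+x. ennreal (q k x) \<partial>?M) = (\<integral>\<^sup>+x\<in>?Q. ennreal (q k x) \<partial>lebesgue)"
          by (intro nn_integral_restrict_space) simp
        also have "\<dots> = (\<integral>\<^sup>+x\<in>?Q. ennreal ((v k (point P s x) - u (point P s x))\<^sup>2
            + (gnorm P (point P s x) (lip_grad P (v k) (point P s x) - G (point P s x)))\<^sup>2) * indicator U (point P s x) \<partial>lebesgue)"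
          by (intro nn_integral_cong) (auto simp: q_def Qint split: split_indicator)
        finally show ?thesis
          using nn_integral_chart_le[OF sobolev_integrand_measurable[OF U v um Gm] Qcell, of k]
          unfolding sobolev_sq_def by simp
      qed
      have "(\<lambda>k. ennreal (sqrt detmin) * (\<integral>\<^sup>+x. ennreal (q k x) \<partial>?M)) \<longlonglongrightarrow> 0"
        by (rule tendsto_sandwich[OF _ _ tendsto_const lim]) (auto simp: le)
      then have "(\<lambda>k. ennreal (1 / sqrt detmin) * (ennreal (sqrt detmin) * (\<integral>\<^sup>+x. ennreal (q k x) \<partial>?M))) \<longlonglongrightarrow> ennreal (1 / sqrt detmin) * 0"
        by (intro ennreal_tendsto_cmult) auto
      moreover have "ennreal (1 / sqrt detmin) * (ennreal (sqrt detmin) * y) = y" for y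
        using detmin_pos by (simp add: mult.assoc[symmetric] ennreal_mult'[symmetric])
      ultimately show ?thesis by simp
    qed
    have FormsAE: "AE x in ?M. gmat P s x \<in> Forms"
      using negligible_subset[OF gmat_Forms_AE, of "{x \<in> ?Q. gmat P s x \<notin> Forms}"] Qcell
      by (subst AE_lebesgue_on_iff_negligible) auto
    have e1: "AE x in ?M. (egrad (v n) (point P s x) \<bullet> i - k x)\<^sup>2 \<le> Lam\<^sup>2 * q n x" for n
      using FormsAE AE_space
    proof eventually_elim
      case (elim x)
      let ?A = "gmat P s x" and ?p = "point P s x"
      have x: "x \<in> ?Q" using elim(2) by (simp add: space_restrict_space)
      have gA: "g_at P ?p = ?A" using g_at_point Qint(1)[OF x] by blast
      define e where "e = lip_grad P (v n) ?p - G ?p"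
      have "egrad (v n) ?p \<bullet> i - k x = i \<bullet> (?A *v e)"
        unfolding e_def k_def lip_grad_egrad gA
        by (simp add: matrix_vector_mult_diff_distrib matrix_inv_mult_vector(1)[OF Forms_det_nonzero[OF elim(1)]]
            inner_diff inner_commute)
      then have "(egrad (v n) ?p \<bullet> i - k x)\<^sup>2 \<le> (i \<bullet> (?A *v i)) * (e \<bullet> (?A *v e))"
        using Forms_Cauchy_Schwarz[OF elim(1), of i e] by simp
      also have "\<dots> \<le> Lam\<^sup>2 * (e \<bullet> (?A *v e))"
      proof (rule mult_right_mono)
        have "i \<bullet> (?A *v i) \<le> Lam\<^sup>2 * (norm i)\<^sup>2" using elim(1) by (simp add: bounded_forms_def)
        then show "i \<bullet> (?A *v i) \<le> Lam\<^sup>2" using i by simp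
      qed (rule Forms_nonneg[OF elim(1)])
      also have "e \<bullet> (?A *v e) = (gnorm P ?p e)\<^sup>2"
        using gnorm_square[of ?p e] elim(1) gA by (simp add: ginner_def)
      also have "Lam\<^sup>2 * (gnorm P ?p e)\<^sup>2 \<le> Lam\<^sup>2 * q n x"
        by (intro mult_left_mono) (auto simp: q_def e_def)
      finally show ?case .
    qed
    have e1m: "(\<lambda>x. egrad (v n) (point P s x) \<bullet> i - k x) \<in> borel_measurable ?M" for n
      using em km by measurable
    note E1 = L1_tendsto_zero_if_L2[OF fin e1m e1 _ ql qm, simplified]
    have e2: "AE x in ?M. (v n (point P s x) - u (point P s x))\<^sup>2 \<le> 1 * q n x" for n
      by (intro AE_I2) (simp add: q_def)
    have e2m: "(\<lambda>x. v n (point P s x) - u (point P s x)) \<in> borel_measurable ?M" for n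
      using vm uom by measurable
    note E2 = L1_tendsto_zero_if_L2[OF fin e2m e2 _ ql qm, simplified]
    have "\<forall>n. \<exists>L F. L-lipschitz_on UNIV F \<and> (\<forall>x\<in>?Q. F x = v n (point P s x))"
      using lip_on_cbox_extension[OF v Q False] by (rule allI)
    from choice[OF this] obtain L :: "nat \<Rightarrow> real" where "\<forall>n. \<exists>F. (L n)-lipschitz_on UNIV F \<and> (\<forall>x\<in>?Q. F x = v n (point P s x))"
      by (rule exE)
    from choice[OF this] obtain F where F0: "\<forall>n. (L n)-lipschitz_on UNIV (F n) \<and> (\<forall>x\<in>?Q. F n x = v n (point P s x))"
      by (rule exE)
    have F: "(L n)-lipschitz_on UNIV (F n)" "x \<in> ?Q \<Longrightarrow> F n x = v n (point P s x)" for n x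
      using F0 by simp_all
    have FAE: "AE x in ?M. egrad (v n) (point P s x) \<bullet> i = dir_deriv (F n) i x" for n
    proof -
      have "AE x in ?M. differentiable_pt (v n) (point P s x) \<and>
          egrad (v n) (point P s x) = (\<Sum>j\<in>Basis. dir_deriv (F n) j x *\<^sub>R j)"
        unfolding AE_lebesgue_on_iff_negligible[OF lmeasurable_cbox[THEN fmeasurableD]]
        by (rule egrad_on_cbox[OF F Q])
      then show ?thesis by eventually_elim (simp add: i inner_sum_left_Basis)
    qed
    have Mcont: "h \<in> borel_measurable ?M" if "h \<in> borel_measurable borel" for h :: "real^'n \<Rightarrow> real"
      using that by (intro measurable_restrict_space1 measurable_completion) simp
    have AEM: "AE x in ?M. R x" if "AE x in lborel. R x" for R
      using AE_completion[OF that] by (simp add: AE_restrict_space_iff) (auto elim: eventually_mono)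
    have int_e: "integrable ?M (\<lambda>x. egrad (v n) (point P s x) \<bullet> i)" for n
    proof (rule integrable_AE_bounded_finite[OF fin])
      show "(\<lambda>x. egrad (v n) (point P s x) \<bullet> i) \<in> borel_measurable ?M" using em by measurable
      have "AE x in ?M. \<bar>dir_deriv (F n) i x\<bar> \<le> L n * norm i"
        using lipschitz_has_dir_deriv_AE[OF F(1), where v=i] by (intro AEM) (rule eventually_mono, auto)
      with FAE[of n] show "AE x in ?M. \<bar>egrad (v n) (point P s x) \<bullet> i\<bar> \<le> L n * norm i"
        by eventually_elim simp
    qed
    have int_v: "integrable ?M (\<lambda>x. v n (point P s x))" for n
    proof -
      have "compact (F n ` ?Q)"
        by (intro compact_continuous_image compact_cbox continuous_on_subset[OF lipschitz_on_continuous_on[OF F(1)]]) auto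
      then obtain B where "\<forall>y\<in>F n ` ?Q. \<bar>y\<bar> \<le> B"
        using compact_imp_bounded[of "F n ` ?Q"] unfolding bounded_iff real_norm_def by blast
      then have "\<forall>x\<in>?Q. \<bar>v n (point P s x)\<bar> \<le> B" using F(2) by auto
      then show ?thesis
        by (intro integrable_AE_bounded_finite[OF fin vm, of _ B] AE_I2) (simp add: space_restrict_space)
    qed
    have int_k: "integrable ?M k"
    proof -
      have "\<forall>\<^sub>F n in sequentially. (\<integral>\<^sup>+x. ennreal \<bar>egrad (v n) (point P s x) \<bullet> i - k x\<bar> \<partial>?M) < 1"
        using E1 by (rule order_tendstoD) simp
      then obtain n where "(\<integral>\<^sup>+x. ennreal \<bar>egrad (v n) (point P s x) \<bullet> i - k x\<bar> \<partial>?M) < 1"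
        by (auto simp: eventually_sequentially)
      then show ?thesis
        by (intro integrable_if_L1_close[OF int_e km]) (auto intro: less_trans)
    qed
    have int_u: "integrable ?M (\<lambda>x. u (point P s x))"
    proof -
      have "\<forall>\<^sub>F n in sequentially. (\<integral>\<^sup>+x. ennreal \<bar>v n (point P s x) - u (point P s x)\<bar> \<partial>?M) < 1"
        using E2 by (rule order_tendstoD) simp
      then obtain n where "(\<integral>\<^sup>+x. ennreal \<bar>v n (point P s x) - u (point P s x)\<bar> \<partial>?M) < 1"
        by (auto simp: eventually_sequentially)
      then show ?thesis
        by (intro integrable_if_L1_close[OF int_v uom]) (auto intro: less_trans)
    qed
    have "?B m c d" if m: "m > 0" and cd: "box c d \<subseteq> box a b" for m c d
    proof -
      let ?\<phi> = "bump m c d" and ?d\<phi> = "dir_deriv (bump m c d) i"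
      have \<phi>b: "?\<phi> \<in> borel_measurable borel"
        using lipschitz_on_continuous_on[OF bump_lipschitz] by (rule borel_measurable_continuous_onI)
      have d\<phi>b: "?d\<phi> \<in> borel_measurable borel"
        by (intro dir_deriv_measurable lipschitz_on_continuous_on[OF bump_lipschitz])
      have out: "?\<phi> x = 0" if "x \<notin> ?Q" for x
        using that cd box_subset_cbox[of a b] by (intro bump_outside[OF _ m]) auto
      have dout: "?d\<phi> x = 0" if "x \<notin> ?Q" for x
        by (rule dir_deriv_eq_0_on_open[of "- ?Q"]) (use that out in \<open>auto simp: closed_cbox open_Compl\<close>)
      have l1: "(\<lambda>n. \<integral>x. (egrad (v n) (point P s x) \<bullet> i) * ?\<phi> x \<partial>?M) \<longlonglongrightarrow> (\<integral>x. k x * ?\<phi> x \<partial>?M)"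
        by (rule L1_limit_times_bounded[OF int_e int_k E1 Mcont[OF \<phi>b], of 1])
           (auto simp: bump_bounds abs_of_nonneg)
      have dbd: "AE x in ?M. \<bar>?d\<phi> x\<bar> \<le> (\<Sum>i\<in>(Basis::(real^'n) set). 2 * \<bar>m\<bar>) * norm i"
        using lipschitz_has_dir_deriv_AE[OF bump_lipschitz[of m c d], of i] by (intro AEM) (rule eventually_mono, auto)
      have l2: "(\<lambda>n. \<integral>x. v n (point P s x) * ?d\<phi> x \<partial>?M) \<longlonglongrightarrow> (\<integral>x. u (point P s x) * ?d\<phi> x \<partial>?M)"
        by (rule L1_limit_times_bounded[OF int_v int_u E2 Mcont[OF d\<phi>b] dbd])
      have ibp: "(\<integral>x. (egrad (v n) (point P s x) \<bullet> i) * ?\<phi> x \<partial>?M) = - (\<integral>x. v n (point P s x) * ?d\<phi> x \<partial>?M)" for n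
      proof -
        have Fb: "F n \<in> borel_measurable borel" "dir_deriv (F n) i \<in> borel_measurable borel"
          using lipschitz_on_continuous_on[OF F(1)] by (auto intro: borel_measurable_continuous_onI dir_deriv_measurable)
        have "(\<integral>x. (egrad (v n) (point P s x) \<bullet> i) * ?\<phi> x \<partial>?M) = (\<integral>x. dir_deriv (F n) i x * ?\<phi> x \<partial>?M)"
        proof (rule integral_cong_AE)
          show "(\<lambda>x. (egrad (v n) (point P s x) \<bullet> i) * ?\<phi> x) \<in> borel_measurable ?M"
            using em Mcont[OF \<phi>b] by measurable
          show "(\<lambda>x. dir_deriv (F n) i x * ?\<phi> x) \<in> borel_measurable ?M"
            using Fb(2) \<phi>b by (intro Mcont) measurable
        qed (use FAE[of n] in \<open>eventually_elim, simp\<close>)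
        also have "\<dots> = (\<integral>x. dir_deriv (F n) i x * ?\<phi> x \<partial>lborel)"
          using Fb \<phi>b out by (intro integral_lborel_eq_lebesgue_on[symmetric]) auto
        also have "\<dots> = - (\<integral>x. F n x * ?d\<phi> x \<partial>lborel)"
          by (rule dir_deriv_bump_ibp[OF F(1) m])
        also have "(\<integral>x. F n x * ?d\<phi> x \<partial>lborel) = (\<integral>x. F n x * ?d\<phi> x \<partial>?M)"
          using Fb d\<phi>b dout by (intro integral_lborel_eq_lebesgue_on) auto
        also have "\<dots> = (\<integral>x. v n (point P s x) * ?d\<phi> x \<partial>?M)"
          by (intro Bochner_Integration.integral_cong) (auto simp: space_restrict_space F(2))
        finally show ?thesis .
      qed
      have "(\<lambda>n. - (\<integral>x. v n (point P s x) * ?d\<phi> x \<partial>?M)) \<longlonglongrightarrow> - (\<integral>x. u (point P s x) * ?d\<phi> x \<partial>?M)"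
        using l2 by (rule tendsto_minus)
      with l1[unfolded ibp] show ?thesis unfolding k_def[symmetric] by (rule LIMSEQ_unique)
    qed
    with int_k show ?thesis unfolding k_def[symmetric] by simp
  qed
  then show ?A "m > 0 \<Longrightarrow> box c d \<subseteq> box a b \<Longrightarrow> ?B m c d" by simp_all
qed

text \<open>By the previous lemma the difference of the two covector fields is orthogonal to all bumps, and the
metric is invertible.\<close>

lemma weak_gradient_unique_on_cbox:
  assumes G: "has_sobolev_grad P U u G" "open U" and H: "has_sobolev_grad P V u H" "open V"
    and Q: "cbox a b \<subseteq> chart_dom U" "cbox a b \<subseteq> chart_dom V"
  shows "negligible {x \<in> cbox a b. G (point P s x) \<noteq> H (point P s x)}"
proof -
  let ?M = "lebesgue_on (cbox a b)"
  define D where "D x = gmat P s x *v G (point P s x) - gmat P s x *v H (point P s x)" for x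
  have "AE x in ?M. x \<in> box a b \<longrightarrow> D x \<bullet> i = 0" if i: "i \<in> Basis" for i
  proof -
    note G1 = weak_gradient_on_cbox[OF G Q(1) i] and H1 = weak_gradient_on_cbox[OF H Q(2) i]
    let ?h = "\<lambda>x. D x \<bullet> i"
    have hint: "integrable ?M ?h"
      using Bochner_Integration.integrable_diff[OF G1(1) H1(1)] by (simp add: D_def inner_diff_left)
    have "integrable lebesgue (\<lambda>x. indicator (cbox a b) x *\<^sub>R ?h x)"
      using hint by (subst (asm) integrable_restrict_space) auto
    then have hi: "integrable lebesgue (\<lambda>x. indicator (cbox a b) x * ?h x)" by simp
    from completion_ex_borel_measurable_real[OF borel_measurable_integrable[OF this]]
    obtain h' where h': "h' \<in> borel_measurable lborel" "AE x in lborel. indicator (cbox a b) x * ?h x = h' x"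
      by (rule bexE)
    have AE': "AE x in lebesgue. indicator (cbox a b) x * ?h x = h' x" by (rule AE_completion[OF h'(2)])
    have h'm: "h' \<in> borel_measurable lebesgue" using h'(1) by (intro measurable_completion) simp
    have "integrable lebesgue h'"
      using hi h'm AE' by (subst integrable_cong_AE[symmetric]) (auto intro: borel_measurable_integrable)
    then have h'int: "integrable lborel h'" using h'(1) by (simp add: integrable_completion)
    have "AE x in lborel. x \<in> box a b \<longrightarrow> h' x = 0"
    proof (rule AE_zero_if_orthogonal_to_bumps)
      show "integrable lborel (\<lambda>x. indicator (box a b) x * h' x)"
        using integrable_mult_indicator[OF _ h'int, of "box a b"] by simp
    next
      fix m :: real and c d :: "real^'n" assume m: "m > 0" and cd: "box c d \<subseteq> box a b"
      let ?\<phi> = "bump m c d"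
      have \<phi>b: "?\<phi> \<in> borel_measurable borel"
        using lipschitz_on_continuous_on[OF bump_lipschitz] by (rule borel_measurable_continuous_onI)
      have \<phi>l: "?\<phi> \<in> borel_measurable lebesgue" using \<phi>b by (intro measurable_completion) simp
      have \<phi>M: "?\<phi> \<in> borel_measurable ?M" using \<phi>l by (rule measurable_restrict_space1)
      have "(\<integral>x. h' x * ?\<phi> x \<partial>lborel) = (\<integral>x. h' x * ?\<phi> x \<partial>lebesgue)"
        using h'(1) \<phi>b by (intro integral_completion[symmetric]) simp
      also have "\<dots> = (\<integral>x. (indicator (cbox a b) x * ?h x) * ?\<phi> x \<partial>lebesgue)"
      proof (rule integral_cong_AE)
        show "(\<lambda>x. h' x * ?\<phi> x) \<in> borel_measurable lebesgue"
          by (intro borel_measurable_times h'm \<phi>l)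
        show "(\<lambda>x. indicator (cbox a b) x * ?h x * ?\<phi> x) \<in> borel_measurable lebesgue"
          by (intro borel_measurable_times[OF borel_measurable_integrable[OF hi] \<phi>l])
      qed (use AE' in \<open>eventually_elim, simp\<close>)
      also have "\<dots> = (\<integral>x. ?h x * ?\<phi> x \<partial>?M)"
        by (subst integral_restrict_space) (auto simp: mult.assoc)
      also have "\<dots> = (\<integral>x. ((gmat P s x *v G (point P s x)) \<bullet> i) * ?\<phi> x - ((gmat P s x *v H (point P s x)) \<bullet> i) * ?\<phi> x \<partial>?M)"
        by (intro Bochner_Integration.integral_cong) (auto simp: D_def inner_diff_left left_diff_distrib)
      also have "\<dots> = (\<integral>x. ((gmat P s x *v G (point P s x)) \<bullet> i) * ?\<phi> x \<partial>?M) - (\<integral>x. ((gmat P s x *v H (point P s x)) \<bullet> i) * ?\<phi> x \<partial>?M)"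
        by (intro Bochner_Integration.integral_diff integrable_mult_AE_bounded[of _ _ _ 1] G1(1) H1(1) \<phi>M)
           (auto simp: bump_bounds abs_of_nonneg)
      also have "\<dots> = 0" unfolding G1(2)[OF m cd] H1(2)[OF m cd] by simp
      finally show "(\<integral>x. h' x * ?\<phi> x \<partial>lborel) = 0" .
    qed
    then have "AE x in lebesgue. x \<in> box a b \<longrightarrow> h' x = 0" by (rule AE_completion)
    with AE' have "AE x in lebesgue. x \<in> box a b \<longrightarrow> ?h x = 0"
    proof eventually_elim
      case (elim x)
      show ?case
      proof
        assume x: "x \<in> box a b"
        then have "x \<in> cbox a b" using box_subset_cbox by blast
        then show "?h x = 0" using elim x by simp
      qed
    qed
    then show ?thesis by (subst AE_restrict_space_iff) (auto elim: eventually_mono)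
  qed
  then have "AE x in ?M. \<forall>i\<in>Basis. x \<in> box a b \<longrightarrow> D x \<bullet> i = 0"
    by (subst AE_finite_all) auto
  then have n1: "negligible {x \<in> cbox a b. \<not> (\<forall>i\<in>Basis. x \<in> box a b \<longrightarrow> D x \<bullet> i = 0)}"
    by (subst (asm) AE_lebesgue_on_iff_negligible) auto
  have n2: "negligible (cbox a b - box a b)"
    using negligible_convex_frontier[of "cbox a b"] by (simp add: frontier_cbox)
  show ?thesis
  proof (rule negligible_subset[OF negligible_Un[OF negligible_Un[OF n1 n2] gmat_Forms_AE]], intro subsetI)
    fix x assume x: "x \<in> {x \<in> cbox a b. G (point P s x) \<noteq> H (point P s x)}"
    then have xc: "x \<in> cell P s" using Q(1) interior_subset[of "cell P s"] by (auto simp: chart_dom_def)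
    show "x \<in> {x \<in> cbox a b. \<not> (\<forall>i\<in>Basis. x \<in> box a b \<longrightarrow> D x \<bullet> i = 0)} \<union> (cbox a b - box a b) \<union>
        {x \<in> cell P s. gmat P s x \<notin> Forms}"
    proof (rule ccontr)
      assume "x \<notin> {x \<in> cbox a b. \<not> (\<forall>i\<in>Basis. x \<in> box a b \<longrightarrow> D x \<bullet> i = 0)} \<union> (cbox a b - box a b) \<union>
        {x \<in> cell P s. gmat P s x \<notin> Forms}"
      then have F: "gmat P s x \<in> Forms" and D0: "\<forall>i\<in>Basis. D x \<bullet> i = 0" using x xc by auto
      have "D x = 0" using D0 by (subst euclidean_eq_iff) simp
      then have "gmat P s x *v (G (point P s x) - H (point P s x)) = 0"
        by (simp add: D_def matrix_vector_mult_diff_distrib)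
      then have "(G (point P s x) - H (point P s x)) \<bullet> (gmat P s x *v (G (point P s x) - H (point P s x))) = 0"
        by simp
      then have "G (point P s x) - H (point P s x) = 0" by (rule Forms_definite[OF F])
      then show False using x by simp
    qed
  qed
qed

lemma weak_gradient_unique:
  assumes G: "has_sobolev_grad P U u G" "open U" and H: "has_sobolev_grad P V u H" "open V"
  shows "negligible {x \<in> chart_dom (U \<inter> V). G (point P s x) \<noteq> H (point P s x)}"
proof -
  have "open (chart_dom (U \<inter> V))" using G(2) H(2) by (intro open_chart_dom open_Int)
  from open_countable_union_cboxes[OF this]
  obtain D where D: "countable D" "\<forall>Q\<in>D. \<exists>a b. Q = cbox a b \<and> cbox a b \<subseteq> chart_dom (U \<inter> V)" "\<Union>D = chart_dom (U \<inter> V)"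
    by (elim exE conjE)
  have "negligible {x \<in> Q. G (point P s x) \<noteq> H (point P s x)}" if Qd: "Q \<in> D" for Q
  proof -
    obtain a b where Q: "Q = cbox a b" "cbox a b \<subseteq> chart_dom (U \<inter> V)" using bspec[OF D(2) Qd] by (elim exE conjE)
    have "cbox a b \<subseteq> chart_dom U" "cbox a b \<subseteq> chart_dom V" using Q(2) by (auto simp: chart_dom_def)
    from weak_gradient_unique_on_cbox[OF G H this] show ?thesis unfolding Q(1) .
  qed
  then have "negligible (\<Union>Q\<in>D. {x \<in> Q. G (point P s x) \<noteq> H (point P s x)})"
    using D(1) by (intro negligible_countable_Union) auto
  then show ?thesis by (rule negligible_subset) (use D(3) in auto)
qed

abbreviation "open_simplex \<equiv> {p. carrier_simplex P p = s}"

lemma chart_dom_open_simplex: "chart_dom open_simplex = interior (cell P s)"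
  using carrier_point_interior by (auto simp: chart_dom_def)

lemma open_simplex_domain: "rel_compact_domain open_simplex"
  unfolding rel_compact_domain_def
proof (intro conjI)
  show "open open_simplex" by (rule open_open_simplex[OF smax])
  show "connected open_simplex"
    unfolding open_simplex_image
    by (intro connected_continuous_image continuous_on_subset[OF continuous_point interior_subset]
        convex_connected convex_interior convex_cell)
  have K: "compact (point P s ` cell P s)"
    by (intro compact_continuous_image continuous_point compact_cell)
  have "closure open_simplex \<subseteq> point P s ` cell P s"
    unfolding open_simplex_image using interior_subset[of "cell P s"]
    by (intro closure_minimal image_mono compact_imp_closed K)
  then show "compact (closure open_simplex)"
    using compact_Int_closed[OF K closed_closure[of open_simplex]] by (simp add: Int_absorb1)
qed

end

context riem_poly begin

lemma has_sobolev_grad_cong_AE: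
  assumes U: "open U" and G: "has_sobolev_grad P U u G"
    and eq: "\<And>s. s \<in> maxs P \<Longrightarrow> negligible {x \<in> riem_simplex.chart_dom P s U. H (point P s x) \<noteq> G (point P s x)}"
  shows "has_sobolev_grad P U u H"
proof -
  have um: "u \<in> borel_measurable (restrict_space (vol P) U)" and Gm: "G \<in> borel_measurable (restrict_space (vol P) U)"
    using G by (auto simp: has_sobolev_grad_def)
  have Hm: "H \<in> borel_measurable (restrict_space (vol P) U)"
    unfolding restrict_vol_measurable_iff[OF U]
  proof
    fix s assume s: "s \<in> maxs P"
    interpret S: riem_simplex P s using s by (rule riem_simplexI)
    have "(\<lambda>x. G (point P s x)) \<in> borel_measurable (lebesgue_on (S.chart_dom U))"
      using Gm s unfolding restrict_vol_measurable_iff[OF U] by (rule bspec)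
    then show "(\<lambda>x. H (point P s x)) \<in> borel_measurable (lebesgue_on (S.chart_dom U))"
      by (rule measurable_lebesgue_on_negligible_cong[OF S.chart_dom_lebesgue[OF U] _ eq[OF s]])
  qed
  have "AE p in vol P. p \<in> U \<longrightarrow> H p = G p"
    unfolding AE_vol_iff
  proof
    fix s assume s: "s \<in> maxs P"
    interpret S: riem_simplex P s using s by (rule riem_simplexI)
    show "negligible {x \<in> interior (cell P s). \<not> (point P s x \<in> U \<longrightarrow> H (point P s x) = G (point P s x))}"
      using eq[OF s] by (rule negligible_subset) (auto simp: S.chart_dom_def)
  qed
  then have "sobolev_sq P U v (\<lambda>p. w p - H p) = sobolev_sq P U v (\<lambda>p. w p - G p)" for v w
    unfolding sobolev_sq_def
    by (intro nn_integral_cong_AE) (auto elim!: eventually_mono split: split_indicator)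
  then show ?thesis using G um Hm unfolding has_sobolev_grad_def by simp
qed

text \<open>A single vector field serves all domains: on each open maximal simplex take the gradient on this simplex.
By uniqueness it agrees almost everywhere with the gradient on any other domain, and the remaining points
form a null set.\<close>

lemma loc_grad_sobolev:
  assumes f: "f \<in> W12_loc P"
  shows "\<forall>U. rel_compact_domain U \<longrightarrow> has_sobolev_grad P U f (loc_grad P f)"
proof -
  let ?O = "\<lambda>s. {p. carrier_simplex P p = s}"
  have ex: "has_sobolev_grad P U f (sobolev_grad P U f)" if "rel_compact_domain U" for U
  proof -
    have "f \<in> W12 P U" using f that by (simp add: W12_loc_def)
    then show ?thesis unfolding W12_def sobolev_grad_def mem_Collect_eq by (rule someI_ex)
  qed
  define G where "G p = sobolev_grad P (?O (carrier_simplex P p)) f p" for p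
  have "has_sobolev_grad P U f G" if U: "rel_compact_domain U" for U
  proof (rule has_sobolev_grad_cong_AE[OF _ ex[OF U]])
    show oU: "open U" using U by (simp add: rel_compact_domain_def)
    fix s assume s: "s \<in> maxs P"
    interpret S: riem_simplex P s using s by (rule riem_simplexI)
    have "negligible {x \<in> S.chart_dom (?O s \<inter> U). sobolev_grad P (?O s) f (point P s x) \<noteq> sobolev_grad P U f (point P s x)}"
      by (rule S.weak_gradient_unique[OF ex[OF S.open_simplex_domain] open_open_simplex[OF s] ex[OF U] oU])
    then show "negligible {x \<in> S.chart_dom U. G (point P s x) \<noteq> sobolev_grad P U f (point P s x)}"
      by (rule negligible_subset) (auto simp: S.chart_dom_def G_def S.carrier_point_interior)
  qed
  then have "\<exists>G. \<forall>U. rel_compact_domain U \<longrightarrow> has_sobolev_grad P U f G" by (intro exI[of _ G]) simp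
  from someI_ex[OF this] show ?thesis unfolding loc_grad_def .
qed

lemma loc_grad_measurable:
  assumes f: "f \<in> W12_loc P"
  shows "loc_grad P f \<in> borel_measurable (vol P)"
proof (rule measurable_vol_interiorI)
  fix s assume s: "s \<in> maxs P"
  interpret S: riem_simplex P s using s by (rule riem_simplexI)
  have "has_sobolev_grad P S.open_simplex f (loc_grad P f)"
    using loc_grad_sobolev[OF f] S.open_simplex_domain by simp
  then have "loc_grad P f \<in> borel_measurable (restrict_space (vol P) S.open_simplex)"
    by (simp add: has_sobolev_grad_def)
  then have "(\<lambda>x. loc_grad P f (point P s x)) \<in> borel_measurable (lebesgue_on (S.chart_dom S.open_simplex))"
    using s unfolding restrict_vol_measurable_iff[OF open_open_simplex[OF s]] by (rule bspec)
  then show "(\<lambda>x. loc_grad P f (point P s x)) \<in> borel_measurable (lebesgue_on (interior (cell P s)))"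
    unfolding S.chart_dom_open_simplex .
qed

end

section \<open>Cutoff functions and test functions\<close>

definition clamp01 :: "real \<Rightarrow> real" where "clamp01 t = min 1 (max 0 t)"

lemma clamp01_bounds: "0 \<le> clamp01 t" "clamp01 t \<le> 1"
  by (auto simp: clamp01_def)

lemma clamp01_lipschitz: "\<bar>clamp01 s - clamp01 t\<bar> \<le> \<bar>s - t\<bar>"
  by (auto simp: clamp01_def min_def max_def)

lemma measurable_restrict_space_UNIV:
  "h \<in> borel_measurable (restrict_space M UNIV) \<longleftrightarrow> h \<in> borel_measurable M"
  by (rule arg_cong[where f="\<lambda>A. h \<in> A"], rule measurable_cong_sets) (simp_all add: sets_restrict_space)

text \<open>Convergence of \<open>w\<^sub>k\<close> to \<open>1\<close> in \<open>L\<^sup>2(D)\<close> gives convergence almost everywhere along a subsequence, and \<open>\<bar>T\<bar>\<close>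
dominates.\<close>

lemma cutoff_limit:
  assumes D: "D \<in> sets M" and w: "\<And>k. w k \<in> borel_measurable M" "\<And>k p. 0 \<le> w k p \<and> w k p \<le> 1"
    and lim: "(\<lambda>k. \<integral>\<^sup>+p. ennreal (indicator D p * (1 - w k p)\<^sup>2) \<partial>M) \<longlonglongrightarrow> 0"
    and le: "\<And>k. (\<integral>\<^sup>+p. ennreal (indicator D p * (1 - w k p)\<^sup>2) \<partial>M) < \<infinity>"
    and T: "integrable M T" "AE p in M. p \<notin> D \<longrightarrow> T p = (0::real)"
  shows "\<exists>r. strict_mono r \<and> (\<lambda>k. \<integral>p. T p * w (r k) p \<partial>M) \<longlonglongrightarrow> (\<integral>p. T p \<partial>M)"
proof -
  let ?u = "\<lambda>k p. indicator D p * (1 - w k p)\<^sup>2"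
  have um: "?u k \<in> borel_measurable M" for k using D w(1) by measurable
  have u0: "norm (?u k p) = ?u k p" for k p by simp
  have ui: "integrable M (?u k)" for k
    using um le[of k] by (intro integrableI_bounded) (simp_all only: u0)
  have "(\<lambda>k. \<integral>p. norm (?u k p) \<partial>M) \<longlonglongrightarrow> 0"
  proof -
    have "(\<integral>p. norm (?u k p) \<partial>M) = enn2real (\<integral>\<^sup>+p. ennreal (?u k p) \<partial>M)" for k
      unfolding u0 using um by (intro integral_eq_nn_integral) auto
    moreover have "(\<lambda>k. enn2real (\<integral>\<^sup>+p. ennreal (?u k p) \<partial>M)) \<longlonglongrightarrow> enn2real 0"
      using lim by (intro tendsto_enn2real) auto
    ultimately show ?thesis by simp
  qed
  from tendsto_L1_AE_subseq[OF ui this]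
  obtain r where r: "strict_mono r" "AE p in M. (\<lambda>k. ?u (r k) p) \<longlonglongrightarrow> 0" by (elim exE conjE)
  have "(\<lambda>k. \<integral>p. T p * w (r k) p \<partial>M) \<longlonglongrightarrow> (\<integral>p. T p \<partial>M)"
  proof (rule integral_dominated_convergence[where w="\<lambda>p. \<bar>T p\<bar>"])
    show "T \<in> borel_measurable M" using T(1) by (rule borel_measurable_integrable)
    show "(\<lambda>p. T p * w (r k) p) \<in> borel_measurable M" for k
      by (intro borel_measurable_times borel_measurable_integrable[OF T(1)] w(1))
    show "integrable M (\<lambda>p. \<bar>T p\<bar>)" using T(1) by simp
    show "AE p in M. norm (T p * w (r k) p) \<le> \<bar>T p\<bar>" for k
      by (intro AE_I2) (use w(2) in \<open>simp add: abs_mult abs_of_nonneg mult_left_le\<close>)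
    show "AE p in M. (\<lambda>k. T p * w (r k) p) \<longlonglongrightarrow> T p"
      using r(2) T(2)
    proof eventually_elim
      case (elim p)
      show ?case
      proof (cases "p \<in> D")
        case True
        then have "(\<lambda>k. (1 - w (r k) p)\<^sup>2) \<longlonglongrightarrow> 0" using elim(1) by simp
        from tendsto_real_sqrt[OF this] have "(\<lambda>k. 1 - w (r k) p) \<longlonglongrightarrow> 0"
          using w(2) by (simp add: abs_of_nonneg)
        from tendsto_diff[OF tendsto_const[of 1] this] have "(\<lambda>k. w (r k) p) \<longlonglongrightarrow> 1" by simp
        from tendsto_mult[OF tendsto_const[of "T p"] this] show ?thesis by simp
      qed (use elim(2) in simp)
    qed
  qed
  with r(1) show ?thesis by (intro exI[of _ r] conjI)
qed

context riem_poly begin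

text \<open>The support meets finitely many closed simplexes, and the function is continuous in the charts of each.
The bound is made positive for later use as a factor.\<close>

lemma Lip_c_bounded:
  assumes \<rho>: "\<rho> \<in> Lip_c P UNIV"
  shows "\<exists>M>0. \<forall>p. \<bar>\<rho> p\<bar> \<le> M"
proof -
  let ?D = "closure {p. \<rho> p \<noteq> 0}"
  have lip: "lip_on P UNIV \<rho>" and D: "compact ?D" using \<rho> by (auto simp: Lip_c_def)
  let ?near = "\<lambda>W. {s \<in> cplx P. \<exists>q\<in>W. carrier_simplex P q \<subseteq> s}"
  have "\<forall>p\<in>?D. \<exists>W. open W \<and> p \<in> W \<and> finite (?near W)"
    using locally_finitely_many_simplexes by (intro ballI)
  from bchoice[OF this] obtain W where W: "\<forall>p\<in>?D. open (W p) \<and> p \<in> W p \<and> finite (?near (W p))"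
    by (rule exE)
  have Wo: "open (W p)" and Wp: "p \<in> W p" and Wf: "finite (?near (W p))" if "p \<in> ?D" for p
    using bspec[OF W that] by simp_all
  have "?D \<subseteq> (\<Union>p\<in>?D. W p)" using Wp by auto
  from compactE_image[OF D Wo this]
  obtain C where C: "C \<subseteq> ?D" "finite C" "?D \<subseteq> (\<Union>p\<in>C. W p)" by auto
  let ?T = "maxs P \<inter> (\<Union>p\<in>C. ?near (W p))"
  have "finite (\<Union>p\<in>C. ?near (W p))" using C Wf by (intro finite_UN_I) auto
  then have fT: "finite ?T" by simp
  have cover: "?D \<subseteq> (\<Union>s\<in>?T. closed_simplex P s)"
  proof
    fix q assume q: "q \<in> ?D"
    obtain s where s: "s \<in> maxs P" "carrier_simplex P q \<subseteq> s" using in_some_maximal_simplex by (rule bexE)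
    obtain p where p: "p \<in> C" "q \<in> W p" using C(3) q by auto
    have "s \<in> ?near (W p)" using s p(2) maxs_cplx by auto
    then have "s \<in> ?T" using s(1) p(1) by auto
    then show "q \<in> (\<Union>s\<in>?T. closed_simplex P s)" using s(2) by (intro UN_I) (auto simp: closed_simplex_def)
  qed
  have bs: "bounded (\<rho> ` closed_simplex P s)" if s: "s \<in> maxs P" for s
  proof -
    interpret S: riem_simplex P s using s by (rule riem_simplexI)
    obtain L where L: "L \<ge> 0" "\<forall>x\<in>cell P s. \<forall>y\<in>cell P s. point P s x \<in> UNIV \<longrightarrow> point P s y \<in> UNIV \<longrightarrow>
       \<bar>\<rho> (point P s x) - \<rho> (point P s y)\<bar> \<le> L * dist x y"
      using S.lip_on_chart_lipschitz[OF lip] by (elim exE conjE)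
    have "L-lipschitz_on (cell P s) (\<lambda>x. \<rho> (point P s x))"
      using L by (intro lipschitz_onI) (auto simp: dist_real_def)
    then have "compact ((\<lambda>x. \<rho> (point P s x)) ` cell P s)"
      by (intro compact_continuous_image S.compact_cell lipschitz_on_continuous_on)
    then have "bounded ((\<lambda>x. \<rho> (point P s x)) ` cell P s)" by (rule compact_imp_bounded)
    moreover have "\<rho> ` closed_simplex P s \<subseteq> (\<lambda>x. \<rho> (point P s x)) ` cell P s"
    proof
      fix y assume "y \<in> \<rho> ` closed_simplex P s"
      then obtain p where p: "y = \<rho> p" "carrier_simplex P p \<subseteq> s" by (auto simp: closed_simplex_def)
      then show "y \<in> (\<lambda>x. \<rho> (point P s x)) ` cell P s"
        by (intro image_eqI[of _ _ "coord P s p"]) (simp_all add: S.point_coord S.coord_in_cell)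
    qed
    ultimately show ?thesis by (rule bounded_subset)
  qed
  have "bounded (\<Union>s\<in>?T. \<rho> ` closed_simplex P s)" using fT bs by (intro bounded_UN) auto
  then obtain B where B: "\<forall>y\<in>(\<Union>s\<in>?T. \<rho> ` closed_simplex P s). \<bar>y\<bar> \<le> B"
    unfolding bounded_iff real_norm_def by (rule exE)
  have "\<bar>\<rho> p\<bar> \<le> \<bar>B\<bar> + 1" for p
  proof (cases "\<rho> p = 0")
    case False
    then have "p \<in> {p. \<rho> p \<noteq> 0}" by simp
    then have "p \<in> ?D" by (rule subsetD[OF closure_subset])
    then have "p \<in> (\<Union>s\<in>?T. closed_simplex P s)" by (rule subsetD[OF cover])
    then obtain s where s: "s \<in> ?T" "p \<in> closed_simplex P s" by (rule UN_E)
    have "\<rho> p \<in> (\<Union>s\<in>?T. \<rho> ` closed_simplex P s)" using s(1) by (rule UN_I) (rule imageI[OF s(2)])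
    then have "\<bar>\<rho> p\<bar> \<le> B" using B by (rule bspec[rotated])
    then show ?thesis by linarith
  qed simp
  then show ?thesis by (intro exI[of _ "\<bar>B\<bar> + 1"]) simp
qed

lemma carrier_maximal_AE: "AE p in vol P. carrier_simplex P p \<in> maxs P"
  unfolding AE_vol_iff
proof
  fix s assume s: "s \<in> maxs P"
  interpret S: riem_simplex P s using s by (rule riem_simplexI)
  have "{x \<in> interior (cell P s). carrier_simplex P (point P s x) \<notin> maxs P} = {}"
    using S.carrier_point_interior s by auto
  then show "negligible {x \<in> interior (cell P s). carrier_simplex P (point P s x) \<notin> maxs P}"
    by (simp only: negligible_empty)
qed

lemma point_coord_carrier:
  assumes "carrier_simplex P p \<in> maxs P"
  shows "point P (carrier_simplex P p) (coord P (carrier_simplex P p) p) = p"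
proof -
  interpret S: riem_simplex P "carrier_simplex P p" using assms by (rule riem_simplexI)
  show ?thesis by (rule S.point_coord) simp
qed

lemma egrad_zero_if_locally_zero:
  assumes p: "carrier_simplex P p \<in> maxs P" and N: "open N" "p \<in> N" and z: "\<And>q. q \<in> N \<Longrightarrow> u q = 0"
  shows "egrad u p = 0"
proof -
  let ?s = "carrier_simplex P p" and ?x = "coord P (carrier_simplex P p) p"
  interpret S: riem_simplex P ?s using p by (rule riem_simplexI)
  have x: "?x \<in> S.chart_dom N"
    unfolding S.chart_dom_def using S.coord_in_interior[of p] point_coord_carrier[OF p] N(2) by simp
  have "GDERIV (\<lambda>x. 0) ?x :> (0 :: real^'n)" by (rule GDERIV_const)
  then have "GDERIV (\<lambda>x. u (point P ?s x)) ?x :> 0"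
    by (rule GDERIV_transform_within_open[OF _ S.open_chart_dom[OF N(1)] x]) (simp add: S.chart_dom_def z)
  then show ?thesis by (rule egrad_eqI(1))
qed

text \<open>Where \<open>v\<close> lies strictly between \<open>0\<close> and \<open>1\<close> the truncation agrees with \<open>v\<close> nearby; elsewhere it attains
its minimum \<open>0\<close> or its maximum \<open>1\<close>, so a derivative can only vanish.\<close>

lemma egrad_clamp01:
  assumes v: "differentiable_pt v p" and w: "differentiable_pt (\<lambda>q. clamp01 (v q)) p" and p: "carrier_simplex P p \<in> maxs P"
  shows "egrad (\<lambda>q. clamp01 (v q)) p = egrad v p \<or> egrad (\<lambda>q. clamp01 (v q)) p = 0"
proof -
  let ?s = "carrier_simplex P p" and ?x = "coord P (carrier_simplex P p) p"
  let ?v = "\<lambda>x. v (point P ?s x)" and ?w = "\<lambda>x. clamp01 (v (point P ?s x))"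
  let ?D = "egrad (\<lambda>q. clamp01 (v q)) p"
  have px: "point P ?s ?x = p" by (rule point_coord_carrier[OF p])
  have vd: "GDERIV ?v ?x :> egrad v p" and wd: "GDERIV ?w ?x :> ?D"
    using v w by (simp_all add: differentiable_pt_def)
  have zero: "?D = 0" if "(\<forall>y\<in>UNIV. ?w y \<le> ?w ?x) \<or> (\<forall>y\<in>UNIV. ?w ?x \<le> ?w y)"
  proof -
    have "(\<lambda>h. h \<bullet> ?D) = (\<lambda>h. 0)"
      by (rule differential_zero_maxmin[OF UNIV_I open_UNIV wd[unfolded gderiv_def] that])
    then have "?D \<bullet> ?D = 0" by (rule fun_cong)
    then show ?thesis by simp
  qed
  show ?thesis
  proof (cases "v p \<le> 0 \<or> 1 \<le> v p")
    case True
    then have "(\<forall>y\<in>UNIV. ?w y \<le> ?w ?x) \<or> (\<forall>y\<in>UNIV. ?w ?x \<le> ?w y)"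
      using clamp01_bounds by (auto simp: px) (auto simp: clamp01_def)
    then show ?thesis using zero by simp
  next
    case False
    have "isCont ?v ?x" using vd unfolding gderiv_def by (rule has_derivative_continuous)
    then have "(?v \<longlongrightarrow> v p) (at ?x)" by (simp add: isCont_def px)
    then have "\<forall>\<^sub>F x in at ?x. 0 < ?v x \<and> ?v x < 1"
      using False by (intro eventually_conj order_tendstoD) auto
    then have "\<forall>\<^sub>F x in at ?x. ?v x = ?w x" by eventually_elim (simp add: clamp01_def)
    then have "GDERIV ?w ?x :> egrad v p"
      using vd False unfolding gderiv_def
      by (intro has_derivative_transform_eventually[of ?v _ ?x UNIV ?w]) (auto simp: px clamp01_def)
    then show ?thesis using wd GDERIV_unique by blast
  qed
qed

lemma egrad_mult:
  assumes v: "differentiable_pt v p" and w: "differentiable_pt w p" and p: "carrier_simplex P p \<in> maxs P"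
  shows "egrad (\<lambda>q. v q * w q) p = v p *\<^sub>R egrad w p + w p *\<^sub>R egrad v p"
proof -
  have px: "point P (carrier_simplex P p) (coord P (carrier_simplex P p) p) = p" by (rule point_coord_carrier[OF p])
  show ?thesis
    using GDERIV_mult[OF v[unfolded differentiable_pt_def] w[unfolded differentiable_pt_def]]
    by (intro egrad_eqI(1)) (simp add: px)
qed

lemma egrad_affine:
  assumes v: "differentiable_pt v p"
  shows "differentiable_pt (\<lambda>q. a + b * v q) p" "egrad (\<lambda>q. a + b * v q) p = b *\<^sub>R egrad v p"
proof -
  have "GDERIV (\<lambda>x. a + b * v (point P (carrier_simplex P p) x)) (coord P (carrier_simplex P p) p) :> b *\<^sub>R egrad v p"
    using v unfolding differentiable_pt_def gderiv_def by (auto intro!: derivative_eq_intros)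
  from egrad_eqI[of "\<lambda>q. a + b * v q", OF this]
  show "differentiable_pt (\<lambda>q. a + b * v q) p" "egrad (\<lambda>q. a + b * v q) p = b *\<^sub>R egrad v p" by simp_all
qed

lemma Forms_parallelogram:
  assumes A: "A \<in> Forms"
  shows "a \<bullet> (A *v a) \<le> 2 * ((a - b) \<bullet> (A *v (a - b))) + 2 * (b \<bullet> (A *v b))"
proof -
  have "0 \<le> (a - 2 *\<^sub>R b) \<bullet> (A *v (a - 2 *\<^sub>R b))" by (rule Forms_nonneg[OF A])
  then show ?thesis
    using Forms_symmetric[OF A, of a b]
    by (simp add: matrix_vector_mult_diff_distrib matrix_vector_mult_scaleR inner_diff algebra_simps)
qed

lemma lip_on_compose_contraction:
  assumes v: "lip_on P U v" and le: "\<And>x y. \<bar>w x - w y\<bar> \<le> \<bar>v x - v y\<bar>"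
  shows "lip_on P U w"
proof -
  obtain L where L: "L \<ge> 0" "\<forall>x\<in>U. \<forall>y\<in>U. ennreal \<bar>v x - v y\<bar> \<le> ennreal L * intrinsic_dist P x y"
    using v unfolding lip_on_def by (elim exE conjE)
  have "\<forall>x\<in>U. \<forall>y\<in>U. ennreal \<bar>w x - w y\<bar> \<le> ennreal L * intrinsic_dist P x y"
  proof (intro ballI)
    fix x y assume xy: "x \<in> U" "y \<in> U"
    have "ennreal \<bar>w x - w y\<bar> \<le> ennreal \<bar>v x - v y\<bar>" by (intro ennreal_leI le)
    also have "\<dots> \<le> ennreal L * intrinsic_dist P x y" using L(2) xy by simp
    finally show "ennreal \<bar>w x - w y\<bar> \<le> ennreal L * intrinsic_dist P x y" .
  qed
  then show ?thesis unfolding lip_on_def using L(1) by (intro exI[of _ L] conjI)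
qed

lemma sobolev_grad_UNIV_measurable:
  assumes "has_sobolev_grad P UNIV u G"
  shows "u \<in> borel_measurable (vol P)" "G \<in> borel_measurable (vol P)"
  using assms unfolding has_sobolev_grad_def by (simp_all add: measurable_restrict_space_UNIV)

text \<open>Take a competitor \<open>u\<close> of small energy for the capacity of \<open>D\<close>, approximate it by a Lipschitz function \<open>v\<close> of
compact support and truncate \<open>v\<close> to \<open>[0, 1]\<close>. Truncation does not increase the energy, and where \<open>u \<ge> 1\<close> the
distance of the truncation to \<open>1\<close> is at most \<open>\<bar>v - u\<bar>\<close>.\<close>

lemma parabolic_cutoff:
  assumes par: "parabolic P UNIV" and D: "compact D" and e: "e > 0"
  shows "\<exists>w. lip_on P UNIV w \<and> compact (closure {p. w p \<noteq> 0}) \<and> (\<forall>p. 0 \<le> w p \<and> w p \<le> 1) \<and>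
    (\<integral>\<^sup>+p. ennreal ((gnorm P p (lip_grad P w p))\<^sup>2) \<partial>vol P) \<le> ennreal e \<and>
    (\<integral>\<^sup>+p. ennreal (indicator D p * (1 - w p)\<^sup>2) \<partial>vol P) \<le> ennreal e"
proof -
  have "capacity P D UNIV = 0" using par D by (simp add: parabolic_def)
  \<comment> \<open>The parallelogram inequality doubles both the energy of \<open>u\<close> and the error of the approximation.\<close>
  then have "capacity P D UNIV < ennreal (e/4)" using e by simp
  then obtain u N where u: "u \<in> W12_0 P UNIV" and N: "open N" "D \<subseteq> N" "AE p in vol P. p \<in> N \<longrightarrow> 1 \<le> u p"
    and en: "(\<integral>\<^sup>+p\<in>UNIV. ennreal ((gnorm P p (sobolev_grad P UNIV u p))\<^sup>2) \<partial>vol P) < ennreal (e/4)"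
    unfolding capacity_def INF_less_iff by auto
  define G where "G = sobolev_grad P UNIV u"
  have "u \<in> W12 P UNIV" using u by (simp add: W12_0_def)
  then have sG: "has_sobolev_grad P UNIV u G"
    unfolding G_def W12_def sobolev_grad_def mem_Collect_eq by (rule someI_ex)
  note um = sobolev_grad_UNIV_measurable[OF sG]
  obtain V where V: "\<forall>k. V k \<in> Lip_c P UNIV"
    "(\<lambda>k. sobolev_sq P UNIV (\<lambda>p. V k p - u p) (\<lambda>p. lip_grad P (V k) p - G p)) \<longlonglongrightarrow> 0"
    using u unfolding W12_0_def mem_Collect_eq G_def by (elim conjE exE)
  have "\<forall>\<^sub>F k in sequentially. sobolev_sq P UNIV (\<lambda>p. V k p - u p) (\<lambda>p. lip_grad P (V k) p - G p) < ennreal (e/4)"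
    using V(2) by (rule order_tendstoD) (use e in simp)
  then obtain k where k: "sobolev_sq P UNIV (\<lambda>p. V k p - u p) (\<lambda>p. lip_grad P (V k) p - G p) < ennreal (e/4)"
    by (auto simp: eventually_sequentially)
  define v where "v = V k"
  have v: "lip_on P UNIV v" "compact (closure {p. v p \<noteq> 0})"
    using V(1) by (auto simp: v_def Lip_c_def)
  define w where "w p = clamp01 (v p)" for p
  have w: "lip_on P UNIV w"
    by (rule lip_on_compose_contraction[OF v(1)]) (simp add: w_def clamp01_lipschitz)
  have wsupp: "compact (closure {p. w p \<noteq> 0})"
  proof -
    have "closure {p. w p \<noteq> 0} \<subseteq> closure {p. v p \<noteq> 0}"
      by (intro closure_mono) (auto simp: w_def clamp01_def)
    then show ?thesis
      using compact_Int_closed[OF v(2) closed_closure[of "{p. w p \<noteq> 0}"]] by (simp add: Int_absorb1)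
  qed
  let ?q = "\<lambda>p. (v p - u p)\<^sup>2 + (gnorm P p (lip_grad P v p - G p))\<^sup>2"
  have qm: "(\<lambda>p. ennreal (?q p)) \<in> borel_measurable (vol P)"
    using sobolev_integrand_measurable[OF open_UNIV v(1), of u G] um by (simp add: measurable_restrict_space_UNIV)
  have qi: "(\<integral>\<^sup>+p. ennreal (?q p) \<partial>vol P) \<le> ennreal (e/4)"
    using k by (simp add: sobolev_sq_def v_def[symmetric])
  have Gi: "(\<integral>\<^sup>+p. ennreal ((gnorm P p (G p))\<^sup>2) \<partial>vol P) \<le> ennreal (e/4)"
    using en by (simp add: G_def)
  have Gm: "(\<lambda>p. ennreal ((gnorm P p (G p))\<^sup>2)) \<in> borel_measurable (vol P)"
    using gnorm_measurable[OF um(2)] by measurable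
  have "(\<integral>\<^sup>+p. ennreal ((gnorm P p (lip_grad P w p))\<^sup>2) \<partial>vol P)
      \<le> (\<integral>\<^sup>+p. 2 * ennreal (?q p) + 2 * ennreal ((gnorm P p (G p))\<^sup>2) \<partial>vol P)"
  proof (rule nn_integral_mono_AE)
    show "AE p in vol P. ennreal ((gnorm P p (lip_grad P w p))\<^sup>2) \<le> 2 * ennreal (?q p) + 2 * ennreal ((gnorm P p (G p))\<^sup>2)"
      using lip_on_differentiable_pt_AE[OF v(1)] lip_on_differentiable_pt_AE[OF w] carrier_maximal_AE g_at_Forms_AE
    proof eventually_elim
      case (elim p)
      note sq = gnorm_square[OF elim(4)]
      have "egrad w p = egrad v p \<or> egrad w p = 0"
        using egrad_clamp01[OF elim(1) _ elim(3)] elim(2) unfolding w_def[abs_def] .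
      then have "lip_grad P w p = lip_grad P v p \<or> lip_grad P w p = 0"
        by (auto simp: lip_grad_egrad)
      moreover have "0 \<le> (gnorm P p (lip_grad P v p))\<^sup>2" by simp
      ultimately have "(gnorm P p (lip_grad P w p))\<^sup>2 \<le> (gnorm P p (lip_grad P v p))\<^sup>2"
        by (auto simp: gnorm_def ginner_def)
      also have "\<dots> \<le> 2 * (gnorm P p (lip_grad P v p - G p))\<^sup>2 + 2 * (gnorm P p (G p))\<^sup>2"
        unfolding sq ginner_def by (rule Forms_parallelogram[OF elim(4)])
      also have "\<dots> \<le> 2 * ?q p + 2 * (gnorm P p (G p))\<^sup>2" by simp
      finally have "ennreal ((gnorm P p (lip_grad P w p))\<^sup>2) \<le> ennreal (2 * ?q p + 2 * (gnorm P p (G p))\<^sup>2)"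
        by (rule ennreal_leI)
      also have "\<dots> = 2 * ennreal (?q p) + 2 * ennreal ((gnorm P p (G p))\<^sup>2)"
        by (subst ennreal_plus) (auto simp: ennreal_mult)
      finally show ?case .
    qed
  qed
  also have "\<dots> = 2 * (\<integral>\<^sup>+p. ennreal (?q p) \<partial>vol P) + 2 * (\<integral>\<^sup>+p. ennreal ((gnorm P p (G p))\<^sup>2) \<partial>vol P)"
  proof -
    define q1 where "q1 p = ennreal (?q p)" for p
    define q2 where "q2 p = ennreal ((gnorm P p (G p))\<^sup>2)" for p
    have [measurable]: "q1 \<in> borel_measurable (vol P)" "q2 \<in> borel_measurable (vol P)"
      using qm Gm unfolding q1_def[abs_def] q2_def[abs_def] .
    have "(\<integral>\<^sup>+p. 2 * q1 p + 2 * q2 p \<partial>vol P) = 2 * (\<integral>\<^sup>+p. q1 p \<partial>vol P) + 2 * (\<integral>\<^sup>+p. q2 p \<partial>vol P)"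
      by (simp add: nn_integral_add nn_integral_cmult)
    then show ?thesis unfolding q1_def q2_def .
  qed
  also have "\<dots> \<le> 2 * ennreal (e/4) + 2 * ennreal (e/4)"
    by (intro add_mono mult_left_mono qi Gi) auto
  also have "\<dots> = ennreal 2 * ennreal (e/4) + ennreal 2 * ennreal (e/4)" by simp
  also have "\<dots> = ennreal e"
    using e by (simp add: ennreal_mult[symmetric] ennreal_plus[symmetric] del: ennreal_plus ennreal_numeral)
  finally have energy: "(\<integral>\<^sup>+p. ennreal ((gnorm P p (lip_grad P w p))\<^sup>2) \<partial>vol P) \<le> ennreal e" .
  have "(\<integral>\<^sup>+p. ennreal (indicator D p * (1 - w p)\<^sup>2) \<partial>vol P) \<le> (\<integral>\<^sup>+p. ennreal (?q p) \<partial>vol P)"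
  proof (rule nn_integral_mono_AE)
    show "AE p in vol P. ennreal (indicator D p * (1 - w p)\<^sup>2) \<le> ennreal (?q p)"
      using N(3)
    proof eventually_elim
      case (elim p)
      have "indicator D p * (1 - w p)\<^sup>2 \<le> (v p - u p)\<^sup>2"
      proof (cases "p \<in> D")
        case True
        then have "1 \<le> u p" using elim N(2) by auto
        then have "\<bar>1 - w p\<bar> \<le> \<bar>v p - u p\<bar>" by (auto simp: w_def clamp01_def)
        then show ?thesis using True by (simp add: abs_le_square_iff)
      qed simp
      also have "\<dots> \<le> ?q p" by simp
      finally show ?case by (rule ennreal_leI)
    qed
  qed
  also have "\<dots> \<le> ennreal (e/4)" by (rule qi)
  also have "\<dots> \<le> ennreal e" using e by (intro ennreal_leI) simp
  finally have near: "(\<integral>\<^sup>+p. ennreal (indicator D p * (1 - w p)\<^sup>2) \<partial>vol P) \<le> ennreal e" .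
  have "\<forall>p. 0 \<le> w p \<and> w p \<le> 1" by (simp add: w_def clamp01_bounds)
  with w wsupp energy near show ?thesis by (intro exI[of _ w] conjI)
qed

text \<open>Boundedness of both factors makes their product Lipschitz; the intrinsic distance may be infinite, so the
estimate is made in the extended reals.\<close>

lemma lip_on_cutoff_product:
  assumes w: "lip_on P UNIV w" "\<And>p. \<bar>w p\<bar> \<le> 1" and \<rho>: "lip_on P UNIV \<rho>" "\<And>p. \<bar>\<rho> p\<bar> \<le> M"
    and \<sigma>: "\<bar>\<sigma>\<bar> = 1" and M: "M > 0"
  shows "lip_on P UNIV (\<lambda>p. w p * (M + \<sigma> * \<rho> p))"
proof -
  obtain L where L: "L \<ge> 0" "\<forall>x\<in>UNIV. \<forall>y\<in>UNIV. ennreal \<bar>w x - w y\<bar> \<le> ennreal L * intrinsic_dist P x y"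
    using w(1) unfolding lip_on_def by (elim exE conjE)
  obtain L' where L': "L' \<ge> 0" "\<forall>x\<in>UNIV. \<forall>y\<in>UNIV. ennreal \<bar>\<rho> x - \<rho> y\<bar> \<le> ennreal L' * intrinsic_dist P x y"
    using \<rho>(1) unfolding lip_on_def by (elim exE conjE)
  have "ennreal \<bar>w x * (M + \<sigma> * \<rho> x) - w y * (M + \<sigma> * \<rho> y)\<bar> \<le> ennreal (2 * M * L + L') * intrinsic_dist P x y" for x y
  proof -
    have "w x * (M + \<sigma> * \<rho> x) - w y * (M + \<sigma> * \<rho> y) = (w x - w y) * (M + \<sigma> * \<rho> x) + w y * (\<sigma> * (\<rho> x - \<rho> y))"
      by (simp add: algebra_simps)
    then have "\<bar>w x * (M + \<sigma> * \<rho> x) - w y * (M + \<sigma> * \<rho> y)\<bar> \<le> \<bar>w x - w y\<bar> * \<bar>M + \<sigma> * \<rho> x\<bar> + \<bar>w y\<bar> * (\<bar>\<sigma>\<bar> * \<bar>\<rho> x - \<rho> y\<bar>)"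
      by (metis abs_mult abs_triangle_ineq)
    also have "\<dots> \<le> \<bar>w x - w y\<bar> * (2 * M) + 1 * (1 * \<bar>\<rho> x - \<rho> y\<bar>)"
    proof (intro add_mono mult_mono)
      have "\<bar>\<sigma> * \<rho> x\<bar> \<le> M" using \<rho>(2)[of x] \<sigma> by (simp add: abs_mult)
      then show "\<bar>M + \<sigma> * \<rho> x\<bar> \<le> 2 * M" using M by linarith
    qed (use w(2) \<sigma> in auto)
    finally have "ennreal \<bar>w x * (M + \<sigma> * \<rho> x) - w y * (M + \<sigma> * \<rho> y)\<bar> \<le> ennreal (2 * M * \<bar>w x - w y\<bar> + \<bar>\<rho> x - \<rho> y\<bar>)"
      by (intro ennreal_leI) (simp add: mult_ac)
    also have "\<dots> = ennreal (2 * M) * ennreal \<bar>w x - w y\<bar> + ennreal \<bar>\<rho> x - \<rho> y\<bar>"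
      using M by (simp add: ennreal_plus ennreal_mult[of "2 * M"])
    also have "\<dots> \<le> ennreal (2 * M) * (ennreal L * intrinsic_dist P x y) + ennreal L' * intrinsic_dist P x y"
      using L(2) L'(2) by (intro add_mono mult_left_mono) auto
    also have "\<dots> = (ennreal (2 * M) * ennreal L + ennreal L') * intrinsic_dist P x y"
      by (simp only: distrib_right mult.assoc)
    also have "ennreal (2 * M) * ennreal L + ennreal L' = ennreal (2 * M * L + L')"
      using M L(1) L'(1) by (simp add: ennreal_plus ennreal_mult[of "2 * M" L])
    finally show ?thesis .
  qed
  moreover have "0 \<le> 2 * M * L + L'" using M L(1) L'(1) by simp
  ultimately show ?thesis unfolding lip_on_def by (intro exI[of _ "2 * M * L + L'"]) simp
qed

lemma gradient_square_integral_finite: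
  assumes "grad_Lp_norm P 2 f < \<infinity>"
  shows "(\<integral>\<^sup>+p. ennreal ((gnorm P p (loc_grad P f p))\<^sup>2) \<partial>vol P) < \<infinity>"
proof -
  have "(\<integral>\<^sup>+p. ennreal (gnorm P p (loc_grad P f p) powr 2) \<partial>vol P) \<noteq> \<infinity>"
    using assms by (auto simp: grad_Lp_norm_def Let_def split: if_splits)
  moreover have "(\<integral>\<^sup>+p. ennreal (gnorm P p (loc_grad P f p) powr 2) \<partial>vol P)
      = (\<integral>\<^sup>+p. ennreal ((gnorm P p (loc_grad P f p))\<^sup>2) \<partial>vol P)"
  proof (rule nn_integral_cong_AE)
    show "AE p in vol P. ennreal (gnorm P p (loc_grad P f p) powr 2) = ennreal ((gnorm P p (loc_grad P f p))\<^sup>2)"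
      using g_at_Forms_AE
    proof eventually_elim
      case (elim p)
      have "0 \<le> gnorm P p (loc_grad P f p)"
        unfolding gnorm_def ginner_def using Forms_nonneg[OF elim] by simp
      then show ?case by (simp add: powr_numeral)
    qed
  qed
  ultimately show ?thesis by (simp add: less_top)
qed

lemma ginner_abs_le:
  assumes "g_at P p \<in> Forms"
  shows "\<bar>ginner P p \<xi> \<eta>\<bar> \<le> gnorm P p \<xi> * gnorm P p \<eta>"
proof -
  have "(ginner P p \<xi> \<eta>)\<^sup>2 \<le> ginner P p \<xi> \<xi> * ginner P p \<eta> \<eta>"
    unfolding ginner_def by (rule Forms_Cauchy_Schwarz[OF assms])
  then have "sqrt ((ginner P p \<xi> \<eta>)\<^sup>2) \<le> sqrt (ginner P p \<xi> \<xi> * ginner P p \<eta> \<eta>)"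
    by (rule real_sqrt_le_mono)
  then show ?thesis by (simp add: gnorm_def real_sqrt_mult)
qed

lemma ginner_L1_bound:
  assumes \<xi>: "\<xi> \<in> borel_measurable (vol P)" and \<eta>: "\<eta> \<in> borel_measurable (vol P)"
  shows "(\<integral>\<^sup>+p. ennreal \<bar>ginner P p (\<xi> p) (\<eta> p)\<bar> \<partial>vol P)\<^sup>2
    \<le> (\<integral>\<^sup>+p. ennreal ((gnorm P p (\<xi> p))\<^sup>2) \<partial>vol P) * (\<integral>\<^sup>+p. ennreal ((gnorm P p (\<eta> p))\<^sup>2) \<partial>vol P)"
proof -
  have "(\<integral>\<^sup>+p. ennreal \<bar>ginner P p (\<xi> p) (\<eta> p)\<bar> \<partial>vol P)
      \<le> (\<integral>\<^sup>+p. ennreal \<bar>gnorm P p (\<xi> p)\<bar> * ennreal \<bar>gnorm P p (\<eta> p)\<bar> \<partial>vol P)"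
  proof (rule nn_integral_mono_AE)
    show "AE p in vol P. ennreal \<bar>ginner P p (\<xi> p) (\<eta> p)\<bar> \<le> ennreal \<bar>gnorm P p (\<xi> p)\<bar> * ennreal \<bar>gnorm P p (\<eta> p)\<bar>"
      using g_at_Forms_AE
    proof eventually_elim
      case (elim p)
      have "\<bar>ginner P p (\<xi> p) (\<eta> p)\<bar> \<le> \<bar>gnorm P p (\<xi> p)\<bar> * \<bar>gnorm P p (\<eta> p)\<bar>"
        using ginner_abs_le[OF elim, of "\<xi> p" "\<eta> p"] by (simp add: abs_mult[symmetric])
      then show ?case by (simp add: ennreal_mult[symmetric] ennreal_leI)
    qed
  qed
  then have "(\<integral>\<^sup>+p. ennreal \<bar>ginner P p (\<xi> p) (\<eta> p)\<bar> \<partial>vol P)\<^sup>2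
      \<le> (\<integral>\<^sup>+p. ennreal \<bar>gnorm P p (\<xi> p)\<bar> * ennreal \<bar>gnorm P p (\<eta> p)\<bar> \<partial>vol P)\<^sup>2"
    by (rule power_mono) simp
  also have "\<dots> \<le> (\<integral>\<^sup>+p. (ennreal \<bar>gnorm P p (\<xi> p)\<bar>)\<^sup>2 \<partial>vol P) * (\<integral>\<^sup>+p. (ennreal \<bar>gnorm P p (\<eta> p)\<bar>)\<^sup>2 \<partial>vol P)"
  proof (rule Cauchy_Schwarz_nn_integral)
    note [measurable] = gnorm_measurable[OF \<xi>] gnorm_measurable[OF \<eta>]
    show "(\<lambda>p. ennreal \<bar>gnorm P p (\<xi> p)\<bar>) \<in> borel_measurable (vol P)" by measurable
    show "(\<lambda>p. ennreal \<bar>gnorm P p (\<eta> p)\<bar>) \<in> borel_measurable (vol P)" by measurable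
  qed
  finally show ?thesis by (simp add: ennreal_power)
qed

text \<open>Subharmonicity tested with \<open>w (M + \<sigma> \<rho>)\<close>, expanded by the product rule. The sign \<open>\<sigma>\<close> allows both signs of
\<open>\<rho>\<close> to be treated at once.\<close>

lemma cutoff_test_inequality:
  assumes sub: "weakly_subharmonic P f" and G2: "(\<integral>\<^sup>+p. ennreal ((gnorm P p (loc_grad P f p))\<^sup>2) \<partial>vol P) < \<infinity>"
    and \<rho>: "\<rho> \<in> Lip_c P UNIV" "\<And>p. \<bar>\<rho> p\<bar> \<le> M" and M: "M > 0" and \<sigma>: "\<bar>\<sigma>\<bar> = 1"
    and T: "integrable (vol P) (\<lambda>p. ginner P p (loc_grad P f p) (lip_grad P \<rho> p))"
    and w: "lip_on P UNIV w" "compact (closure {p. w p \<noteq> 0})" "\<And>p. 0 \<le> w p \<and> w p \<le> 1"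
    and wE: "(\<integral>\<^sup>+p. ennreal ((gnorm P p (lip_grad P w p))\<^sup>2) \<partial>vol P) < \<infinity>"
  shows "integrable (vol P) (\<lambda>p. ginner P p (loc_grad P f p) (lip_grad P w p))"
    and "\<sigma> * (\<integral>p. ginner P p (loc_grad P f p) (lip_grad P \<rho> p) * w p \<partial>vol P)
      \<le> - (\<integral>p. ginner P p (loc_grad P f p) (lip_grad P w p) * (M + \<sigma> * \<rho> p) \<partial>vol P)"
proof -
  let ?G = "loc_grad P f"
  let ?A = "\<lambda>p. ginner P p (?G p) (lip_grad P w p)" and ?T = "\<lambda>p. ginner P p (?G p) (lip_grad P \<rho> p)"
  have f: "f \<in> W12_loc P" using sub by (simp add: weakly_subharmonic_def)
  note Gm = loc_grad_measurable[OF f]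
  have \<rho>l: "lip_on P UNIV \<rho>" using \<rho>(1) by (simp add: Lip_c_def)
  note wm = lip_on_measurable[OF w(1)] and \<rho>m = lip_on_measurable[OF \<rho>l]
  define \<phi> where "\<phi> p = w p * (M + \<sigma> * \<rho> p)" for p
  have \<sigma>\<rho>: "\<bar>\<sigma> * \<rho> p\<bar> \<le> M" for p using \<rho>(2)[of p] \<sigma> by (simp add: abs_mult)
  have wabs: "\<bar>w p\<bar> \<le> 1" for p using w(3)[of p] by (simp add: abs_of_nonneg)
  have \<phi>l: "lip_on P UNIV \<phi>"
    unfolding \<phi>_def[abs_def] by (rule lip_on_cutoff_product[OF w(1) wabs \<rho>l \<rho>(2) \<sigma> M])
  have "closure {p. \<phi> p \<noteq> 0} \<subseteq> closure {p. w p \<noteq> 0}"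
    by (intro closure_mono) (auto simp: \<phi>_def)
  then have "compact (closure {p. \<phi> p \<noteq> 0})"
    using compact_Int_closed[OF w(2) closed_closure[of "{p. \<phi> p \<noteq> 0}"]] by (simp add: Int_absorb1)
  then have \<phi>c: "\<phi> \<in> Lip_c P UNIV" using \<phi>l by (simp add: Lip_c_def)
  have \<phi>0: "\<forall>p. 0 \<le> \<phi> p"
  proof
    fix p
    have "0 \<le> M + \<sigma> * \<rho> p" using \<sigma>\<rho>[of p] by linarith
    then show "0 \<le> \<phi> p" using w(3)[of p] by (simp add: \<phi>_def)
  qed
  have Am: "?A \<in> borel_measurable (vol P)" by (rule ginner_measurable[OF Gm wm(2)])
  have Afin: "(\<integral>\<^sup>+p. ennreal \<bar>?A p\<bar> \<partial>vol P) < \<infinity>"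
  proof -
    have "(\<integral>\<^sup>+p. ennreal \<bar>?A p\<bar> \<partial>vol P)\<^sup>2 < \<infinity>"
      by (rule le_less_trans[OF ginner_L1_bound[OF Gm wm(2)]]) (use G2 wE in \<open>simp add: ennreal_mult_less_top\<close>)
    then show ?thesis by (simp add: power2_eq_square ennreal_mult_less_top less_top[symmetric] ennreal_mult_eq_top_iff)
  qed
  show Ai: "integrable (vol P) ?A" using Am Afin by (intro integrableI_bounded) auto
  have c1: "(\<lambda>p. M + \<sigma> * \<rho> p) \<in> borel_measurable (vol P)" using \<rho>m(1) by measurable
  have c1b: "AE p in vol P. \<bar>M + \<sigma> * \<rho> p\<bar> \<le> 2 * M"
    using \<sigma>\<rho> M by (intro AE_I2) (smt (verit))
  have i1: "integrable (vol P) (\<lambda>p. ?A p * (M + \<sigma> * \<rho> p))" by (rule integrable_mult_AE_bounded[OF Ai c1 c1b])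
  have wb: "AE p in vol P. \<bar>w p\<bar> \<le> 1" using w(3) by (intro AE_I2) (simp add: abs_of_nonneg)
  have i2: "integrable (vol P) (\<lambda>p. ?T p * w p)" by (rule integrable_mult_AE_bounded[OF T wm(1) wb])
  have "(\<integral>p. ginner P p (?G p) (lip_grad P \<phi> p) \<partial>vol P) = (\<integral>p. ?A p * (M + \<sigma> * \<rho> p) + \<sigma> * (?T p * w p) \<partial>vol P)"
  proof (rule integral_cong_AE)
    show "(\<lambda>p. ginner P p (?G p) (lip_grad P \<phi> p)) \<in> borel_measurable (vol P)"
      by (rule ginner_measurable[OF Gm lip_on_measurable(2)[OF \<phi>l]])
    show "(\<lambda>p. ?A p * (M + \<sigma> * \<rho> p) + \<sigma> * (?T p * w p)) \<in> borel_measurable (vol P)"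
      using i1 i2 by (intro borel_measurable_integrable Bochner_Integration.integrable_add integrable_mult_right)
    show "AE p in vol P. ginner P p (?G p) (lip_grad P \<phi> p) = ?A p * (M + \<sigma> * \<rho> p) + \<sigma> * (?T p * w p)"
      using lip_on_differentiable_pt_AE[OF w(1)] lip_on_differentiable_pt_AE[OF \<rho>l] carrier_maximal_AE g_at_Forms_AE
    proof eventually_elim
      case (elim p)
      have "egrad \<phi> p = w p *\<^sub>R (\<sigma> *\<^sub>R egrad \<rho> p) + (M + \<sigma> * \<rho> p) *\<^sub>R egrad w p"
        using egrad_mult[OF elim(1) egrad_affine(1)[OF elim(2)] elim(3), of M \<sigma>]
        unfolding \<phi>_def[abs_def] egrad_affine(2)[OF elim(2)] .
      then show ?case
        by (simp add: ginner_lip_grad[OF elim(4)] inner_add_right algebra_simps)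
    qed
  qed
  also have "\<dots> = (\<integral>p. ?A p * (M + \<sigma> * \<rho> p) \<partial>vol P) + \<sigma> * (\<integral>p. ?T p * w p \<partial>vol P)"
    using i1 i2 by (subst Bochner_Integration.integral_add) auto
  finally have eq: "(\<integral>p. ginner P p (?G p) (lip_grad P \<phi> p) \<partial>vol P)
      = (\<integral>p. ?A p * (M + \<sigma> * \<rho> p) \<partial>vol P) + \<sigma> * (\<integral>p. ?T p * w p \<partial>vol P)" .
  have "(\<integral>p. ginner P p (?G p) (lip_grad P \<phi> p) \<partial>vol P) \<le> 0"
    using sub \<phi>c \<phi>0 unfolding weakly_subharmonic_def by (elim conjE) (drule bspec, assumption, simp)
  then show "\<sigma> * (\<integral>p. ?T p * w p \<partial>vol P) \<le> - (\<integral>p. ?A p * (M + \<sigma> * \<rho> p) \<partial>vol P)"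
    unfolding eq by linarith
qed

lemma signed_weak_inequality:
  assumes par: "parabolic P UNIV" and sub: "weakly_subharmonic P f"
    and G2: "(\<integral>\<^sup>+p. ennreal ((gnorm P p (loc_grad P f p))\<^sup>2) \<partial>vol P) < \<infinity>"
    and \<rho>: "\<rho> \<in> Lip_c P UNIV"
    and T: "integrable (vol P) (\<lambda>p. ginner P p (loc_grad P f p) (lip_grad P \<rho> p))" and \<sigma>: "\<bar>\<sigma>\<bar> = 1"
  shows "\<sigma> * (\<integral>p. ginner P p (loc_grad P f p) (lip_grad P \<rho> p) \<partial>vol P) \<le> 0"
proof -
  let ?G = "loc_grad P f" and ?D = "closure {p. \<rho> p \<noteq> 0}"
  let ?T = "\<lambda>p. ginner P p (?G p) (lip_grad P \<rho> p)"
  have f: "f \<in> W12_loc P" using sub by (simp add: weakly_subharmonic_def)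
  note Gm = loc_grad_measurable[OF f]
  obtain M where M: "M > 0" "\<forall>p. \<bar>\<rho> p\<bar> \<le> M" using Lip_c_bounded[OF \<rho>] by (elim exE conjE)
  have \<rho>l: "lip_on P UNIV \<rho>" and D: "compact ?D" using \<rho> by (auto simp: Lip_c_def)
  define e where "e k = 1 / real (Suc k)" for k
  have e0: "e k > 0" for k by (simp add: e_def)
  have elim: "(\<lambda>k. ennreal (e k)) \<longlonglongrightarrow> 0"
    using tendsto_ennrealI[OF LIMSEQ_inverse_real_of_nat] unfolding e_def inverse_eq_divide by simp
  have "\<forall>k. \<exists>w. lip_on P UNIV w \<and> compact (closure {p. w p \<noteq> 0}) \<and> (\<forall>p. 0 \<le> w p \<and> w p \<le> 1) \<and>
    (\<integral>\<^sup>+p. ennreal ((gnorm P p (lip_grad P w p))\<^sup>2) \<partial>vol P) \<le> ennreal (e k) \<and>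
    (\<integral>\<^sup>+p. ennreal (indicator ?D p * (1 - w p)\<^sup>2) \<partial>vol P) \<le> ennreal (e k)"
    using parabolic_cutoff[OF par D e0] by (rule allI)
  from choice[OF this] obtain w where w: "\<forall>k. lip_on P UNIV (w k) \<and> compact (closure {p. w k p \<noteq> 0}) \<and> (\<forall>p. 0 \<le> w k p \<and> w k p \<le> 1) \<and>
    (\<integral>\<^sup>+p. ennreal ((gnorm P p (lip_grad P (w k) p))\<^sup>2) \<partial>vol P) \<le> ennreal (e k) \<and>
    (\<integral>\<^sup>+p. ennreal (indicator ?D p * (1 - w k p)\<^sup>2) \<partial>vol P) \<le> ennreal (e k)" by (rule exE)
  have wl: "lip_on P UNIV (w k)" and wc: "compact (closure {p. w k p \<noteq> 0})" and wb: "0 \<le> w k p \<and> w k p \<le> 1"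
    and wE: "(\<integral>\<^sup>+p. ennreal ((gnorm P p (lip_grad P (w k) p))\<^sup>2) \<partial>vol P) \<le> ennreal (e k)"
    and wD: "(\<integral>\<^sup>+p. ennreal (indicator ?D p * (1 - w k p)\<^sup>2) \<partial>vol P) \<le> ennreal (e k)" for k p
    using w by simp_all
  have wE': "(\<integral>\<^sup>+p. ennreal ((gnorm P p (lip_grad P (w k) p))\<^sup>2) \<partial>vol P) < \<infinity>" for k
    by (rule le_less_trans[OF wE]) simp
  have wD': "(\<integral>\<^sup>+p. ennreal (indicator ?D p * (1 - w k p)\<^sup>2) \<partial>vol P) < \<infinity>" for k
    by (rule le_less_trans[OF wD]) simp
  let ?A = "\<lambda>k p. ginner P p (?G p) (lip_grad P (w k) p)"
  note test = cutoff_test_inequality[OF sub G2 \<rho> M(2)[rule_format] M(1) \<sigma> T wl wc wb wE']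
  have A0: "(\<lambda>k. \<integral>\<^sup>+p. ennreal \<bar>?A k p - 0\<bar> \<partial>vol P) \<longlonglongrightarrow> 0"
  proof (rule tendsto_zero_if_square_le)
    let ?I = "\<integral>\<^sup>+p. ennreal ((gnorm P p (?G p))\<^sup>2) \<partial>vol P"
    show "(\<integral>\<^sup>+p. ennreal \<bar>?A k p - 0\<bar> \<partial>vol P)\<^sup>2 \<le> ?I * ennreal (e k)" for k
      using order_trans[OF ginner_L1_bound[OF Gm lip_on_measurable(2)[OF wl]] mult_left_mono[OF wE]] by simp
    show "(\<lambda>k. ?I * ennreal (e k)) \<longlonglongrightarrow> 0"
      using ennreal_tendsto_cmult[OF G2[unfolded infinity_ennreal_def] elim] by simp
  qed
  have \<rho>m: "(\<lambda>p. M + \<sigma> * \<rho> p) \<in> borel_measurable (vol P)" using lip_on_measurable(1)[OF \<rho>l] by measurable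
  have \<rho>b: "AE p in vol P. \<bar>M + \<sigma> * \<rho> p\<bar> \<le> 2 * M"
  proof (intro AE_I2)
    fix p
    have "\<bar>\<sigma> * \<rho> p\<bar> \<le> M" using M(2) \<sigma> by (simp add: abs_mult)
    then show "\<bar>M + \<sigma> * \<rho> p\<bar> \<le> 2 * M" using M(1) by linarith
  qed
  have Alim: "(\<lambda>k. \<integral>p. ?A k p * (M + \<sigma> * \<rho> p) \<partial>vol P) \<longlonglongrightarrow> (\<integral>p. 0 * (M + \<sigma> * \<rho> p) \<partial>vol P)"
    by (rule L1_limit_times_bounded[OF test(1) integrable_zero A0 \<rho>m \<rho>b])
  have off: "AE p in vol P. p \<notin> ?D \<longrightarrow> ?T p = 0"
    using carrier_maximal_AE g_at_Forms_AE
  proof eventually_elim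
    case (elim p)
    show ?case
    proof
      assume p: "p \<notin> ?D"
      have "egrad \<rho> p = 0"
        by (rule egrad_zero_if_locally_zero[OF elim(1), of "- ?D"])
           (use p closure_subset[of "{p. \<rho> p \<noteq> 0}"] in auto)
      then show "?T p = 0" by (simp add: ginner_lip_grad[OF elim(2)])
    qed
  qed
  have Dm: "?D \<in> sets (vol P)" unfolding vol_eq by (intro sets_completionI_sets) simp
  have "(\<lambda>k. \<integral>\<^sup>+p. ennreal (indicator ?D p * (1 - w k p)\<^sup>2) \<partial>vol P) \<longlonglongrightarrow> 0"
    by (rule tendsto_sandwich[OF _ _ tendsto_const elim])
       (rule always_eventually, rule allI, rule zero_le, rule always_eventually, rule allI, rule wD)
  from cutoff_limit[OF Dm lip_on_measurable(1)[OF wl] wb this wD' T off]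
  obtain r where r: "strict_mono r" "(\<lambda>k. \<integral>p. ?T p * w (r k) p \<partial>vol P) \<longlonglongrightarrow> (\<integral>p. ?T p \<partial>vol P)"
    by (elim exE conjE)
  have "(\<lambda>k. \<sigma> * (\<integral>p. ?T p * w (r k) p \<partial>vol P)) \<longlonglongrightarrow> \<sigma> * (\<integral>p. ?T p \<partial>vol P)"
    by (intro tendsto_mult tendsto_const r(2))
  moreover have "(\<lambda>k. - (\<integral>p. ?A (r k) p * (M + \<sigma> * \<rho> p) \<partial>vol P)) \<longlonglongrightarrow> - 0"
    using LIMSEQ_subseq_LIMSEQ[OF Alim r(1)] by (intro tendsto_minus) (simp add: comp_def)
  ultimately have "\<sigma> * (\<integral>p. ?T p \<partial>vol P) \<le> - 0"
    by (rule LIMSEQ_le) (intro exI allI impI, rule test(2))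
  then show ?thesis by simp
qed

end

section \<open>Harmonicity\<close>

theorem proposition5p4:
  fixes P :: "('e::euclidean_space, 'a::metric_space, 'n::finite) rpoly"
    and f :: "'a \<Rightarrow> real"
  assumes "riemannian_polyhedron P"
    and "pseudomanifold P"
    and "boundary_poly P = {}"
    and "parabolic P UNIV"
    and "f \<in> W12_loc P"
    and "continuous_on UNIV f"
    and "weakly_subharmonic P f"
    and "grad_Lp_norm P 1 f < \<infinity>"
    and "grad_Lp_norm P 2 f < \<infinity>"
  shows "harmonic_fun P f"
proof -
  interpret riem_poly P by unfold_locales (rule assms(1))
  have "(\<integral>p. ginner P p (loc_grad P f p) (lip_grad P \<rho> p) \<partial>vol P) = 0" if \<rho>: "\<rho> \<in> Lip_c P UNIV" for \<rho>
  proof (cases "integrable (vol P) (\<lambda>p. ginner P p (loc_grad P f p) (lip_grad P \<rho> p))")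
    case True
    note signed = signed_weak_inequality[OF assms(4,7) gradient_square_integral_finite[OF assms(9)] \<rho> True]
    show ?thesis using signed[of 1] signed[of "-1"] by simp
  next
    case False
    then show ?thesis by (rule not_integrable_integral_eq)
  qed
  then show ?thesis using assms(5,6) by (simp add: harmonic_fun_def weakly_harmonic_def)
qed

end
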